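(* Let $(r_n)_{n\in\mathbb{N}}$ be a sequence of deterministic radii with $0\le r_n<1$, at most one of which equals $0$, let $(\theta_n)_{n\in\mathbb{N}}$ be independent random variables uniformly distributed in $[0,2\pi)$, and let $\Lambda=\Lambda(\omega)=(\lambda_n(\omega))_{n\in\mathbb{N}}$ with $\lambda_n(\omega)=r_ne^{i\theta_n(\omega)}$. Let $X$ be either the Nevanlinna class $\mathcal{N}$ or the Smirnov class $\mathcal{N}^+$. Then $\Lambda$ is almost surely free interpolating for $X$ if and only if $\Lambda$ is a Blaschke sequence, i.e. $\sum_{n}(1-|\lambda_n|)=\sum_n(1-r_n)<\infty$.
   Context: $\mathbb{D}=\{z\in\mathbb{C}:|z|<1\}$, and $\mathrm{Hol}(\mathbb{D})$ is the set of holomorphic functions on $\mathbb{D}$. The Nevanlinna class is $$\mathcal{N}=\Big\{f\in\mathrm{Hol}(\mathbb{D}):\lim_{r\to1}\frac1{2\pi}\int_0^{2\pi}\log^+|f(re^{i\theta})|\,d\theta<\infty\Big\}.$$ Functions in $\mathcal{N}$ have non-tangential boundary values $f(e^{i\theta})$ almost everywhere. The Smirnov class is $$\mathcal{N}^+=\Big\{f\in\mathcal{N}:\lim_{r\to1}\frac1{2\pi}\int_0^{2\pi}\log^+|f(re^{i\theta})|\,d\theta=\frac1{2\pi}\int_0^{2\pi}\log^+|f(e^{i\theta})|\,d\theta<\infty\Big\}.$$ For a space $X$ of holomorphic functions on $\mathbb{D}$ and a sequence $\Lambda=(\lambda_n)_n$ in $\mathbb{D}$, the trace space is $X|_\Lambda=\{(f(\lambda_n))_n: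 f\in X\}$. The sequence $\Lambda$ is free interpolating for $X$ if $\ell^\infty\cdot X|_\Lambda\subset X|_\Lambda$ (pointwise products). When $X$ is an algebra containing the constants (as is the case for $\mathcal{N}$ and $\mathcal{N}^+$), this is equivalent to $\ell^\infty\subset X|_\Lambda$. *)

theory Defs
  imports "HOL-Probability.Probability"
begin

text \<open>As \<open>ln 0 = 0\<close> in HOL, this gives the usual value \<open>0\<close> at \<open>x = 0\<close>.\<close>

definition log_plus :: "real \<Rightarrow> real" where
  "log_plus x = max 0 (ln x)"

definition circle_log_mean :: "(complex \<Rightarrow> complex) \<Rightarrow> real \<Rightarrow> real" where
  "circle_log_mean f r =
     1 / (2 * pi) * (LINT t:{0..2*pi}|lebesgue. log_plus (norm (f (of_real r * cis t))))"

text \<open>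
  For holomorphic \<open>f\<close> the means are nondecreasing in \<open>r\<close>, so the limit always exists in
  \<open>[0, \<infinity>]\<close>; it is finite iff there is a real limit. Functions are total in HOL, and their
  values outside the disc are irrelevant to membership.
\<close>

definition nevanlinna_class :: "(complex \<Rightarrow> complex) set" where
  "nevanlinna_class =
     {f. f holomorphic_on ball 0 1 \<and> (\<exists>L. (circle_log_mean f \<longlongrightarrow> L) (at_left 1))}"

definition stolz_region :: "complex \<Rightarrow> real \<Rightarrow> complex set" where
  "stolz_region \<zeta> \<alpha> = {z \<in> ball 0 1. norm (z - \<zeta>) < \<alpha> * (1 - norm z)}"

definition has_nontangential_limit ::
    "(complex \<Rightarrow> complex) \<Rightarrow> complex \<Rightarrow> complex \<Rightarrow> bool" where
  "has_nontangential_limit f \<zeta> l \<longleftrightarrow>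
     (\<forall>\<alpha>>1. (f \<longlongrightarrow> l) (at \<zeta> within stolz_region \<zeta> \<alpha>))"

text \<open>
  Unspecified where the non-tangential limit does not exist, which for \<open>f\<close> in the Nevanlinna
  class is a null subset of the circle.
\<close>

definition nontangential_value :: "(complex \<Rightarrow> complex) \<Rightarrow> complex \<Rightarrow> complex" where
  "nontangential_value f \<zeta> = (THE l. has_nontangential_limit f \<zeta> l)"

text \<open>
  A Bochner integral is \<open>0\<close> for non-integrable functions, so the finiteness of the boundary
  integral is the separate integrability clause.
\<close>

definition smirnov_class :: "(complex \<Rightarrow> complex) set" where
  "smirnov_class =
     {f \<in> nevanlinna_class.
        set_integrable lebesgue {0..2*pi}
          (\<lambda>t. log_plus (norm (nontangential_value f (cis t)))) \<and>
        (circle_log_mean f \<longlongrightarrow>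
           1 / (2 * pi) *
             (LINT t:{0..2*pi}|lebesgue. log_plus (norm (nontangential_value f (cis t)))))
          (at_left 1)}"

definition trace_space ::
    "(complex \<Rightarrow> complex) set \<Rightarrow> (nat \<Rightarrow> complex) \<Rightarrow> (nat \<Rightarrow> complex) set" where
  "trace_space X \<Lambda> = {(\<lambda>n. f (\<Lambda> n)) | f. f \<in> X}"

definition free_interpolating ::
    "(complex \<Rightarrow> complex) set \<Rightarrow> (nat \<Rightarrow> complex) \<Rightarrow> bool" where
  "free_interpolating X \<Lambda> \<longleftrightarrow>
     {(\<lambda>n. a n * b n) | a b. bounded (range a) \<and> b \<in> trace_space X \<Lambda>} \<subseteq> trace_space X \<Lambda>"

definition blaschke_sequence :: "(nat \<Rightarrow> complex) \<Rightarrow> bool" where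
  "blaschke_sequence \<Lambda> \<longleftrightarrow> summable (\<lambda>n. 1 - norm (\<Lambda> n))"

definition random_sequence ::
    "(nat \<Rightarrow> real) \<Rightarrow> (nat \<Rightarrow> 'w \<Rightarrow> real) \<Rightarrow> 'w \<Rightarrow> nat \<Rightarrow> complex" where
  "random_sequence r \<theta> \<omega> = (\<lambda>n. of_real (r n) * cis (\<theta> n \<omega>))"

text \<open>
  The moduli of a random sequence are deterministic, so the Blaschke condition is as well.
\<close>

lemma blaschke_random_sequence_iff:
  assumes "\<And>n. 0 \<le> r n"
  shows "blaschke_sequence (random_sequence r \<theta> \<omega>) \<longleftrightarrow> summable (\<lambda>n. 1 - r n)"
  using assms by (simp add: blaschke_sequence_def random_sequence_def norm_mult)

end

theory Submission
  imports Defs "HOL-Complex_Analysis.Complex_Analysis"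
begin

text \<open>
  Necessity: a function of the Nevanlinna class is a quotient of bounded holomorphic functions, so
  one that interpolates \<open>(1, 0, 0, \<dots>)\<close> forces the Blaschke condition.

  Sufficiency: let \<open>c\<^sub>n\<close> be the sum of \<open>ln (1 / \<rho>(\<lambda>\<^sub>k, \<lambda>\<^sub>n))\<close> over \<open>k \<noteq> n\<close>, where \<open>\<rho>\<close> is the
  pseudohyperbolic distance. The circle mean of \<open>ln (1 / \<rho>)\<close> over one independent angle is
  \<open>ln (1 / max r\<^sub>k r\<^sub>n)\<close>, so the Blaschke condition bounds the expectations of the \<open>c\<^sub>n\<close> uniformly and
  \<open>\<Sum>n. c\<^sub>n * (1 - r\<^sub>n\<^sup>2)\<close> is almost surely finite. In that case every bounded sequence is interpolated
  by a function \<open>\<psi> * exp E\<close> with \<open>\<psi>\<close> bounded by \<open>1\<close> and \<open>E\<close> a sum of Cauchy kernels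
  \<open>e\<^sub>n / (1 - cnj \<lambda>\<^sub>n * z)\<close> with summable nonnegative coefficients. The mean of \<open>Re E\<close> over a circle
  does not depend on the radius and equals the mean of its boundary values, which makes
  multiplication by \<open>\<psi> * exp E\<close> preserve both classes.
\<close>

section \<open>Circle means and polynomial majorants\<close>

text \<open>Interpolation in the Nevanlinna class costs a positive harmonic function that is at
  least \<open>c n\<close> at \<open>\<Lambda> n\<close>. A simple candidate spends one kernel per
  point: \<open>w n / (1 - cnj (\<Lambda> n) * z)\<close> with
  \<open>w n = 1 - norm (\<Lambda> n) ^ 2\<close> is 1 at \<open>\<Lambda> n\<close>, has positive
  real part in the disc and is \<open>w n\<close> at 0. With weights \<open>c n\<close> the total
  price, the value at 0, is the series of \<open>c n * w n\<close>. Its expectation can be estimated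
  termwise, and only pairs of angles enter.

  The Smirnov class shapes the rest. Its definition compares circle means with an integral of
  non-tangential boundary values, so these must exist almost everywhere for the constructed
  function, and no mass may be lost in the limit. Hence Fatou's theorem, for bounded functions and
  then for quotients by zero-free ones, and a dominated convergence theorem with varying majorants.

  At most one radius may be 0 because the logarithm of \<open>1 / max (r k) (r n)\<close> has to be
  bounded by a multiple of \<open>1 - r k\<close>, uniformly in \<open>n\<close>.\<close>

abbreviation circ :: "real measure" where
  "circ \<equiv> lebesgue_on {0..2*pi}"

lemma finite_measure_circ: "finite_measure circ"
  by (intro finite_measure_lebesgue_on) auto

lemma measure_circ [simp]: "measure circ {0..2*pi} = 2 * pi"
  by (simp add: measure_restrict_space)

lemma integrable_circ_continuous:
  fixes f :: "real \<Rightarrow> 'a::euclidean_space"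
  assumes "continuous_on {0..2*pi} f"
  shows "integrable circ f"
  using absolutely_integrable_continuous_real[OF assms]
  by (simp add: set_integrable_def integrable_restrict_space)

lemma measurable_circ_continuous:
  fixes f :: "real \<Rightarrow> 'a::euclidean_space"
  assumes "continuous_on {0..2*pi} f"
  shows "f \<in> borel_measurable circ"
  using integrable_circ_continuous[OF assms] by auto

lemma integral_circ_const [simp]: "(LINT t|circ. c) = 2 * pi * c" for c :: real
  using measure_circ by simp

lemma circle_log_mean_eq:
  "circle_log_mean f r = (LINT t|circ. log_plus (norm (f (of_real r * cis t)))) / (2 * pi)"
  by (simp add: circle_log_mean_def set_lebesgue_integral_def integral_restrict_space)

text \<open>\<open>ln\<close> with \<open>ln 0 = 0\<close> jumps at 0, \<open>ln (max 1 x)\<close>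
  does not. Continuity and monotonicity of \<open>log_plus\<close> are read off from this
  form.\<close>

lemma log_plus_eq: "0 \<le> x \<Longrightarrow> log_plus x = ln (max 1 x)"
  by (cases "x = 0"; cases "x \<le> 1") (simp_all add: log_plus_def)

lemma log_plus_nonneg [simp]: "0 \<le> log_plus x"
  by (simp add: log_plus_def)

lemma continuous_on_log_plus [continuous_intros]:
  assumes "continuous_on S f" "\<And>x. x \<in> S \<Longrightarrow> 0 \<le> f x"
  shows "continuous_on S (\<lambda>x. log_plus (f x))"
proof -
  have "continuous_on S (\<lambda>x. ln (max 1 (f x)))"
    by (intro continuous_intros assms) (auto simp: max_def)
  then show ?thesis
    using assms(2) by (subst continuous_on_cong[OF refl log_plus_eq]) auto
qed

lemma tendsto_log_plus_norm:
  fixes f :: "'a \<Rightarrow> 'b::real_normed_vector"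
  assumes "(f \<longlongrightarrow> l) F"
  shows "((\<lambda>x. log_plus (norm (f x))) \<longlongrightarrow> log_plus (norm l)) F"
proof -
  have "((\<lambda>x. ln (max 1 (norm (f x)))) \<longlongrightarrow> ln (max 1 (norm l))) F"
    by (intro tendsto_intros assms) auto
  then show ?thesis by (simp add: log_plus_eq)
qed

lemma log_plus_mono: "0 \<le> x \<Longrightarrow> x \<le> y \<Longrightarrow> log_plus x \<le> log_plus y"
  by (simp add: log_plus_eq)

lemma log_plus_mult_exp_le:
  assumes "0 \<le> x" "0 \<le> h"
  shows "log_plus (exp h * x) \<le> h + log_plus x"
proof -
  have "max 1 (exp h * x) \<le> exp h * max 1 x"
    using assms mult_mono[of 1 "exp h" 1 "max 1 x"] by simp
  then have "ln (max 1 (exp h * x)) \<le> ln (exp h * max 1 x)"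
    by (subst ln_le_cancel_iff) auto
  also have "\<dots> = h + ln (max 1 x)" by (subst ln_mult) auto
  finally show ?thesis using assms by (simp add: log_plus_eq)
qed

lemma le_exp_log_plus: "0 \<le> x \<Longrightarrow> x \<le> exp (log_plus x)"
  by (simp add: log_plus_eq)

section \<open>Mean value property on circles\<close>

lemma continuous_on_circle_comp:
  fixes f :: "complex \<Rightarrow> 'a::topological_space"
  assumes "continuous_on (ball 0 1) f" "0 \<le> r" "r < 1"
  shows "continuous_on S (\<lambda>t. f (of_real r * cis t))"
  by (rule continuous_on_compose2[OF assms(1)])
     (use assms in \<open>auto intro!: continuous_intros simp: norm_mult cis_conv_exp\<close>)

lemma integral_circ_eq_integral:
  fixes f :: "real \<Rightarrow> 'a::euclidean_space"
  assumes "integrable circ f"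
  shows "(LINT t|circ. f t) = integral {0..2*pi} f"
  using lebesgue_integral_eq_integral[OF assms] by simp

lemma has_contour_integral_circlepath_imp_integral_circ:
  assumes I: "(g has_contour_integral I) (circlepath 0 r)"
    and g: "continuous_on (sphere 0 r) g" and r: "0 < r"
  shows "(LINT t|circ. g (of_real r * cis t) * (of_real r * \<i> * cis t)) = I"
proof -
  have "((\<lambda>t. g (of_real r * cis t) * (of_real r * \<i> * cis t)) has_integral I) {0..2*pi}"
    using I unfolding circlepath_def
    by (subst (asm) has_contour_integral_part_circlepath_iff) (auto simp: mult.assoc)
  moreover have "continuous_on {0..2*pi} (\<lambda>t. g (of_real r * cis t) * (of_real r * \<i> * cis t))"
    by (intro continuous_intros continuous_on_compose2[OF g])
       (use r in \<open>auto simp: norm_mult cis_conv_exp intro!: continuous_intros\<close>)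
  ultimately show ?thesis
    using integral_circ_eq_integral integrable_circ_continuous integral_unique by metis
qed

lemma holomorphic_circle_mean:
  fixes f :: "complex \<Rightarrow> complex"
  assumes f: "f holomorphic_on cball 0 r" and r: "0 \<le> r"
  shows "(LINT t|circ. f (of_real r * cis t)) = of_real (2 * pi) * f 0"
proof (cases "r = 0")
  case False
  have "((\<lambda>u. f u / (u - 0)) has_contour_integral (2 * of_real pi * \<i> * f 0)) (circlepath 0 r)"
    using False r by (intro Cauchy_integral_circlepath_simple f) auto
  moreover have "continuous_on (sphere 0 r) (\<lambda>u. f u / (u - 0))"
    using False r by (intro continuous_intros continuous_on_subset[OF holomorphic_on_imp_continuous_on[OF f]]) auto
  ultimately have "(LINT t|circ. f (of_real r * cis t) / (of_real r * cis t - 0) *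
      (of_real r * \<i> * cis t)) = 2 * of_real pi * \<i> * f 0"
    using False r by (intro has_contour_integral_circlepath_imp_integral_circ) auto
  also have "(\<lambda>t. f (of_real r * cis t) / (of_real r * cis t - 0) * (of_real r * \<i> * cis t))
      = (\<lambda>t. \<i> * f (of_real r * cis t))"
    using False by (auto simp: field_simps)
  finally have "\<i> * (LINT t|circ. f (of_real r * cis t)) = \<i> * (2 * of_real pi * f 0)"
    by (simp add: mult_ac)
  then show ?thesis by simp
qed (use measure_circ in \<open>simp add: scaleR_conv_of_real\<close>)

lemma integrable_circ_holomorphic:
  assumes f: "f holomorphic_on cball 0 r" and r: "0 \<le> r"
  shows "integrable circ (\<lambda>t. f (of_real r * cis t))"
  by (intro integrable_circ_continuous
        continuous_on_compose2[OF holomorphic_on_imp_continuous_on[OF f]])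
     (use r in \<open>auto simp: norm_mult cis_conv_exp intro!: continuous_intros\<close>)

lemma Re_holomorphic_circle_mean:
  fixes f :: "complex \<Rightarrow> complex"
  assumes f: "f holomorphic_on cball 0 r" and r: "0 \<le> r"
  shows "(LINT t|circ. Re (f (of_real r * cis t))) = 2 * pi * Re (f 0)"
  using integral_Re[OF integrable_circ_holomorphic[OF assms]] holomorphic_circle_mean[OF assms]
  by simp

text \<open>On the circle \<open>cnj z\<close> is the inverse of \<open>z\<close>, and conjugating a
  term of negative frequency keeps its real part, so real parts of analytic polynomials give all
  real trigonometric polynomials. In this encoding each of them extends harmonically to the
  disc.\<close>

definition circle_trig :: "(complex \<Rightarrow> real) set" where
  "circle_trig = {u. \<exists>p. \<forall>z. norm z = 1 \<longrightarrow> u z = Re (poly p z)}"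

lemma circle_trig_add: "u \<in> circle_trig \<Longrightarrow> v \<in> circle_trig \<Longrightarrow> (\<lambda>z. u z + v z) \<in> circle_trig"
  unfolding circle_trig_def by clarsimp (metis plus_complex.simps(1) poly_add)

lemma circle_trig_const_mult: "u \<in> circle_trig \<Longrightarrow> (\<lambda>z. c * u z) \<in> circle_trig"
proof -
  assume "u \<in> circle_trig"
  then obtain p where p: "\<And>z. norm z = 1 \<Longrightarrow> u z = Re (poly p z)"
    by (auto simp: circle_trig_def)
  show ?thesis unfolding circle_trig_def
    by (rule CollectI, rule exI[of _ "smult (of_real c) p"]) (use p in auto)
qed

text \<open>On the circle \<open>Re (c z) * Re (p z)\<close> is half the real part of \<open>c z p z\<close> plus that of
  \<open>cnj (c z) p z\<close>, and \<open>cnj z\<close> cancels one factor of the nonconstant part of \<open>p\<close>.\<close>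

lemma circle_trig_linear_mult:
  assumes "bounded_linear L" "u \<in> circle_trig"
  shows "(\<lambda>z. L z * u z) \<in> circle_trig"
proof -
  obtain p where p: "\<And>z. norm z = 1 \<Longrightarrow> u z = Re (poly p z)"
    using assms by (auto simp: circle_trig_def)
  interpret bounded_linear L by fact
  define c where "c = Complex (L 1) (- L \<i>)"
  have L: "L z = Re (c * z)" for z
  proof -
    have "L z = L (Re z *\<^sub>R 1 + Im z *\<^sub>R \<i>)"
      by (metis complex_eq mult.commute scaleR_conv_of_real mult.right_neutral)
    also have "\<dots> = Re (c * z)" by (simp add: add scaleR c_def)
    finally show ?thesis .
  qed
  obtain a q where pq: "p = pCons a q" by (cases p)
  define P where "P = smult (1/2) (smult c (pCons 0 p) + [:0, c * cnj a:] + smult (cnj c) q)"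
  have "L z * u z = Re (poly P z)" if z: "norm z = 1" for z
  proof -
    have zz: "cnj z * z = 1" using z complex_norm_square[of z] by (simp add: mult.commute)
    have Re_mult: "Re x * Re y = Re ((x * y + cnj x * y) / 2)" for x y by simp
    have "L z * u z = Re (c * z) * Re (poly p z)" using L p[OF z] by simp
    also have "\<dots> = Re ((c * z * poly p z + cnj c * cnj z * poly p z) / 2)"
      unfolding Re_mult complex_cnj_mult ..
    also have "cnj c * cnj z * poly p z = cnj c * cnj z * a + cnj c * poly q z * (cnj z * z)"
      by (simp add: pq algebra_simps)
    also have "Re ((c * z * poly p z + (cnj c * cnj z * a + cnj c * poly q z * (cnj z * z))) / 2)
        = Re (poly P z)"
    proof -
      have "Re ((x + (y + w)) / 2) = Re ((x + cnj y + w) / 2)" for x y w by simp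
      moreover have "poly P z = (c * z * poly p z + cnj (cnj c * cnj z * a) + cnj c * poly q z) / 2"
        by (simp add: P_def pq field_simps)
      ultimately show ?thesis unfolding zz by (simp only: mult_1_right)
    qed
    finally show ?thesis .
  qed
  then show ?thesis unfolding circle_trig_def by blast
qed

lemma real_polynomial_function_circle_trig:
  assumes "real_polynomial_function g"
  shows "g \<in> circle_trig"
proof -
  \<comment> \<open>The induction is on the operator of multiplication by \<open>g\<close>, so that
    products become compositions and only linear factors and constants have to be treated. Applied
    to 1, the operator returns \<open>g\<close>.\<close>
  have "\<forall>u \<in> circle_trig. (\<lambda>z. g z * u z) \<in> circle_trig"
    using assms
  proof induction
    case (add f g)
    then show ?case by (auto simp: distrib_right intro!: circle_trig_add)
  next
    case (mult f g)
    then show ?case by (simp add: mult.assoc)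
  qed (auto intro: circle_trig_linear_mult circle_trig_const_mult)
  moreover have "(\<lambda>z. 1) \<in> circle_trig"
    unfolding circle_trig_def by (rule CollectI, rule exI[of _ 1]) auto
  ultimately show ?thesis by fastforce
qed

lemma circle_approx_Re_poly:
  fixes v :: "complex \<Rightarrow> real"
  assumes v: "continuous_on (sphere 0 1) v" and e: "0 < e"
  obtains p where "\<And>z. norm z = 1 \<Longrightarrow> v z \<le> Re (poly p z)"
    "\<And>z. norm z = 1 \<Longrightarrow> Re (poly p z) \<le> v z + e"
proof -
  obtain g where g: "real_polynomial_function g" "\<And>x. x \<in> sphere 0 1 \<Longrightarrow> \<bar>v x - g x\<bar> < e / 2"
    using Stone_Weierstrass_real_polynomial_function[OF compact_sphere v, of "e/2"] e by auto
  obtain p where p: "\<And>z. norm z = 1 \<Longrightarrow> g z = Re (poly p z)"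
    using real_polynomial_function_circle_trig[OF g(1)] by (auto simp: circle_trig_def)
  \<comment> \<open>An approximation within \<open>e / 2\<close>, raised by \<open>e / 2\<close>,
    lies between \<open>v\<close> and \<open>v + e\<close>.\<close>
  define d where "d = e / 2"
  then have d: "e = 2 * d" by simp
  show ?thesis
  proof (rule that[of "p + [:of_real d:]"])
    fix z :: complex assume "norm z = 1"
    then show "v z \<le> Re (poly (p + [:of_real d:]) z)"
      "Re (poly (p + [:of_real d:]) z) \<le> v z + e"
      using g(2)[of z] p[of z] unfolding d by (auto simp: abs_less_iff)
  qed
qed

text \<open>A polynomial replaces the Poisson integral of \<open>log_plus (norm f)\<close> over the circle of radius
  \<open>R\<close>; the maximum modulus principle applied to \<open>f * exp (- p)\<close> replaces subharmonicity.\<close>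

lemma log_plus_majorant:
  assumes f: "f holomorphic_on ball 0 1" and R: "0 \<le> R" "R < 1" and e: "0 < e"
  obtains p where "\<And>z. norm z \<le> 1 \<Longrightarrow> 0 \<le> Re (poly p z)"
    "\<And>z. norm z \<le> 1 \<Longrightarrow> norm (f (of_real R * z)) \<le> exp (Re (poly p z))"
    "Re (poly p 0) \<le> circle_log_mean f R + e"
proof -
  define v where "v = (\<lambda>z. log_plus (norm (f (of_real R * z))))"
  have RB: "of_real R * z \<in> ball 0 1" if "norm z \<le> 1" for z :: complex
    using R that mult_mono[of R R "norm z" 1] by (auto simp: norm_mult)
  have holf: "(\<lambda>z. f (of_real R * z)) holomorphic_on cball 0 1"
    by (rule holomorphic_on_compose_gen[OF _ f, unfolded o_def])
       (use RB in \<open>auto intro!: holomorphic_intros\<close>)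
  have contf: "continuous_on (cball 0 1) (\<lambda>z. f (of_real R * z))"
    by (rule holomorphic_on_imp_continuous_on[OF holf])
  have "continuous_on (sphere 0 1) v" unfolding v_def
    by (intro continuous_intros continuous_on_subset[OF contf]) auto
  then obtain p where p: "\<And>z. norm z = 1 \<Longrightarrow> v z \<le> Re (poly p z)"
    "\<And>z. norm z = 1 \<Longrightarrow> Re (poly p z) \<le> v z + e"
    using circle_approx_Re_poly e by metis
  \<comment> \<open>Used twice: with the constant 1, where \<open>0 \<le> v\<close> yields
    \<open>0 \<le> Re (poly p z)\<close> throughout the disc, and with the dilated
    \<open>f\<close>.\<close>
  have le: "norm (g z * exp (- poly p z)) \<le> 1"
    if "g holomorphic_on cball 0 1" "\<And>z. norm z = 1 \<Longrightarrow> norm (g z) \<le> exp (v z)" "norm z \<le> 1"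
    for g z
  proof (rule maximum_modulus_frontier[of "\<lambda>z. g z * exp (- poly p z)" "cball 0 1"])
    show "(\<lambda>z. g z * exp (- poly p z)) holomorphic_on interior (cball 0 1)"
      by (intro holomorphic_intros holomorphic_on_subset[OF that(1)]) auto
    show "continuous_on (closure (cball 0 1)) (\<lambda>z. g z * exp (- poly p z))"
      using holomorphic_on_imp_continuous_on[OF that(1)] by (auto intro!: continuous_intros)
    fix w :: complex assume "w \<in> frontier (cball 0 1)"
    then have w: "norm w = 1" by auto
    then have "norm (g w) \<le> exp (Re (poly p w))"
      using that(2)[of w] p(1)[of w] by (smt (verit) exp_le_cancel_iff)
    then show "norm (g w * exp (- poly p w)) \<le> 1"
      by (simp add: norm_mult norm_divide norm_exp_eq_Re exp_minus divide_simps)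
  qed (use that in auto)
  show ?thesis
  proof (rule that)
    fix z :: complex assume z: "norm z \<le> 1"
    show "0 \<le> Re (poly p z)"
      using le[of "\<lambda>_. 1" z] z by (auto simp: v_def norm_exp_eq_Re)
    show "norm (f (of_real R * z)) \<le> exp (Re (poly p z))"
      using le[of "\<lambda>z. f (of_real R * z)" z] z holf
      by (auto simp: v_def norm_mult norm_divide norm_exp_eq_Re exp_minus divide_simps le_exp_log_plus)
  next
    have "2 * pi * Re (poly p 0) = (LINT t|circ. Re (poly p (of_real 1 * cis t)))"
      by (rule Re_holomorphic_circle_mean[symmetric]) (auto intro!: holomorphic_intros)
    also have "\<dots> \<le> (LINT t|circ. v (cis t) + e)"
    proof (rule integral_mono)
      show "integrable circ (\<lambda>t. v (cis t) + e)" unfolding v_def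
        by (intro integrable_circ_continuous continuous_intros
             continuous_on_circle_comp holomorphic_on_imp_continuous_on f R) auto
    qed (use p(2) in \<open>auto intro!: integrable_circ_continuous continuous_intros simp: cis_conv_exp\<close>)
    also have "\<dots> = (LINT t|circ. v (cis t)) + 2 * pi * e"
      by (subst Bochner_Integration.integral_add)
         (auto simp: v_def intro!: integrable_circ_continuous continuous_intros
             continuous_on_circle_comp holomorphic_on_imp_continuous_on f R)
    also have "\<dots> = 2 * pi * (circle_log_mean f R + e)"
      by (simp add: circle_log_mean_eq v_def field_simps)
    finally show "Re (poly p 0) \<le> circle_log_mean f R + e" by simp
  qed
qed

lemma integrable_log_plus_circle:
  assumes f: "f holomorphic_on ball 0 1" and R: "0 \<le> R" "R < 1"
  shows "integrable circ (\<lambda>t. log_plus (norm (f (of_real R * cis t))))"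
  by (intro integrable_circ_continuous continuous_intros
             continuous_on_circle_comp holomorphic_on_imp_continuous_on f R) auto

text \<open>The polynomial that majorizes at radius \<open>R\<close> does so on the smaller circle
  as well. Its mean over that circle is its value at 0, which exceeds the mean of
  \<open>log_plus (norm f)\<close> at radius \<open>R\<close> by at most \<open>e\<close>.\<close>

lemma circle_log_mean_mono:
  assumes f: "f holomorphic_on ball 0 1" and r: "0 \<le> r" "r \<le> R" "R < 1"
  shows "circle_log_mean f r \<le> circle_log_mean f R"
proof (cases "r < R")
  case True
  have "circle_log_mean f r \<le> circle_log_mean f R + e" if e: "0 < e" for e
  proof -
    obtain p where p: "\<And>z. norm z \<le> 1 \<Longrightarrow> 0 \<le> Re (poly p z)"
      "\<And>z. norm z \<le> 1 \<Longrightarrow> norm (f (of_real R * z)) \<le> exp (Re (poly p z))"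
      "Re (poly p 0) \<le> circle_log_mean f R + e"
      using log_plus_majorant[OF f, of R e] r e by auto
    have "2 * pi * circle_log_mean f r = (LINT t|circ. log_plus (norm (f (of_real r * cis t))))"
      by (simp add: circle_log_mean_eq)
    also have "\<dots> \<le> (LINT t|circ. Re (poly p (of_real (r / R) * cis t)))"
    proof (rule integral_mono)
      show "integrable circ (\<lambda>t. log_plus (norm (f (of_real r * cis t))))"
        using r by (intro integrable_log_plus_circle f) auto
      show "integrable circ (\<lambda>t. Re (poly p (of_real (r / R) * cis t)))"
        using r True by (intro integrable_circ_continuous continuous_intros) auto
      fix t
      have n: "norm (of_real (r / R) * cis t) \<le> 1" using r True by (simp add: norm_mult norm_divide)
      have "of_real r * cis t = of_real R * (of_real (r/R) * cis t)" using r True by simp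
      then have "norm (f (of_real r * cis t)) \<le> exp (Re (poly p (of_real (r/R) * cis t)))"
        using p(2)[OF n] by simp
      then have "log_plus (norm (f (of_real r * cis t)))
          \<le> log_plus (exp (Re (poly p (of_real (r/R) * cis t))))"
        by (intro log_plus_mono) auto
      then show "log_plus (norm (f (of_real r * cis t))) \<le> Re (poly p (of_real (r / R) * cis t))"
        using p(1)[OF n] by (simp add: log_plus_def)
    qed
    also have "\<dots> = 2 * pi * Re (poly p 0)"
      using r by (intro Re_holomorphic_circle_mean) (auto intro!: holomorphic_intros)
    finally have "circle_log_mean f r \<le> Re (poly p 0)" by simp
    then show ?thesis using p(3) by simp
  qed
  then show ?thesis by (rule field_le_epsilon)
qed (use r in simp)

text \<open>The circle means are nondecreasing in the radius, so a limit exists as soon as they are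
  bounded.\<close>

lemma nevanlinna_class_iff:
  "f \<in> nevanlinna_class \<longleftrightarrow>
     f holomorphic_on ball 0 1 \<and> (\<exists>L. \<forall>r. 0 \<le> r \<longrightarrow> r < 1 \<longrightarrow> circle_log_mean f r \<le> L)"
proof (cases "f holomorphic_on ball 0 1")
  case f: True
  have ev: "\<forall>\<^sub>F R in at_left 1. r < R \<and> R < 1" if "r < 1" for r :: real
    using that by (auto simp: eventually_at_left_field)
  have "(\<exists>L. (circle_log_mean f \<longlongrightarrow> L) (at_left 1)) \<longleftrightarrow>
      (\<exists>L. \<forall>r. 0 \<le> r \<longrightarrow> r < 1 \<longrightarrow> circle_log_mean f r \<le> L)"
  proof
    assume "\<exists>L. (circle_log_mean f \<longlongrightarrow> L) (at_left 1)"
    then obtain L where L: "(circle_log_mean f \<longlongrightarrow> L) (at_left 1)" by blast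
    have "circle_log_mean f r \<le> L" if "0 \<le> r" "r < 1" for r
    proof (rule tendsto_lowerbound[OF L])
      show "\<forall>\<^sub>F x in at_left 1. circle_log_mean f r \<le> circle_log_mean f x"
        using ev[OF that(2)] by eventually_elim (intro circle_log_mean_mono[OF f] that; simp)
    qed simp
    then show "\<exists>L. \<forall>r. 0 \<le> r \<longrightarrow> r < 1 \<longrightarrow> circle_log_mean f r \<le> L" by blast
  next
    assume "\<exists>L. \<forall>r. 0 \<le> r \<longrightarrow> r < 1 \<longrightarrow> circle_log_mean f r \<le> L"
    then obtain L where L: "\<And>r. 0 \<le> r \<Longrightarrow> r < 1 \<Longrightarrow> circle_log_mean f r \<le> L" by blast
    define S where "S = (SUP r\<in>{0..<1}. circle_log_mean f r)"
    have bdd: "bdd_above (circle_log_mean f ` {0..<1})" using L by (intro bdd_aboveI2[of _ _ L]) auto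
    have "(circle_log_mean f \<longlongrightarrow> S) (at_left 1)"
    proof (rule order_tendstoI)
      fix a assume "a < S"
      then obtain r where r: "0 \<le> r" "r < 1" "a < circle_log_mean f r"
        unfolding S_def using less_cSUP_iff[OF _ bdd] by auto
      show "\<forall>\<^sub>F x in at_left 1. a < circle_log_mean f x"
        using ev[OF r(2)]
      proof eventually_elim
        case (elim x)
        then have "circle_log_mean f r \<le> circle_log_mean f x"
          using r by (intro circle_log_mean_mono[OF f]) auto
        then show ?case using r by simp
      qed
    next
      fix a assume a: "S < a"
      show "\<forall>\<^sub>F x in at_left 1. circle_log_mean f x < a"
        using ev[of 0, OF zero_less_one]
      proof eventually_elim
        case (elim R)
        then have "circle_log_mean f R \<le> S" unfolding S_def by (intro cSUP_upper bdd) auto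
        then show ?case using a by simp
      qed
    qed
    then show "\<exists>L. (circle_log_mean f \<longlongrightarrow> L) (at_left 1)" by blast
  qed
  then show ?thesis by (simp add: nevanlinna_class_def f)
qed (simp add: nevanlinna_class_def)

section \<open>Boundary functions of bounded holomorphic functions\<close>

text \<open>Cauchy's formula for the \<open>n\<close>-th derivative, read as a Fourier coefficient
  of \<open>f\<close> on the circle of radius \<open>r\<close>.\<close>

lemma circle_coefficient:
  assumes f: "f holomorphic_on ball 0 1" and r: "0 < r" "r < 1"
  shows "(LINT t|circ. f (of_real r * cis t) * cis (- (real n * t))) =
    of_real (2 * pi) * ((deriv ^^ n) f 0 / fact n) * of_real r ^ n"
proof -
  have fc: "f holomorphic_on cball 0 r"
    using r by (intro holomorphic_on_subset[OF f]) auto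
  have cont: "continuous_on (cball 0 r) f" by (rule holomorphic_on_imp_continuous_on[OF fc])
  have "((\<lambda>u. f u / (u - 0) ^ Suc n) has_contour_integral
      (2 * pi * \<i> / fact n * (deriv ^^ n) f 0)) (circlepath 0 r)"
    using r by (intro Cauchy_has_contour_integral_higher_derivative_circlepath cont
       holomorphic_on_subset[OF f]) auto
  moreover have "continuous_on (sphere 0 r) (\<lambda>u. f u / (u - 0) ^ Suc n)"
    using r by (intro continuous_intros continuous_on_subset[OF cont]) auto
  ultimately have "(LINT t|circ. f (of_real r * cis t) / (of_real r * cis t - 0) ^ Suc n *
      (of_real r * \<i> * cis t)) = 2 * pi * \<i> / fact n * (deriv ^^ n) f 0"
    using r by (intro has_contour_integral_circlepath_imp_integral_circ) auto
  also have "(\<lambda>t. f (of_real r * cis t) / (of_real r * cis t - 0) ^ Suc n * (of_real r * \<i> * cis t))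
      = (\<lambda>t. \<i> / of_real r ^ n * (f (of_real r * cis t) * cis (- (real n * t))))"
  proof
    fix t
    have "inverse (cis t ^ n) = cis (- (real n * t))"
      unfolding Complex.DeMoivre cis_inverse ..
    then show "f (of_real r * cis t) / (of_real r * cis t - 0) ^ Suc n * (of_real r * \<i> * cis t)
      = \<i> / of_real r ^ n * (f (of_real r * cis t) * cis (- (real n * t)))"
      using r by (simp add: field_simps)
  qed
  finally have "\<i> / of_real r ^ n * (LINT t|circ. f (of_real r * cis t) * cis (- (real n * t)))
     = 2 * pi * \<i> / fact n * (deriv ^^ n) f 0" by simp
  then show ?thesis using r by (simp add: field_simps)
qed

text \<open>Parseval's identity, polarized to two circles of different radii. The Taylor series of
  the second factor converges absolutely and uniformly on its circle, so it may be integrated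
  termwise.\<close>

lemma circle_inner_sums:
  assumes f: "f holomorphic_on ball 0 1" and r: "0 < r" "r < 1" and s: "0 < s" "s < 1"
  shows "(\<lambda>n. of_real (2 * pi * (norm ((deriv ^^ n) f 0 / fact n))\<^sup>2 * (r * s) ^ n)) sums
     (LINT t|circ. f (of_real r * cis t) * cnj (f (of_real s * cis t)))"
proof -
  define a where "a n = (deriv ^^ n) f 0 / fact n" for n
  have ser: "(\<lambda>n. a n * w ^ n) sums f w" if "norm w < 1" for w
    using holomorphic_power_series[OF f, of w] that by (simp add: a_def)
  define s' where "s' = (1 + s) / 2"
  have s': "s < s'" "s' < 1" using s by (auto simp: s'_def)
  have abs: "summable (\<lambda>n. norm (a n) * s ^ n)"
  proof -
    have "summable (\<lambda>n. a n * of_real s' ^ n)"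
      using ser[of "of_real s'"] s s' by (auto simp: sums_iff)
    from powser_insidea[OF this, of "of_real s"] show ?thesis
      using s s' by (simp add: norm_mult norm_power)
  qed
  have cont: "continuous_on UNIV (\<lambda>t. f (of_real r * cis t))"
    using r by (intro continuous_on_circle_comp holomorphic_on_imp_continuous_on[OF f]) auto
  have "compact ((\<lambda>t. f (of_real r * cis t)) ` {0..2*pi})"
    by (intro compact_continuous_image continuous_on_subset[OF cont]) auto
  then obtain C where C: "\<And>t. t \<in> {0..2*pi} \<Longrightarrow> norm (f (of_real r * cis t)) \<le> C"
    by (meson bounded_iff compact_imp_bounded imageI)
  define F where "F n t = f (of_real r * cis t) * (cnj (a n) * of_real s ^ n * cis (- (real n * t)))" for n t
  have C0: "0 \<le> C" using C[of 0] norm_ge_zero[of "f (of_real r * cis 0)"] by (auto intro: order_trans[OF norm_ge_zero])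
  have Fnorm: "norm (F n t) \<le> C * (norm (a n) * s ^ n)" if "t \<in> {0..2*pi}" for n t
    using C[OF that] C0 s by (auto simp: F_def norm_mult norm_power intro!: mult_mono)
  have Fint: "integrable circ (F n)" for n
    unfolding F_def by (intro integrable_circ_continuous continuous_intros
       continuous_on_subset[OF cont]) auto
  have Fint_eq: "(LINT t|circ. F n t) = of_real (2 * pi * (norm (a n))\<^sup>2 * (r * s) ^ n)" for n
  proof -
    have "(LINT t|circ. F n t) = (LINT t|circ. (cnj (a n) * of_real s ^ n) *
        (f (of_real r * cis t) * cis (- (real n * t))))"
      by (simp add: F_def mult_ac)
    also have "\<dots> = (cnj (a n) * of_real s ^ n) * (of_real (2 * pi) * a n * of_real r ^ n)"
      by (simp only: integral_mult_right_zero circle_coefficient[OF f r] a_def)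
    finally show ?thesis
      using complex_norm_square[of "a n"] by (simp add: power_mult_distrib mult_ac)
  qed
  have "(\<lambda>n. LINT t|circ. F n t) sums (LINT t|circ. (\<Sum>n. F n t))"
  proof (rule sums_integral[OF Fint])
    show "AE t in circ. summable (\<lambda>n. norm (F n t))"
    proof (rule AE_I2)
      fix t assume "t \<in> space circ"
      then show "summable (\<lambda>n. norm (F n t))"
        using Fnorm[of t] by (intro summable_comparison_test'[OF summable_mult[OF abs, of C], of 0]) auto
    qed
    show "summable (\<lambda>n. LINT t|circ. norm (F n t))"
    proof (rule summable_comparison_test'[OF summable_mult[OF summable_mult[OF abs]]])
      fix n
      have "(LINT t|circ. norm (F n t)) \<le> (LINT t|circ. C * (norm (a n) * s ^ n))"
        using Fint Fnorm by (intro integral_mono finite_measure.integrable_const finite_measure_circ) auto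
      then show "norm (LINT t|circ. norm (F n t)) \<le> 2 * pi * (C * (norm (a n) * s ^ n))"
        by simp
    qed
  qed
  moreover have "(\<Sum>n. F n t) = f (of_real r * cis t) * cnj (f (of_real s * cis t))" for t
  proof -
    have "(\<lambda>n. cnj (a n * (of_real s * cis t) ^ n)) sums cnj (f (of_real s * cis t))"
      using ser[of "of_real s * cis t"] s by (subst sums_cnj) (auto simp: norm_mult)
    from sums_mult[OF this, of "f (of_real r * cis t)"]
    have "F n t = f (of_real r * cis t) * cnj (a n * (of_real s * cis t) ^ n)" for n
      by (simp add: F_def power_mult_distrib Complex.DeMoivre cis_cnj)
    then show ?thesis
      using sums_mult[OF \<open>(\<lambda>n. cnj (a n * (of_real s * cis t) ^ n)) sums cnj (f (of_real s * cis t))\<close>,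
         of "f (of_real r * cis t)"] by (simp add: sums_iff)
  qed
  ultimately show ?thesis by (simp add: Fint_eq a_def)
qed

text \<open>\<open>L x\<close> is \<open>2 * pi\<close> times the sum of
  \<open>norm (a n) ^ 2 * x ^ n\<close> over the Taylor coefficients, and \<open>L (r * s)\<close>
  is the inner product of the slices at radii \<open>r\<close> and \<open>s\<close>. Boundedness of
  \<open>f\<close> bounds \<open>L\<close>, and \<open>S\<close> is its supremum, so the slices form
  a Cauchy family in the square mean as the radii tend to 1.\<close>

lemma bounded_holomorphic_L2_cauchy:
  assumes f: "f holomorphic_on ball 0 1" and B: "\<And>z. norm z < 1 \<Longrightarrow> norm (f z) \<le> B"
  obtains L S where "mono_on {0<..<1} L" "\<And>x. 0 < x \<Longrightarrow> x < 1 \<Longrightarrow> L x \<le> (S::real)"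
    "\<And>e. 0 < e \<Longrightarrow> \<exists>x. 0 < x \<and> x < 1 \<and> S - e < L x"
    "\<And>r s. 0 < r \<Longrightarrow> r < 1 \<Longrightarrow> 0 < s \<Longrightarrow> s < 1 \<Longrightarrow>
      (LINT t|circ. (norm (f (of_real r * cis t) - f (of_real s * cis t)))\<^sup>2)
      = L (r * r) + L (s * s) - 2 * L (r * s)"
proof -
  let ?J = "\<lambda>r s t. Re (f (of_real r * cis t) * cnj (f (of_real s * cis t)))"
  define c where "c n = 2 * pi * (norm ((deriv ^^ n) f 0 / fact n))\<^sup>2" for n
  have c0: "0 \<le> c n" for n by (simp add: c_def)
  define L where "L x = (\<Sum>n. c n * x ^ n)" for x :: real
  have K: "(\<lambda>n. c n * (r * s) ^ n) sums Re (LINT t|circ. f (of_real r * cis t) * cnj (f (of_real s * cis t)))"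
    if "0 < r" "r < 1" "0 < s" "s < 1" for r s
    using sums_Re[OF circle_inner_sums[OF f that]] by (simp add: c_def)
  have sumL: "summable (\<lambda>n. c n * x ^ n)" if "0 < x" "x < 1" for x
  proof -
    have "(sqrt x) * sqrt x = x" "0 < sqrt x" "sqrt x < 1" using that by auto
    then show ?thesis using K[of "sqrt x" "sqrt x"] by (auto simp: sums_iff)
  qed
  have KL: "Re (LINT t|circ. f (of_real r * cis t) * cnj (f (of_real s * cis t))) = L (r * s)"
    if "0 < r" "r < 1" "0 < s" "s < 1" for r s
    using K[OF that] by (simp add: L_def sums_iff)
  have int: "integrable circ (\<lambda>t. f (of_real r * cis t) * cnj (f (of_real s * cis t)))"
    if "0 < r" "r < 1" "0 < s" "s < 1" for r s
    using that by (intro integrable_circ_continuous continuous_intros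
       continuous_on_circle_comp holomorphic_on_imp_continuous_on[OF f]) auto
  have bound: "L x \<le> 2 * pi * B\<^sup>2" if "0 < x" "x < 1" for x
  proof -
    define r where "r = sqrt x"
    have r: "0 < r" "r < 1" "r * r = x" using that by (auto simp: r_def)
    have "L x = (LINT t|circ. ?J r r t)"
      using KL[OF r(1,2) r(1,2)] r(3) integral_Re[OF int[OF r(1,2) r(1,2)]] by simp
    also have "\<dots> \<le> (LINT t|circ. B\<^sup>2)"
    proof (rule integral_mono)
      show "integrable circ (\<lambda>t. ?J r r t)"
        by (intro integrable_Re int r)
      show "integrable circ (\<lambda>t. B\<^sup>2)"
        by (intro finite_measure.integrable_const finite_measure_circ)
      fix t
      have "norm (f (of_real r * cis t)) \<le> B" using B r by (simp add: norm_mult)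
      then have "(norm (f (of_real r * cis t)))\<^sup>2 \<le> B\<^sup>2" by (intro power_mono) auto
      then show "?J r r t \<le> B\<^sup>2"
        by (metis complex_norm_square Re_complex_of_real)
    qed
    finally show ?thesis by simp
  qed
  define S where "S = (SUP x\<in>{0<..<1}. L x)"
  have bdd: "bdd_above (L ` {0<..<1})" using bound by (intro bdd_aboveI2[of _ _ "2 * pi * B\<^sup>2"]) auto
  show ?thesis
  proof (rule that)
    show "mono_on {0<..<1} L"
      unfolding L_def by (intro mono_onI suminf_le mult_left_mono power_mono c0 sumL) auto
    show "L x \<le> S" if "0 < x" "x < 1" for x
      unfolding S_def using that by (intro cSUP_upper bdd) auto
    show "\<exists>x. 0 < x \<and> x < 1 \<and> S - e < L x" if "0 < e" for e
    proof -
      have "S - e < S" using that by simp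
      then have "\<exists>x\<in>{0<..<1}. S - e < L x"
        unfolding S_def[symmetric] using less_cSUP_iff[OF _ bdd, of "S - e"] by (auto simp: S_def[symmetric])
      then show ?thesis by auto
    qed
    fix r s :: real assume rs: "0 < r" "r < 1" "0 < s" "s < 1"
    have "(norm (u - v))\<^sup>2 = Re (u * cnj u) + Re (v * cnj v) - 2 * Re (u * cnj v)" for u v :: complex
      unfolding cmod_power2 by (simp add: power2_eq_square algebra_simps)
    then have "(LINT t|circ. (norm (f (of_real r * cis t) - f (of_real s * cis t)))\<^sup>2) =
      (LINT t|circ. ?J r r t +
         ?J s s t -
         2 * ?J r s t)" by (simp only:)
    also have "\<dots> = (LINT t|circ. ?J r r t) +
         (LINT t|circ. ?J s s t) -
         2 * (LINT t|circ. ?J r s t)"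
    proof -
      have I: "integrable circ (\<lambda>t. ?J r r t)"
        "integrable circ (\<lambda>t. ?J s s t)"
        "integrable circ (\<lambda>t. ?J r s t)"
        by (intro integrable_Re int rs)+
      show ?thesis
        using Bochner_Integration.integral_diff[OF Bochner_Integration.integrable_add[OF I(1,2)]
            integrable_mult_right[OF I(3), of 2]] Bochner_Integration.integral_add[OF I(1,2)]
        by (simp only: integral_mult_right_zero)
    qed
    also have "\<dots> = L (r * r) + L (s * s) - 2 * L (r * s)"
      using KL int rs by (simp only: integral_Re)
    finally show "(LINT t|circ. (norm (f (of_real r * cis t) - f (of_real s * cis t)))\<^sup>2)
      = L (r * r) + L (s * s) - 2 * L (r * s)" .
  qed
qed

text \<open>Convergence in the square mean becomes convergence almost everywhere along radii that
  tend to 1 fast enough. One such sequence suffices to represent \<open>f\<close> by a Poisson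
  integral.\<close>

lemma bounded_holomorphic_boundary_function:
  assumes f: "f holomorphic_on ball 0 1" and B: "\<And>z. norm z < 1 \<Longrightarrow> norm (f z) \<le> B"
  obtains g \<rho> where "g \<in> borel_measurable borel" "\<And>t::real. norm (g t) \<le> B"
    "\<And>k::nat. 0 < \<rho> k" "\<And>k. \<rho> k < 1" "\<rho> \<longlonglongrightarrow> 1"
    "AE t in circ. (\<lambda>k. f (of_real (\<rho> k) * cis t)) \<longlonglongrightarrow> g t"
proof -
  obtain L S where L: "mono_on {0<..<1} L" "\<And>x. 0 < x \<Longrightarrow> x < 1 \<Longrightarrow> L x \<le> (S::real)"
    "\<And>e. 0 < e \<Longrightarrow> \<exists>x. 0 < x \<and> x < 1 \<and> S - e < L x"
    "\<And>r s. 0 < r \<Longrightarrow> r < 1 \<Longrightarrow> 0 < s \<Longrightarrow> s < 1 \<Longrightarrow>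
      (LINT t|circ. (norm (f (of_real r * cis t) - f (of_real s * cis t)))\<^sup>2)
      = L (r * r) + L (s * s) - 2 * L (r * s)"
    using bounded_holomorphic_L2_cauchy[OF f B] by blast
  \<comment> \<open>The rate \<open>(1/8)^k\<close> leaves room for the factor \<open>2^k\<close>
    lost in passing from the square mean to the mean; the bound \<open>1 - 1 / (real k + 2)\<close>
    drives the radii to 1.\<close>
  have "\<exists>r. 0 < r \<and> r < 1 \<and> 1 - 1 / (real k + 2) \<le> r \<and> S - (1/8)^k < L (r * r)" for k
  proof -
    obtain x where x: "0 < x" "x < 1" "S - (1/8)^k < L x" using L(3)[of "(1/8)^k"] by auto
    define r where "r = max (sqrt x) (1 - 1 / (real k + 2))"
    have r: "0 < r" "r < 1" "1 - 1 / (real k + 2) \<le> r" "sqrt x \<le> r"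
      using x by (auto simp: r_def less_max_iff_disj)
    have "x = sqrt x * sqrt x" using x by simp
    also have "\<dots> \<le> r * r" using r x by (intro mult_mono) auto
    finally have "x \<le> r * r" .
    moreover have "r * r < 1" using r mult_strict_mono[of r 1 r 1] by simp
    ultimately have "L x \<le> L (r * r)" using x by (intro mono_onD[OF L(1)]) auto
    then show ?thesis using r x by force
  qed
  then obtain \<rho> where \<rho>: "\<And>k. 0 < \<rho> k" "\<And>k. \<rho> k < 1" "\<And>k. 1 - 1 / (real k + 2) \<le> \<rho> k"
    "\<And>k. S - (1/8)^k < L (\<rho> k * \<rho> k)" by metis
  have \<rho>lim: "\<rho> \<longlonglongrightarrow> 1"
  proof (rule tendsto_sandwich)
    show "(\<lambda>k. 1 - 1 / (real k + 2)) \<longlonglongrightarrow> 1" by real_asymp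
    show "\<forall>\<^sub>F k in sequentially. 1 - 1 / (real k + 2) \<le> \<rho> k" using \<rho> by auto
    show "\<forall>\<^sub>F k in sequentially. \<rho> k \<le> 1" using \<rho>(2) by (intro always_eventually allI less_imp_le)
  qed auto
  define F where "F k t = f (of_real (\<rho> k) * cis t)" for k t
  have contF: "continuous_on A (F k)" for k A
    unfolding F_def using \<rho>[of k]
    by (intro continuous_on_circle_comp holomorphic_on_imp_continuous_on[OF f]) auto
  have FB: "norm (F k t) \<le> B" for k t
    using B \<rho>[of k] unfolding F_def by (simp add: norm_mult)
  \<comment> \<open>The default 0 makes \<open>g\<close> Borel and bounded at every point, as the
    averages over intervals of the line require later.\<close>
  define g where "g t = (if convergent (\<lambda>k. F k t) then lim (\<lambda>k. F k t) else 0)" for t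
  have D: "(LINT t|circ. (norm (F (Suc k) t - F k t))\<^sup>2) \<le> 2 * (1/8)^k" for k
  proof -
    define m where "m = min (\<rho> k) (\<rho> (Suc k))"
    have m: "0 < m" "m < 1" using \<rho> by (auto simp: m_def min_less_iff_disj)
    have lt1: "x * y < 1" if "0 < x" "x < 1" "0 < y" "y < 1" for x y :: real
      using that mult_strict_mono[of x 1 y 1] by simp
    have "S - (1/8)^k < L (m * m)"
    proof (cases "\<rho> k \<le> \<rho> (Suc k)")
      case False
      have "(1/8::real) ^ Suc k \<le> (1/8)^k" by simp
      then have "S - (1/8)^k < L (\<rho> (Suc k) * \<rho> (Suc k))" using \<rho>(4)[of "Suc k"] by linarith
      then show ?thesis using False by (simp add: m_def min_def)
    qed (use \<rho>(4)[of k] in \<open>simp add: m_def min_def\<close>)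
    also have "\<dots> \<le> L (\<rho> (Suc k) * \<rho> k)"
      using m lt1 \<rho>(1,2)[of k] \<rho>(1,2)[of "Suc k"]
      by (intro mono_onD[OF L(1)] mult_mono) (auto simp: m_def)
    finally have "S - (1/8)^k < L (\<rho> (Suc k) * \<rho> k)" .
    moreover have "L (\<rho> (Suc k) * \<rho> (Suc k)) \<le> S" "L (\<rho> k * \<rho> k) \<le> S"
      using \<rho> lt1 by (auto intro!: L(2))
    ultimately show ?thesis
      using L(4)[of "\<rho> (Suc k)" "\<rho> k"] \<rho> unfolding F_def by simp
  qed
  have intF: "integrable circ (\<lambda>t. norm (F (Suc k) t - F k t))"
    "integrable circ (\<lambda>t. (norm (F (Suc k) t - F k t))\<^sup>2)" for k
    by (intro integrable_circ_continuous continuous_intros contF)+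
  have D1: "(LINT t|circ. norm (F (Suc k) t - F k t)) \<le> (2 + 2 * pi) * (1/2)^k" for k
  proof -
    have "(LINT t|circ. norm (F (Suc k) t - F k t)) \<le>
        (LINT t|circ. 2^k * (norm (F (Suc k) t - F k t))\<^sup>2 + (1/2)^k)"
    proof (rule integral_mono)
      fix t
      define x where "x = norm (F (Suc k) t - F k t)"
      \<comment> \<open>With \<open>y = x * 2^k\<close> this is \<open>y \<le> y^2 + 1\<close>;
        division by \<open>2^k\<close> gives the claim.\<close>
      have "0 \<le> (x * 2^k - 1)\<^sup>2 + x * 2 ^ k" by (simp add: x_def)
      then have "x * 2^k \<le> (x * 2^k)\<^sup>2 + 1" by (simp add: power2_diff)
      then have "(x * 2^k) / 2^k \<le> ((x * 2^k)\<^sup>2 + 1) / 2 ^ k" by (intro divide_right_mono) auto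
      then show "x \<le> 2^k * x\<^sup>2 + (1/2)^k"
        by (simp add: power_divide add_divide_distrib power2_eq_square mult_ac)
    qed (use intF in \<open>auto intro!: Bochner_Integration.integrable_add finite_measure.integrable_const finite_measure_circ\<close>)
    also have "\<dots> = 2^k * (LINT t|circ. (norm (F (Suc k) t - F k t))\<^sup>2) + 2 * pi * (1/2)^k"
      using intF by (subst Bochner_Integration.integral_add)
        (auto intro!: finite_measure.integrable_const finite_measure_circ)
    also have "\<dots> \<le> 2^k * (2 * (1/8)^k) + 2 * pi * (1/2)^k"
      using D by (intro add_right_mono mult_left_mono) auto
    also have "2^k * (2 * (1/8)^k) = 2 * (1/4::real)^k"
      by (simp add: power_mult_distrib[symmetric])
    also have "\<dots> \<le> 2 * (1/2)^k" by (intro mult_left_mono power_mono) auto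
    finally show ?thesis by (simp add: algebra_simps)
  qed
  have "AE t in circ. summable (\<lambda>k. norm (F (Suc k) t - F k t))"
  proof -
    have sm: "summable (\<lambda>k. (2 + 2 * pi) * (1/2)^k)" by (intro summable_mult summable_geometric) auto
    have "(\<integral>\<^sup>+t. (\<Sum>k. ennreal (norm (F (Suc k) t - F k t))) \<partial>circ)
      = (\<Sum>k. \<integral>\<^sup>+t. ennreal (norm (F (Suc k) t - F k t)) \<partial>circ)"
      using intF by (intro nn_integral_suminf) auto
    also have "\<dots> = (\<Sum>k. ennreal (LINT t|circ. norm (F (Suc k) t - F k t)))"
      using intF by (intro suminf_cong nn_integral_eq_integral) auto
    also have "\<dots> \<le> (\<Sum>k. ennreal ((2 + 2 * pi) * (1/2)^k))"
      using D1 by (intro suminf_le ennreal_leI) auto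
    also have "\<dots> = ennreal (\<Sum>k. (2 + 2 * pi) * (1/2)^k)"
      by (intro suminf_ennreal2 sm) auto
    also have "\<dots> < \<infinity>" by simp
    finally have "AE t in circ. (\<Sum>k. ennreal (norm (F (Suc k) t - F k t))) \<noteq> \<infinity>"
      using intF by (intro nn_integral_PInf_AE) auto
    then show ?thesis
      by eventually_elim (rule summable_suminf_not_top, auto)
  qed
  then have lim: "AE t in circ. (\<lambda>k. F k t) \<longlonglongrightarrow> g t"
  proof eventually_elim
    case (elim t)
    then have "summable (\<lambda>k. F (Suc k) t - F k t)" by (rule summable_norm_cancel)
    then have "convergent (\<lambda>n. \<Sum>k<n. F (Suc k) t - F k t)" by (simp add: summable_iff_convergent)
    then have "convergent (\<lambda>n. F n t - F 0 t)" using sum_lessThan_telescope[of "\<lambda>k. F k t"] by simp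
    then have "convergent (\<lambda>n. F n t)" by (simp add: convergent_diff_const_right_iff)
    then show ?case by (simp add: g_def convergent_LIMSEQ_iff)
  qed
  have "F k \<in> borel_measurable borel" for k
    by (intro borel_measurable_continuous_onI contF)
  then have gm: "g \<in> borel_measurable borel" unfolding g_def
    unfolding Cauchy_convergent_iff[symmetric] by measurable
  have "norm (g t) \<le> B" for t
  proof (cases "convergent (\<lambda>k. F k t)")
    case True
    then have "(\<lambda>k. F k t) \<longlonglongrightarrow> g t" by (simp add: g_def convergent_LIMSEQ_iff)
    then show ?thesis using FB by (intro Lim_bounded[OF tendsto_norm]) auto
  next
    case False
    have "0 \<le> B" using FB[of 0 t] norm_ge_zero order_trans by blast
    then show ?thesis using False by (simp add: g_def)
  qed
  with gm \<rho> \<rho>lim lim show ?thesis unfolding F_def by (intro that) auto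
qed

section \<open>The Poisson kernel and the Poisson representation\<close>

definition poisson :: "complex \<Rightarrow> real \<Rightarrow> real" where
  "poisson z t = (1 - (norm z)\<^sup>2) / (norm (cis t - z))\<^sup>2"

lemma cis_minus_nonzero: "norm z < 1 \<Longrightarrow> cis t - z \<noteq> 0"
  by (metis eq_iff_diff_eq_0 less_irrefl norm_cis)

lemma continuous_on_poisson: "norm z < 1 \<Longrightarrow> continuous_on A (poisson z)"
  unfolding poisson_def by (auto intro!: continuous_intros simp: cis_minus_nonzero)

lemma poisson_nonneg: "norm z < 1 \<Longrightarrow> 0 \<le> poisson z t"
  by (simp add: poisson_def power_le_one)

text \<open>For \<open>w\<close> on the circle the kernel is the sum of \<open>w / (w - z)\<close>
  and \<open>w * cnj z / (1 - cnj z * w)\<close>. The second summand times \<open>f\<close> is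
  holomorphic on the closed disc and vanishes at 0, so its mean is 0; the first gives Cauchy's
  formula.\<close>

lemma poisson_integral_holomorphic:
  fixes f :: "complex \<Rightarrow> complex"
  assumes f: "f holomorphic_on cball 0 1" and z: "norm z < 1"
  shows "(LINT t|circ. of_real (poisson z t) * f (cis t)) = of_real (2 * pi) * f z"
proof -
  have cont: "continuous_on (cball 0 1) f" by (rule holomorphic_on_imp_continuous_on[OF f])
  have cont2: "continuous_on A (\<lambda>t. f (cis t))" for A
    by (intro continuous_on_compose2[OF cont]) (auto intro!: continuous_intros)
  have nz: "w - z \<noteq> 0" if "norm w = 1" for w using that z by auto
  have nz2: "1 - cnj z * w \<noteq> 0" if "norm w \<le> 1" for w
  proof
    assume "1 - cnj z * w = 0"
    then have "norm (cnj z * w) = 1" by (simp add: eq_iff_diff_eq_0[symmetric])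
    moreover have "norm (cnj z * w) < 1"
      using that z mult_mono[of "norm z" "norm z" "norm w" 1] by (simp add: norm_mult)
    ultimately show False by simp
  qed
  have "((\<lambda>u. f u / (u - z)) has_contour_integral (2 * of_real pi * \<i> * f z)) (circlepath 0 1)"
    using z by (intro Cauchy_integral_circlepath_simple f) auto
  moreover have "continuous_on (sphere 0 1) (\<lambda>u. f u / (u - z))"
    using nz by (intro continuous_intros continuous_on_subset[OF cont]) auto
  ultimately have "(LINT t|circ. f (of_real 1 * cis t) / (of_real 1 * cis t - z) *
      (of_real 1 * \<i> * cis t)) = 2 * of_real pi * \<i> * f z"
    by (intro has_contour_integral_circlepath_imp_integral_circ) auto
  then have 1: "\<i> * (LINT t|circ. f (cis t) * cis t / (cis t - z)) = \<i> * (of_real (2 * pi) * f z)"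
    by (subst integral_mult_right_zero[symmetric]) (simp add: mult_ac)
  have 2: "(LINT t|circ. (of_real 1 * cis t) * f (of_real 1 * cis t) * cnj z / (1 - cnj z * (of_real 1 * cis t)))
     = of_real (2 * pi) * (0 * f 0 * cnj z / (1 - cnj z * 0))"
    by (rule holomorphic_circle_mean) (use nz2 in \<open>auto intro!: holomorphic_intros f\<close>)
  have eq: "of_real (poisson z t) * f (cis t) = f (cis t) * cis t / (cis t - z) +
      cis t * f (cis t) * cnj z / (1 - cnj z * cis t)" for t
  proof -
    define w where "w = cis t"
    have w: "cnj w * w = 1" "norm w = 1" unfolding w_def by (simp_all add: cis_cnj cis_mult)
    have n1: "w - z \<noteq> 0" "1 - cnj z * w \<noteq> 0" "w \<noteq> 0" using nz[OF w(2)] nz2[of w] w by auto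
    have n3: "cnj w - cnj z \<noteq> 0" using n1(1) by (metis complex_cnj_diff complex_cnj_zero_iff)
    have e: "1 - cnj z * w = w * (cnj w - cnj z)" using w by (simp add: algebra_simps)
    have "of_real (poisson z t) = (1 - z * cnj z) / ((w - z) * (cnj w - cnj z))"
      by (simp add: poisson_def w_def[symmetric] complex_norm_square[symmetric] flip: complex_cnj_diff)
    also have "1 - z * cnj z = w * (cnj w - cnj z) + cnj z * (w - z)"
      using w by (simp add: algebra_simps)
    also have "(w * (cnj w - cnj z) + cnj z * (w - z)) / ((w - z) * (cnj w - cnj z))
       = w / (w - z) + cnj z / (cnj w - cnj z)"
      using n1 n3 by (simp add: field_simps)
    finally have "of_real (poisson z t) = w / (w - z) + w * cnj z / (1 - cnj z * w)"
      unfolding e using n1 by simp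
    then show ?thesis unfolding w_def[symmetric] by (simp add: algebra_simps)
  qed
  have "(LINT t|circ. of_real (poisson z t) * f (cis t)) = (LINT t|circ. f (cis t) * cis t / (cis t - z))
      + (LINT t|circ. cis t * f (cis t) * cnj z / (1 - cnj z * cis t))"
    unfolding eq
  proof (rule Bochner_Integration.integral_add)
    show "integrable circ (\<lambda>t. f (cis t) * cis t / (cis t - z))"
      using z by (intro integrable_circ_continuous continuous_intros cont2) (auto simp: cis_minus_nonzero)
    show "integrable circ (\<lambda>t. cis t * f (cis t) * cnj z / (1 - cnj z * cis t))"
      using nz2 by (intro integrable_circ_continuous continuous_intros cont2) auto
  qed
  then show ?thesis using 1 2 by simp
qed

lemma poisson_integral_1: "norm z < 1 \<Longrightarrow> (LINT t|circ. poisson z t) = 2 * pi"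
proof -
  assume z: "norm z < 1"
  have "complex_of_real (LINT t|circ. poisson z t) = of_real (2 * pi)"
    using poisson_integral_holomorphic[of "\<lambda>_. 1" z] z by simp
  then show ?thesis using of_real_eq_iff by blast
qed

lemma poisson_le: "norm z < 1 \<Longrightarrow> poisson z t \<le> 2 / (1 - norm z)"
proof -
  assume z: "norm z < 1"
  define d where "d = 1 - norm z"
  have d: "0 < d" using z by (simp add: d_def)
  have "d \<le> norm (cis t - z)" using norm_triangle_ineq2[of "cis t" z] by (simp add: d_def)
  then have "d\<^sup>2 \<le> (norm (cis t - z))\<^sup>2" using d by (intro power_mono) auto
  moreover have "1 - (norm z)\<^sup>2 \<le> 2 * d"
    using zero_le_power2[of "1 - norm z"] by (simp add: d_def power2_diff)
  ultimately have "poisson z t \<le> 2 * d / d\<^sup>2"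
    unfolding poisson_def using d z by (intro frac_le) (auto simp: power_le_one)
  then show ?thesis using d by (simp add: d_def[symmetric] power2_eq_square)
qed

text \<open>The dilations of \<open>f\<close> by \<open>\<rho> k\<close> are holomorphic on the
  closed disc and have the representation. Dominated convergence on the circle and continuity of
  \<open>f\<close> at \<open>z\<close> carry it to the limit.\<close>

lemma bounded_holomorphic_poisson_rep:
  assumes f: "f holomorphic_on ball 0 1" and B: "\<And>z. norm z < 1 \<Longrightarrow> norm (f z) \<le> B"
  obtains g where "g \<in> borel_measurable borel" "\<And>t::real. norm (g t) \<le> B"
    "\<And>z. norm z < 1 \<Longrightarrow> (LINT t|circ. of_real (poisson z t) * g t) = of_real (2 * pi) * f z"
proof -
  obtain g \<rho> where g: "g \<in> borel_measurable borel" "\<And>t::real. norm (g t) \<le> B"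
    and \<rho>: "\<And>k::nat. 0 < \<rho> k" "\<And>k. \<rho> k < 1" "\<rho> \<longlonglongrightarrow> 1"
    and lim: "AE t in circ. (\<lambda>k. f (of_real (\<rho> k) * cis t)) \<longlonglongrightarrow> g t"
    by (rule bounded_holomorphic_boundary_function[OF f B], assumption) (rule that; assumption)
  have gm: "g \<in> borel_measurable circ" using g(1) by (intro measurable_restrict_space1 measurable_completion) simp
  have "(LINT t|circ. of_real (poisson z t) * g t) = of_real (2 * pi) * f z" if z: "norm z < 1" for z
  proof -
    have "(\<lambda>k. LINT t|circ. of_real (poisson z t) * f (of_real (\<rho> k) * cis t))
        \<longlonglongrightarrow> (LINT t|circ. of_real (poisson z t) * g t)"
    proof (rule integral_dominated_convergence[where w="\<lambda>_. 2 / (1 - norm z) * B"])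
      show "(\<lambda>t. of_real (poisson z t) * g t) \<in> borel_measurable circ"
        using gm measurable_circ_continuous[OF continuous_on_poisson[OF z]] by measurable
      show "(\<lambda>t. of_real (poisson z t) * f (of_real (\<rho> k) * cis t)) \<in> borel_measurable circ" for k
        using \<rho>(1,2)[of k] z by (intro measurable_circ_continuous continuous_intros continuous_on_poisson
          continuous_on_circle_comp holomorphic_on_imp_continuous_on[OF f]) auto
      show "integrable circ (\<lambda>_. 2 / (1 - norm z) * B)"
        by (intro finite_measure.integrable_const finite_measure_circ)
      show "AE t in circ. (\<lambda>k. of_real (poisson z t) * f (of_real (\<rho> k) * cis t))
         \<longlonglongrightarrow> of_real (poisson z t) * g t"
        using lim by eventually_elim (intro tendsto_intros)
      show "AE t in circ. norm (of_real (poisson z t) * f (of_real (\<rho> k) * cis t)) \<le> 2 / (1 - norm z) * B" for k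
      proof (rule AE_I2)
        fix t
        have "norm (f (of_real (\<rho> k) * cis t)) \<le> B" using B \<rho>(1,2)[of k] by (simp add: norm_mult)
        then show "norm (of_real (poisson z t) * f (of_real (\<rho> k) * cis t)) \<le> 2 / (1 - norm z) * B"
          unfolding norm_mult using z poisson_le[OF z, of t] poisson_nonneg[OF z, of t]
          by (intro mult_mono) (auto simp del: times_divide_eq_left)
      qed
    qed
    moreover have "(LINT t|circ. of_real (poisson z t) * f (of_real (\<rho> k) * cis t))
        = of_real (2 * pi) * f (of_real (\<rho> k) * z)" for k
    proof (rule poisson_integral_holomorphic[OF _ z])
      show "(\<lambda>w. f (of_real (\<rho> k) * w)) holomorphic_on cball 0 1"
      proof (rule holomorphic_on_compose_gen[OF _ f, unfolded o_def])
        have "\<rho> k * norm w < 1" if "norm w \<le> 1" for w :: complex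
          using \<rho>(1,2)[of k] that mult_left_mono[of "norm w" 1 "\<rho> k"] by linarith
        then show "(*) (of_real (\<rho> k)) ` cball 0 1 \<subseteq> ball (0::complex) 1"
          using \<rho>(1)[of k] by (auto simp: norm_mult)
      qed (intro holomorphic_intros)
    qed
    moreover have "(\<lambda>k. of_real (2 * pi) * f (of_real (\<rho> k) * z)) \<longlonglongrightarrow> of_real (2 * pi) * f z"
    proof (intro tendsto_intros)
      have "isCont f z" using z f
        by (intro continuous_on_interior[OF holomorphic_on_imp_continuous_on[OF f]]) auto
      moreover have "(\<lambda>k. of_real (\<rho> k) * z) \<longlonglongrightarrow> of_real 1 * z"
        by (intro tendsto_intros \<rho>)
      ultimately show "(\<lambda>k. f (of_real (\<rho> k) * z)) \<longlonglongrightarrow> f z"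
        using isCont_tendsto_compose by fastforce
    qed
    ultimately show ?thesis by (simp only: LIMSEQ_unique)
  qed
  with g show ?thesis by (rule that)
qed

section \<open>Fatou's theorem\<close>

lemma bounded_borel_integrable_on:
  fixes g :: "real \<Rightarrow> 'a::euclidean_space"
  assumes "g \<in> borel_measurable borel" "\<And>t. norm (g t) \<le> B"
  shows "g integrable_on {a..b}"
proof (rule measurable_bounded_by_integrable_imp_integrable[where g="\<lambda>_. B"])
  show "g \<in> borel_measurable (lebesgue_on {a..b})"
    using assms(1) by (intro measurable_restrict_space1 measurable_completion) simp
qed (use assms in auto)

text \<open>The differentiation theorem, applied to \<open>norm (g s - q)\<close> for all
  \<open>q\<close> in a countable dense set, leaves one null set. Off it, \<open>q\<close> is taken
  within \<open>e / 3\<close> of \<open>g x\<close>: the average of \<open>norm (g s - q)\<close> is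
  then below \<open>2 * e / 3\<close>, and replacing \<open>q\<close> by \<open>g x\<close> costs
  another \<open>e / 3\<close>.\<close>

lemma right_lebesgue_points:
  fixes g :: "real \<Rightarrow> complex"
  assumes g: "g \<in> borel_measurable borel" and B: "\<And>t. norm (g t) \<le> B"
  obtains N where "negligible N"
    "\<And>x e. x \<notin> N \<Longrightarrow> 0 < e \<Longrightarrow>
       \<exists>d>0. \<forall>h. 0 < h \<and> h < d \<longrightarrow> integral {x..x + h} (\<lambda>s. norm (g s - g x)) \<le> e * h"
proof -
  obtain D :: "complex set" where D: "countable D" "\<And>X. open X \<Longrightarrow> X \<noteq> {} \<Longrightarrow> \<exists>d\<in>D. d \<in> X"
    using countable_dense_exists by metis
  have int: "(\<lambda>s. norm (g s - q)) integrable_on {a..b}" for q a b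
    using g by (intro bounded_borel_integrable_on[where B="B + norm q"])
      (auto intro: order_trans[OF norm_triangle_ineq4] add_right_mono B)
  have "\<exists>N. negligible N \<and> (\<forall>x e. x \<notin> N \<longrightarrow> 0 < e \<longrightarrow> (\<exists>d>0. \<forall>h. 0 < h \<and> h < d \<longrightarrow>
       \<bar>integral {x..x + h} (\<lambda>s. norm (g s - q)) / h - norm (g x - q)\<bar> < e))" for q
  proof -
    obtain N where N: "negligible N" "\<And>x e. x \<notin> N \<Longrightarrow> 0 < e \<Longrightarrow> \<exists>d>0. \<forall>h. 0 < h \<and> h < d \<longrightarrow>
        norm (integral (cbox x (x + h *\<^sub>R One)) (\<lambda>s. norm (g s - q)) /\<^sub>R h ^ DIM(real) - norm (g x - q)) < e"
      by (rule integrable_ccontinuous_explicit[of "\<lambda>s::real. norm (g s - q)"])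
         (simp_all add: int)
    have "integral (cbox x (x + h *\<^sub>R One)) u /\<^sub>R h ^ DIM(real) = integral {x..x + h} u / h"
      for x h :: real and u :: "real \<Rightarrow> real"
      by (simp add: divide_inverse_commute)
    then show ?thesis using N unfolding real_norm_def by metis
  qed
  then obtain N where N: "\<And>q. negligible (N q)" "\<And>q x e. x \<notin> N q \<Longrightarrow> 0 < e \<Longrightarrow> (\<exists>d>0. \<forall>h. 0 < h \<and> h < d \<longrightarrow>
       \<bar>integral {x..x + h} (\<lambda>s. norm (g s - q)) / h - norm (g x - q)\<bar> < e)" by metis
  show ?thesis
  proof (rule that)
    show "negligible (\<Union>q\<in>D. N q)"
      using D(1) N(1) by (intro negligible_countable_Union) auto
    fix x and e :: real assume x: "x \<notin> (\<Union>q\<in>D. N q)" and e: "0 < e"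
    obtain q where q: "q \<in> D" "norm (g x - q) < e / 3"
      using D(2)[of "ball (g x) (e/3)"] e by (auto simp: dist_norm)
    obtain d where d: "d > 0" "\<And>h. 0 < h \<and> h < d \<Longrightarrow>
       \<bar>integral {x..x + h} (\<lambda>s. norm (g s - q)) / h - norm (g x - q)\<bar> < e / 3"
      using N(2)[of x q "e/3"] x q e by auto
    have "integral {x..x + h} (\<lambda>s. norm (g s - g x)) \<le> e * h" if h: "0 < h" "h < d" for h
    proof -
      have "integral {x..x + h} (\<lambda>s. norm (g s - g x)) \<le>
          integral {x..x + h} (\<lambda>s. norm (g s - q) + norm (g x - q))"
      proof (rule integral_le)
        fix s show "norm (g s - g x) \<le> norm (g s - q) + norm (g x - q)"
          using norm_triangle_ineq4[of "g s - q" "g x - q"] by simp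
      qed (intro integrable_add int integrable_const_ivl)+
      also have "\<dots> = integral {x..x + h} (\<lambda>s. norm (g s - q)) + h * norm (g x - q)"
        using h by (subst integral_add) (auto intro: int)
      also have "integral {x..x + h} (\<lambda>s. norm (g s - q)) / h < 2 * e / 3"
        using d(2)[OF conjI[OF h]] q(2) by linarith
      then have "integral {x..x + h} (\<lambda>s. norm (g s - q)) \<le> 2 * e / 3 * h"
        using h by (simp add: field_simps)
      also have "2 * e / 3 * h + h * norm (g x - q) \<le> 2 * e / 3 * h + h * (e / 3)"
        using q h by (intro add_left_mono mult_left_mono) auto
      finally show ?thesis by (simp add: field_simps)
    qed
    then show "\<exists>d>0. \<forall>h. 0 < h \<and> h < d \<longrightarrow> integral {x..x + h} (\<lambda>s. norm (g s - g x)) \<le> e * h"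
      using d(1) by blast
  qed
qed

text \<open>The left half of a symmetric interval is a right half for the reflected
  function.\<close>

lemma lebesgue_points:
  fixes g :: "real \<Rightarrow> complex"
  assumes g: "g \<in> borel_measurable borel" and B: "\<And>t. norm (g t) \<le> B"
  obtains N where "negligible N"
    "\<And>x e. x \<notin> N \<Longrightarrow> 0 < e \<Longrightarrow>
       \<exists>d>0. \<forall>h. 0 < h \<and> h < d \<longrightarrow> integral {x - h..x + h} (\<lambda>s. norm (g s - g x)) \<le> e * h"
proof -
  obtain N1 where N1: "negligible N1" "\<And>x e. x \<notin> N1 \<Longrightarrow> 0 < e \<Longrightarrow>
       \<exists>d>0. \<forall>h. 0 < h \<and> h < d \<longrightarrow> integral {x..x + h} (\<lambda>s. norm (g s - g x)) \<le> e * h"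
    by (rule right_lebesgue_points[OF g B]) (rule that; assumption)
  have g2: "(\<lambda>s. g (- s)) \<in> borel_measurable borel" using g by measurable
  obtain N2 where N2: "negligible N2" "\<And>x e. x \<notin> N2 \<Longrightarrow> 0 < e \<Longrightarrow>
       \<exists>d>0. \<forall>h. 0 < h \<and> h < d \<longrightarrow> integral {x..x + h} (\<lambda>s. norm (g (- s) - g (- x))) \<le> e * h"
    by (rule right_lebesgue_points[OF g2 B]) (rule that; assumption)
  show ?thesis
  proof (rule that)
    show "negligible (N1 \<union> uminus ` N2)"
      using N1(1) N2(1)
      by (intro negligible_Un negligible_differentiable_image_negligible) (auto intro!: derivative_intros)
    fix x and e :: real assume x: "x \<notin> N1 \<union> uminus ` N2" and e: "0 < e"
    then have nx: "- x \<notin> N2" by force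
    obtain d1 where d1: "d1 > 0" "\<And>h. 0 < h \<and> h < d1 \<Longrightarrow>
        integral {x..x + h} (\<lambda>s. norm (g s - g x)) \<le> (e/2) * h"
      using N1(2)[of x "e/2"] x e by auto
    obtain d2 where d2: "d2 > 0" "\<And>h. 0 < h \<and> h < d2 \<Longrightarrow>
        integral {- x..- x + h} (\<lambda>s. norm (g (- s) - g x)) \<le> (e/2) * h"
      using N2(2)[of "-x" "e/2"] nx e by auto
    have int: "(\<lambda>s. norm (g s - g x)) integrable_on {a..b}" for a b
      using g by (intro bounded_borel_integrable_on[where B="B + norm (g x)"])
        (auto intro: order_trans[OF norm_triangle_ineq4] add_right_mono B)
    have "integral {x - h..x + h} (\<lambda>s. norm (g s - g x)) \<le> e * h"
      if h: "0 < h" "h < min d1 d2" for h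
    proof -
      have "integral {- x..- x + h} (\<lambda>s. norm (g (- s) - g x)) =
          integral {x - h..x} (\<lambda>s. norm (g s - g x))"
        using Henstock_Kurzweil_Integration.integral_reflect_real[of x "x - h" "\<lambda>s. norm (g s - g x)"] by (simp add: add.commute)
      then have "integral {x - h..x} (\<lambda>s. norm (g s - g x)) \<le> (e/2) * h"
        using d2(2)[of h] h by simp
      moreover have "integral {x..x + h} (\<lambda>s. norm (g s - g x)) \<le> (e/2) * h"
        using d1(2)[of h] h by simp
      moreover have "integral {x - h..x} (\<lambda>s. norm (g s - g x)) + integral {x..x + h} (\<lambda>s. norm (g s - g x))
          = integral {x - h..x + h} (\<lambda>s. norm (g s - g x))"
        using h by (intro Henstock_Kurzweil_Integration.integral_combine int) auto
      ultimately show ?thesis by (simp add: field_simps)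
    qed
    then show "\<exists>d>0. \<forall>h. 0 < h \<and> h < d \<longrightarrow> integral {x - h..x + h} (\<lambda>s. norm (g s - g x)) \<le> e * h"
      using d1(1) d2(1) by (intro exI[of _ "min d1 d2"]) auto
  qed
qed

text \<open>Induction on the dyadic scale of \<open>h\<close>: the shell at distance \<open>2 ^ n * d\<close> contributes at
  most \<open>2 * e / 2 ^ n\<close>.\<close>

lemma poisson_type_bound:
  fixes \<phi> k :: "real \<Rightarrow> real"
  assumes \<phi>: "integrable circ \<phi>" "\<And>t. 0 \<le> \<phi> t"
    and kint: "integrable circ (\<lambda>t. k t * \<phi> t)" and k0: "\<And>t. 0 \<le> k t"
    and k1: "\<And>t. k t \<le> 1 / d" and k2: "\<And>t. t \<noteq> x \<Longrightarrow> \<bar>t - x\<bar> \<le> \<delta> \<Longrightarrow> k t \<le> d / (t - x)\<^sup>2" and d: "0 < d"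
    and avg: "\<And>h. 0 < h \<Longrightarrow> h \<le> \<delta> \<Longrightarrow> (LINT t|circ. indicator {x - h..x + h} t * \<phi> t) \<le> e * h"
    and h: "0 < h" "h \<le> \<delta>"
  shows "(LINT t|circ. indicator {x - h..x + h} t * (k t * \<phi> t)) \<le> 5 * e"
proof -
  have e: "0 \<le> e"
  proof -
    have "0 \<le> (LINT t|circ. indicator {x - h..x + h} t * \<phi> t)" using \<phi>(2) by simp
    then have "0 \<le> e * h" using avg[OF h] by linarith
    then show ?thesis using h by (simp add: zero_le_mult_iff)
  qed
  have ind: "integrable circ (\<lambda>t. indicator {x - h..x + h} t * u t)" if "integrable circ u" for u :: "real \<Rightarrow> real" and h
  proof -
    have "(\<lambda>t. indicator {x - h..x + h} t :: real) \<in> borel_measurable circ"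
      by (intro measurable_restrict_space1 measurable_completion) simp
    then show ?thesis
      using that by (intro Bochner_Integration.integrable_bound[OF that]) (auto simp: indicator_def)
  qed
  \<comment> \<open>\<open>5 - 4 / 2 ^ n\<close> is 1 for the core, where
    \<open>k \<le> 1 / d\<close> is used, plus the shell terms \<open>2 / 2 ^ j\<close> for
    \<open>j < n\<close>.\<close>
  have "(LINT t|circ. indicator {x - h..x + h} t * (k t * \<phi> t)) \<le> e * (5 - 4 / 2 ^ n)"
    if "0 < h" "h \<le> \<delta>" "h \<le> 2 ^ n * d" for n h
    using that
  proof (induction n arbitrary: h)
    case 0
    have "(LINT t|circ. indicator {x - h..x + h} t * (k t * \<phi> t)) \<le>
      (LINT t|circ. 1 / d * (indicator {x - h..x + h} t * \<phi> t))"
    proof (rule integral_mono)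
      fix t show "indicator {x - h..x + h} t * (k t * \<phi> t) \<le> 1 / d * (indicator {x - h..x + h} t * \<phi> t)"
        using mult_right_mono[OF k1 \<phi>(2), of t t] by (auto simp: indicator_def)
    qed (use ind kint \<phi> in auto)
    also have "\<dots> = 1 / d * (LINT t|circ. indicator {x - h..x + h} t * \<phi> t)" by simp
    also have "\<dots> \<le> 1 / d * (e * h)" using avg[of h] 0 d by (intro mult_left_mono) auto
    also have "\<dots> \<le> e" using 0 d e mult_left_mono[of h d e] by (simp add: field_simps)
    finally show ?case by simp
  next
    case (Suc n)
    show ?case
    proof (cases "h \<le> 2 ^ n * d")
      case True
      have "(LINT t|circ. indicator {x - h..x + h} t * (k t * \<phi> t)) \<le> e * (5 - 4 / 2 ^ n)"
        using Suc True by auto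
      also have "\<dots> \<le> e * (5 - 4 / 2 ^ Suc n)" using e by (intro mult_left_mono) (auto simp: field_simps)
      finally show ?thesis .
    next
      case False
      define h' where "h' = 2 ^ n * d"
      have h': "0 < h'" "h' < h" using False d by (auto simp: h'_def)
      have "(LINT t|circ. indicator {x - h..x + h} t * (k t * \<phi> t)) \<le>
        (LINT t|circ. indicator {x - h'..x + h'} t * (k t * \<phi> t) + 1 / (4 ^ n * d) * (indicator {x - h..x + h} t * \<phi> t))"
      proof (rule integral_mono)
        fix t
        show "indicator {x - h..x + h} t * (k t * \<phi> t) \<le> indicator {x - h'..x + h'} t * (k t * \<phi> t)
            + 1 / (4 ^ n * d) * (indicator {x - h..x + h} t * \<phi> t)"
        proof (cases "t \<in> {x - h..x + h} \<and> t \<notin> {x - h'..x + h'}")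
          case True
          then have t: "h' \<le> \<bar>t - x\<bar>" "t \<noteq> x" "\<bar>t - x\<bar> \<le> \<delta>" using h' Suc.prems by auto
          have "h'\<^sup>2 \<le> (t - x)\<^sup>2" using t(1) h' by (metis abs_le_square_iff abs_of_pos)
          then have "k t \<le> d / h'\<^sup>2" using k2[OF t(2,3)] d h'
            by (meson frac_le less_imp_le order_refl order_trans zero_less_power)
          also have "d / h'\<^sup>2 = 1 / (4 ^ n * d)"
            using d by (simp add: h'_def power2_eq_square field_simps flip: power_mult_distrib)
          finally have "k t * \<phi> t \<le> 1 / (4 ^ n * d) * \<phi> t" by (intro mult_right_mono \<phi>)
          then show ?thesis using True by simp
        next
          case False
          then show ?thesis using h' k0[of t] \<phi>(2)[of t] d by (auto simp: indicator_def)
        qed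
      qed (use ind kint \<phi> in auto)
      also have "\<dots> = (LINT t|circ. indicator {x - h'..x + h'} t * (k t * \<phi> t)) +
          1 / (4 ^ n * d) * (LINT t|circ. indicator {x - h..x + h} t * \<phi> t)"
        using ind kint \<phi> by (subst Bochner_Integration.integral_add) auto
      also have "\<dots> \<le> e * (5 - 4 / 2 ^ n) + 1 / (4 ^ n * d) * (e * (2 ^ Suc n * d))"
      proof (intro add_mono mult_left_mono)
        show "(LINT t|circ. indicator {x - h'..x + h'} t * (k t * \<phi> t)) \<le> e * (5 - 4 / 2 ^ n)"
          using Suc h' by (auto simp: h'_def)
        have "e * h \<le> e * (2 ^ Suc n * d)" using Suc.prems e by (intro mult_left_mono) auto
        then show "(LINT t|circ. indicator {x - h..x + h} t * \<phi> t) \<le> e * (2 ^ Suc n * d)"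
          using avg[of h] Suc.prems by linarith
      qed (use d in auto)
      also have "1 / (4 ^ n * d) * (e * (2 ^ Suc n * d)) = e * (2 / 2 ^ n)"
      proof -
        have "(4::real) ^ n = 2 ^ n * 2 ^ n" by (simp flip: power_mult_distrib)
        then show ?thesis using d by (simp add: field_simps)
      qed
      also have "e * (5 - 4 / 2 ^ n) + e * (2 / 2 ^ n) = e * (5 - 4 / 2 ^ Suc n)"
        by (simp add: field_simps)
      finally show ?thesis .
    qed
  qed
  note * = this
  obtain n where "h / d < 2 ^ n" using real_arch_pow[of 2 "h / d"] by auto
  then have "h \<le> 2 ^ n * d" using d by (simp add: field_simps)
  then have "(LINT t|circ. indicator {x - h..x + h} t * (k t * \<phi> t)) \<le> e * (5 - 4 / 2 ^ n)"
    using * h by blast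
  also have "\<dots> \<le> e * 5" using e by (intro mult_left_mono) auto
  finally show ?thesis by simp
qed

text \<open>The derivative of \<open>cis\<close> has modulus 1, so short chords are at least half as
  long as the parameter difference.\<close>

lemma cis_lower_bound: "\<exists>\<delta>>0. \<forall>t. \<bar>t - x\<bar> < \<delta> \<longrightarrow> \<bar>t - x\<bar> \<le> 2 * norm (cis t - cis x)"
proof -
  have "(cis has_vector_derivative \<i> * cis x) (at x)"
    unfolding cis_conv_exp
    by (rule has_vector_derivative_real_field) (auto intro!: derivative_eq_intros)
  then have "(cis has_derivative (\<lambda>h. h *\<^sub>R (\<i> * cis x))) (at x)"
    by (simp add: has_vector_derivative_def)
  then obtain \<delta> where \<delta>: "0 < \<delta>" "\<And>t. norm (t - x) < \<delta> \<Longrightarrow>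
      norm (cis t - cis x - (t - x) *\<^sub>R (\<i> * cis x)) \<le> 1/2 * norm (t - x)"
    unfolding has_derivative_at_alt by (metis half_gt_zero_iff zero_less_one)
  have "\<bar>t - x\<bar> \<le> 2 * norm (cis t - cis x)" if "\<bar>t - x\<bar> < \<delta>" for t
  proof -
    have "norm ((t - x) *\<^sub>R (\<i> * cis x)) = \<bar>t - x\<bar>" by (simp add: norm_mult)
    moreover have "norm ((t - x) *\<^sub>R (\<i> * cis x)) \<le> norm (cis t - cis x - (t - x) *\<^sub>R (\<i> * cis x)) + norm (cis t - cis x)"
      by (metis add.commute norm_minus_commute norm_triangle_sub)
    moreover have "norm (cis t - cis x - (t - x) *\<^sub>R (\<i> * cis x)) \<le> 1/2 * \<bar>t - x\<bar>"
      using \<delta>(2)[of t] that by simp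
    moreover have "u \<le> 2 * b" if "w = u" "w \<le> a + b" "a \<le> 1/2 * u" for u w a b :: real
      using that by linarith
    ultimately show ?thesis by blast
  qed
  then show ?thesis using \<delta> by blast
qed

text \<open>Compactness, as \<open>cis\<close> takes its value at an interior \<open>x\<close> only
  once on the closed interval. The endpoints are excluded because
  \<open>cis 0 = cis (2 * pi)\<close>.\<close>

lemma cis_distance_pos:
  assumes x: "0 < x" "x < 2 * pi" and \<delta>: "0 < \<delta>"
  shows "\<exists>\<eta>>0. \<forall>t\<in>{0..2*pi}. \<delta> \<le> \<bar>t - x\<bar> \<longrightarrow> \<eta> \<le> norm (cis t - cis x)"
proof -
  define K where "K = {0..2*pi} - {x - \<delta><..<x + \<delta>}"
  have "compact K" unfolding K_def by (intro compact_diff) auto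
  moreover have "K \<noteq> {} \<Longrightarrow> ?thesis"
  proof -
    assume "K \<noteq> {}"
    then have "\<exists>s\<in>K. \<forall>t\<in>K. norm (cis s - cis x) \<le> norm (cis t - cis x)"
      by (intro continuous_attains_inf[OF \<open>compact K\<close>] continuous_intros)
    then obtain s where s: "s \<in> K" "\<And>t. t \<in> K \<Longrightarrow> norm (cis s - cis x) \<le> norm (cis t - cis x)"
      by blast
    have "cis s \<noteq> cis x"
    proof
      assume "cis s = cis x"
      then have "cis (s - x) = 1" by (metis cis_divide cis_neq_zero divide_self)
      then have "cos (s - x) = 1" by (simp add: complex_eq_iff)
      then obtain n :: int where n: "s - x = of_int n * (2 * pi)" using cos_one_2pi_int by (auto simp: mult_ac)
      have "-(2 * pi) < s - x" "s - x < 2 * pi" using s(1) x by (auto simp: K_def)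
      then have "-1 < (of_int n::real)" "(of_int n::real) < 1"
        unfolding n using pi_gt_zero mult_less_cancel_right[of "-1" "2 * pi" "of_int n"]
          mult_less_cancel_right[of "of_int n" "2 * pi" 1] by auto
      then have "n = 0" by linarith
      then show False using n s(1) \<delta> by (simp add: K_def)
    qed
    then show ?thesis using s(2) by (intro exI[of _ "norm (cis s - cis x)"]) (auto simp: K_def abs_if split: if_splits)
  qed
  moreover have "K = {} \<Longrightarrow> ?thesis"
    by (intro exI[of _ 1]) (auto simp: K_def abs_if split: if_splits)
  ultimately show ?thesis by blast
qed

lemma integral_circ_indicator_le:
  fixes \<phi> :: "real \<Rightarrow> real"
  assumes \<phi>: "\<And>a b. \<phi> integrable_on {a..b}" "\<And>t::real. 0 \<le> \<phi> t" "integrable circ \<phi>"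
  shows "(LINT t|circ. indicator {a..b} t * \<phi> t) \<le> integral {a..b} \<phi>"
proof -
  have "(LINT t|circ. indicator {a..b} t * \<phi> t) = (LINT t|lebesgue. indicator ({0..2*pi} \<inter> {a..b}) t *\<^sub>R \<phi> t)"
    using integral_restrict_space[of "{0..2*pi}" lebesgue "\<lambda>t. indicator {a..b} t * \<phi> t"]
    unfolding indicator_inter_arith real_scaleR_def mult.assoc by simp
  also have "\<dots> = integral ({0..2*pi} \<inter> {a..b}) \<phi>"
  proof -
    have "set_integrable lebesgue ({0..2*pi} \<inter> {a..b}) \<phi>"
    proof (rule set_integrable_subset[of _ "{0..2*pi}"])
      show "set_integrable lebesgue {0..2*pi} \<phi>"
        using \<phi>(3) by (simp add: set_integrable_def integrable_restrict_space)
    qed auto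
    from set_lebesgue_integral_eq_integral(2)[OF this] show ?thesis
      by (simp only: set_lebesgue_integral_def)
  qed
  also have "\<dots> \<le> integral {a..b} \<phi>"
    using \<phi> by (intro integral_subset_le) (auto simp: Int_atLeastAtMost)
  finally show ?thesis .
qed

lemma stolz_regionD:
  assumes "z \<in> stolz_region \<zeta> \<alpha>"
  shows "norm z < 1" "norm (z - \<zeta>) < \<alpha> * (1 - norm z)"
  using assms by (auto simp: stolz_region_def)

text \<open>Fatou's theorem: the Poisson kernel at a point of a Stolz region is dominated by the radial
  kernel of \<open>poisson_type_bound\<close>, so the limit exists at every Lebesgue point.\<close>

lemma poisson_integral_nontangential_limit:
  assumes g: "g \<in> borel_measurable borel" "\<And>t::real. norm (g t) \<le> B"
    and rep: "\<And>z. norm z < 1 \<Longrightarrow> (LINT t|circ. of_real (poisson z t) * g t) = of_real (2 * pi) * f z"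
    and x: "0 < x" "x < 2 * pi"
    and leb: "\<And>e. 0 < e \<Longrightarrow>
       \<exists>d>0. \<forall>h. 0 < h \<and> h < d \<longrightarrow> integral {x - h..x + h} (\<lambda>s. norm (g s - g x)) \<le> e * h"
  shows "has_nontangential_limit f (cis x) (g x)"
  unfolding has_nontangential_limit_def
proof (intro allI impI)
  fix \<alpha> :: real assume \<alpha>: "1 < \<alpha>"
  define \<phi> where "\<phi> s = norm (g s - g x)" for s
  have B0: "0 \<le> B" using g(2)[of 0] norm_ge_zero order_trans by blast
  have \<phi>0: "0 \<le> \<phi> s" for s by (simp add: \<phi>_def)
  have \<phi>B: "\<phi> s \<le> 2 * B" for s
    using norm_triangle_ineq4[of "g s" "g x"] g(2)[of s] g(2)[of x] by (simp add: \<phi>_def)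
  have \<phi>m: "\<phi> \<in> borel_measurable borel" unfolding \<phi>_def using g(1) by measurable
  have \<phi>int: "\<phi> integrable_on {a..b}" for a b
    using \<phi>m \<phi>B \<phi>0 by (intro bounded_borel_integrable_on[where B="2*B"]) auto
  have circm: "u \<in> borel_measurable circ" if "u \<in> borel_measurable borel" for u :: "real \<Rightarrow> 'b::euclidean_space"
    using that by (intro measurable_restrict_space1 measurable_completion) simp
  have \<phi>circ: "integrable circ \<phi>"
    using \<phi>B \<phi>0 by (intro finite_measure.integrable_const_bound[OF finite_measure_circ, of _ "2*B"] circm \<phi>m) auto
  \<comment> \<open>For \<open>t\<close> near \<open>x\<close> and \<open>z\<close> in the Stolz
    region, \<open>\<bar>t - x\<bar> \<le> 2 * (1 + \<alpha>) * norm (cis t - z)\<close>. Squaring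
    gives \<open>4 * (1 + \<alpha>)^2\<close>, and the numerator of the Poisson kernel, at most
    \<open>2 * d\<close>, doubles it.\<close>
  define A where "A = 8 * (1 + \<alpha>)\<^sup>2"
  have "1 \<le> (1 + \<alpha>)\<^sup>2" using \<alpha> by (intro one_le_power) auto
  then have A: "2 \<le> A" "0 < A" unfolding A_def by linarith+
  have pm: "poisson z \<in> borel_measurable circ" if "norm z < 1" for z
    using measurable_circ_continuous[OF continuous_on_poisson[OF that]] .
  have pint: "integrable circ (\<lambda>t. poisson z t * \<phi> t)" if z: "norm z < 1" for z
  proof (rule finite_measure.integrable_const_bound[OF finite_measure_circ, of _ "2 / (1 - norm z) * (2 * B)"])
    show "AE t in circ. norm (poisson z t * \<phi> t) \<le> 2 / (1 - norm z) * (2 * B)"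
      using poisson_le[OF z] poisson_nonneg[OF z] \<phi>B \<phi>0 z
      by (intro AE_I2) (auto simp: abs_mult simp del: times_divide_eq_left intro!: mult_mono)
  qed (use pm[OF z] circm[OF \<phi>m] in measurable)
  show "(f \<longlongrightarrow> g x) (at (cis x) within stolz_region (cis x) \<alpha>)"
  proof (rule tendstoI)
    fix e0 :: real assume e0: "0 < e0"
    \<comment> \<open>The near part will contribute at most \<open>5 * A * e\<close>, the far part
      at most \<open>4 * pi * B * e\<close>; the summand 1 makes the final estimate strict.\<close>
    define e where "e = e0 / (5 * A + 4 * pi * B + 1)"
    have den: "0 < 5 * A + 4 * pi * B + 1" using A B0 by (simp add: add_nonneg_pos)
    then have e: "0 < e" using e0 by (simp add: e_def)
    obtain d0 where d0: "d0 > 0" "\<And>h. 0 < h \<Longrightarrow> h < d0 \<Longrightarrow> integral {x - h..x + h} \<phi> \<le> e * h"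
      using leb[OF e] unfolding \<phi>_def by blast
    obtain d1 where d1: "d1 > 0" "\<And>t. \<bar>t - x\<bar> < d1 \<Longrightarrow> \<bar>t - x\<bar> \<le> 2 * norm (cis t - cis x)"
      using cis_lower_bound by blast
    define \<delta> where "\<delta> = min d0 d1 / 2"
    have \<delta>: "0 < \<delta>" "\<delta> < d0" "\<delta> < d1" using d0(1) d1(1) by (auto simp: \<delta>_def)
    obtain \<eta> where \<eta>: "0 < \<eta>" "\<And>t. t \<in> {0..2*pi} \<Longrightarrow> \<delta> \<le> \<bar>t - x\<bar> \<Longrightarrow> \<eta> \<le> norm (cis t - cis x)"
      using cis_distance_pos[OF x \<delta>(1)] by blast
    \<comment> \<open>The first bound keeps \<open>z\<close> away from the far part of the circle,
      the second makes the Poisson kernel at most \<open>e\<close> there.\<close>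
    define \<rho> where "\<rho> = min (\<eta> / 2) (e * \<eta>\<^sup>2 / 8)"
    have \<rho>: "0 < \<rho>" "\<rho> \<le> \<eta> / 2" "\<rho> \<le> e * \<eta>\<^sup>2 / 8" using \<eta>(1) e by (auto simp: \<rho>_def)
    have "dist (f z) (g x) < e0" if z: "z \<in> stolz_region (cis x) \<alpha>" "dist z (cis x) < \<rho>" for z
    proof -
      define d where "d = 1 - norm z"
      have z1: "norm z < 1" "norm (z - cis x) < \<alpha> * d" using stolz_regionD[OF z(1)] by (auto simp: d_def)
      have d: "0 < d" "d < \<rho>"
        using z1 z(2) norm_triangle_ineq2[of "cis x" z] by (auto simp: d_def dist_norm norm_minus_commute)
      have zle: "1 - (norm z)\<^sup>2 \<le> 2 * d" "0 \<le> 1 - (norm z)\<^sup>2"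
        using zero_le_power2[of "1 - norm z"] z1 by (simp_all add: d_def power2_diff power_le_one)
      define k where "k t = poisson z t / A" for t
      have k1: "k t \<le> 1 / d" for t
      proof -
        have "poisson z t \<le> 2 / d" using poisson_le[OF z1(1)] by (simp add: d_def)
        also have "\<dots> \<le> A / d" using A d by (intro divide_right_mono) auto
        finally show ?thesis using A by (simp add: k_def field_simps)
      qed
      have k2: "k t \<le> d / (t - x)\<^sup>2" if t: "t \<noteq> x" "\<bar>t - x\<bar> \<le> \<delta>" for t
      proof -
        have dz: "d \<le> norm (cis t - z)" using norm_triangle_ineq2[of "cis t" z] by (simp add: d_def)
        have "\<bar>t - x\<bar> \<le> 2 * norm (cis t - cis x)" using d1(2)[of t] t \<delta> by simp
        also have "norm (cis t - cis x) \<le> norm (cis t - z) + norm (z - cis x)"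
          using norm_triangle_ineq[of "cis t - z" "z - cis x"] by simp
        also have "\<dots> \<le> norm (cis t - z) + \<alpha> * norm (cis t - z)"
          using z1 dz \<alpha> mult_left_mono[OF dz, of \<alpha>] by linarith
        finally have "\<bar>t - x\<bar> \<le> 2 * (1 + \<alpha>) * norm (cis t - z)" by (simp add: algebra_simps)
        then have "\<bar>t - x\<bar>\<^sup>2 \<le> (2 * (1 + \<alpha>) * norm (cis t - z))\<^sup>2" by (intro power_mono) auto
        then have sq: "(t - x)\<^sup>2 \<le> A / 2 * (norm (cis t - z))\<^sup>2"
          by (simp only: power2_abs power_mult_distrib A_def) (simp add: field_simps)
        have pos: "0 < (norm (cis t - z))\<^sup>2" "0 < (t - x)\<^sup>2" using dz d t by auto
        have "poisson z t \<le> 2 * d / (norm (cis t - z))\<^sup>2"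
          unfolding poisson_def using zle pos by (intro divide_right_mono) auto
        then have "k t \<le> (2 * d / (norm (cis t - z))\<^sup>2) / A"
          unfolding k_def using A by (intro divide_right_mono) auto
        also have "\<dots> = d / (A / 2 * (norm (cis t - z))\<^sup>2)" using A by (simp add: mult_ac)
        also have "\<dots> \<le> d / (t - x)\<^sup>2" using sq pos d A by (intro divide_left_mono) auto
        finally show ?thesis .
      qed
      have near: "(LINT t|circ. indicator {x - \<delta>..x + \<delta>} t * (k t * \<phi> t)) \<le> 5 * e"
      proof (rule poisson_type_bound[where \<delta>=\<delta> and d=d])
        show "integrable circ (\<lambda>t. k t * \<phi> t)" using pint[OF z1(1)] by (simp add: k_def)
        show "0 \<le> k t" for t using poisson_nonneg[OF z1(1)] A by (simp add: k_def)
        show "(LINT t|circ. indicator {x - h..x + h} t * \<phi> t) \<le> e * h" if "0 < h" "h \<le> \<delta>" for h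
          using integral_circ_indicator_le[of \<phi> "x - h" "x + h"] d0(2)[of h] that \<delta> \<phi>int \<phi>0 \<phi>circ
          by fastforce
      qed (use k1 k2 \<phi>circ \<phi>0 d \<delta> in auto)
      have far: "poisson z t * \<phi> t \<le> 2 * B * e" if t: "t \<in> {0..2*pi}" "t \<notin> {x - \<delta>..x + \<delta>}" for t
      proof -
        have "\<delta> \<le> \<bar>t - x\<bar>" using t by auto
        then have "\<eta> \<le> norm (cis t - cis x)" using \<eta>(2) t by blast
        also have "\<dots> \<le> norm (cis t - z) + norm (z - cis x)"
          using norm_triangle_ineq[of "cis t - z" "z - cis x"] by simp
        finally have "\<eta> / 2 \<le> norm (cis t - z)" using z(2) \<rho>(2) by (simp add: dist_norm)
        then have "(\<eta> / 2)\<^sup>2 \<le> (norm (cis t - z))\<^sup>2" using \<eta> by (intro power_mono) auto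
        then have "poisson z t \<le> 2 * d / (\<eta> / 2)\<^sup>2"
          unfolding poisson_def using zle \<eta>(1) d by (intro frac_le) auto
        also have "\<dots> = 8 * d / \<eta>\<^sup>2" by (simp add: power_divide)
        also have "\<dots> \<le> e" using d \<rho>(3) \<eta>(1) by (simp add: field_simps)
        finally have "poisson z t * \<phi> t \<le> e * (2 * B)"
          using \<phi>B \<phi>0 e by (intro mult_mono) auto
        then show ?thesis by (simp add: mult_ac)
      qed
      have rep_diff: "of_real (2 * pi) * (f z - g x) = (LINT t|circ. of_real (poisson z t) * (g t - g x))"
      proof -
        have i1: "integrable circ (\<lambda>t. of_real (poisson z t) * g t)"
        proof (rule finite_measure.integrable_const_bound[OF finite_measure_circ, of _ "2 / (1 - norm z) * B"])
          show "AE t in circ. norm (of_real (poisson z t) * g t) \<le> 2 / (1 - norm z) * B"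
            using poisson_le[OF z1(1)] poisson_nonneg[OF z1(1)] g(2) z1
            by (intro AE_I2) (auto simp: norm_mult simp del: times_divide_eq_left intro!: mult_mono)
        qed (use pm[OF z1(1)] circm[OF g(1)] in measurable)
        have i2: "integrable circ (\<lambda>t. of_real (poisson z t) * g x)"
          by (intro integrable_circ_continuous continuous_intros continuous_on_poisson z1)
        have "(LINT t|circ. complex_of_real (poisson z t)) = of_real (2 * pi)"
          using poisson_integral_1[OF z1(1)] by simp
        then have "(LINT t|circ. of_real (poisson z t) * g x) = of_real (2 * pi) * g x" by simp
        then show ?thesis
          using Bochner_Integration.integral_diff[OF i1 i2] rep[OF z1(1)]
          by (simp add: right_diff_distrib poisson_integral_1[OF z1(1)])
      qed
      have indm: "(\<lambda>t. indicator {x - \<delta>..x + \<delta>} t :: real) \<in> borel_measurable circ"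
        by (intro circm) simp
      have kint: "integrable circ (\<lambda>t. indicator {x - \<delta>..x + \<delta>} t * (k t * \<phi> t))"
        using indm pint[OF z1(1)] unfolding k_def
        by (intro Bochner_Integration.integrable_bound[OF pint[OF z1(1), THEN integrable_divide, of A]])
           (auto simp: indicator_def)
      from rep_diff have "2 * pi * norm (f z - g x) = norm (LINT t|circ. of_real (poisson z t) * (g t - g x))"
        by (metis abs_of_nonneg norm_mult norm_of_real pi_ge_zero mult_nonneg_nonneg zero_le_numeral)
      also have "\<dots> \<le> (LINT t|circ. norm (of_real (poisson z t) * (g t - g x)))"
        by (rule integral_norm_bound)
      also have "\<dots> = (LINT t|circ. poisson z t * \<phi> t)"
        using poisson_nonneg[OF z1(1)] by (simp add: norm_mult \<phi>_def)
      also have "\<dots> \<le> (LINT t|circ. A * (indicator {x - \<delta>..x + \<delta>} t * (k t * \<phi> t)) + 2 * B * e)"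
      proof (rule integral_mono)
        show "integrable circ (\<lambda>t. A * (indicator {x - \<delta>..x + \<delta>} t * (k t * \<phi> t)) + 2 * B * e)"
          by (intro Bochner_Integration.integrable_add integrable_mult_right kint finite_measure.integrable_const finite_measure_circ)
        fix t assume "t \<in> space circ"
        then show "poisson z t * \<phi> t \<le> A * (indicator {x - \<delta>..x + \<delta>} t * (k t * \<phi> t)) + 2 * B * e"
          using far[of t] A B0 e by (cases "t \<in> {x - \<delta>..x + \<delta>}") (auto simp: k_def)
      qed (use pint[OF z1(1)] in auto)
      also have "\<dots> = A * (LINT t|circ. indicator {x - \<delta>..x + \<delta>} t * (k t * \<phi> t)) + 2 * pi * (2 * B * e)"
        using kint by (subst Bochner_Integration.integral_add)
          (auto intro!: finite_measure.integrable_const finite_measure_circ)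
      also have "\<dots> \<le> A * (5 * e) + 2 * pi * (2 * B * e)"
        using near A by (intro add_right_mono mult_left_mono) auto
      also have "\<dots> = (5 * A + 4 * pi * B) * e" by (simp add: algebra_simps)
      also have "\<dots> < (5 * A + 4 * pi * B + 1) * e" using e by simp
      also have "\<dots> = e0" using den by (simp add: e_def)
      finally have "2 * pi * norm (f z - g x) < e0" .
      moreover have "norm (f z - g x) \<le> 2 * pi * norm (f z - g x)"
        using pi_gt3 by (simp add: mult_le_cancel_right1)
      ultimately show ?thesis by (simp add: dist_norm)
    qed
    then show "\<forall>\<^sub>F z in at (cis x) within stolz_region (cis x) \<alpha>. dist (f z) (g x) < e0"
      using \<rho>(1) by (auto simp: eventually_at)
  qed
qed

theorem fatou_bounded:
  assumes f: "f holomorphic_on ball 0 1" and B: "\<And>z. norm z < 1 \<Longrightarrow> norm (f z) \<le> B"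
  shows "AE t in circ. \<exists>l. has_nontangential_limit f (cis t) l"
proof -
  obtain g where g: "g \<in> borel_measurable borel" "\<And>t::real. norm (g t) \<le> B"
    and rep: "\<And>z. norm z < 1 \<Longrightarrow> (LINT t|circ. of_real (poisson z t) * g t) = of_real (2 * pi) * f z"
    by (rule bounded_holomorphic_poisson_rep[OF f B], assumption) (rule that; assumption)
  obtain N where N: "negligible N" "\<And>x e. x \<notin> N \<Longrightarrow> 0 < e \<Longrightarrow>
       \<exists>d>0. \<forall>h. 0 < h \<and> h < d \<longrightarrow> integral {x - h..x + h} (\<lambda>s. norm (g s - g x)) \<le> e * h"
    by (rule lebesgue_points[OF g]) (rule that; assumption)
  \<comment> \<open>One period contains no two-sided neighbourhood of its endpoints, so these are
    discarded too.\<close>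
  have "negligible (N \<union> {0, 2 * pi})" using N(1) by (intro negligible_Un) auto
  then have "AE t in lebesgue. t \<notin> N \<union> {0, 2 * pi}"
    using AE_not_in negligible_iff_null_sets by blast
  then have "AE t in lebesgue. t \<in> {0..2*pi} \<longrightarrow> (\<exists>l. has_nontangential_limit f (cis t) l)"
  proof eventually_elim
    case (elim t)
    then show ?case
      using poisson_integral_nontangential_limit[OF g rep, of t] N(2)[of t] by auto
  qed
  then show ?thesis by (subst AE_restrict_space_iff) auto
qed

section \<open>The Nevanlinna and Smirnov classes\<close>

text \<open>Completeness of Lebesgue measure; it is needed because
  \<open>nontangential_value\<close> is arbitrary on a null set.\<close>

lemma circ_measurable_AE:
  fixes f g :: "real \<Rightarrow> 'a::euclidean_space"
  assumes f: "f \<in> borel_measurable circ" and ae: "AE t in circ. f t = g t"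
  shows "g \<in> borel_measurable circ"
proof -
  have *: "u \<in> borel_measurable circ \<longleftrightarrow> (\<lambda>t. indicator {0..2*pi} t *\<^sub>R u t) \<in> borel_measurable lebesgue"
    for u :: "real \<Rightarrow> 'a" by (intro borel_measurable_restrict_space_iff) auto
  have "AE t in lebesgue. t \<in> {0..2*pi} \<longrightarrow> f t = g t"
    using ae by (subst (asm) AE_restrict_space_iff) auto
  then have ae': "AE t in lebesgue. indicator {0..2*pi} t *\<^sub>R f t = indicator {0..2*pi} t *\<^sub>R g t"
    by eventually_elim (auto simp: indicator_def)
  show ?thesis unfolding * by (rule borel_measurable_AE[OF f[unfolded *] ae'])
qed

lemma filterlim_radial_stolz:
  assumes \<zeta>: "norm \<zeta> = 1" and \<alpha>: "1 < \<alpha>"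
  shows "filterlim (\<lambda>r. of_real r * \<zeta>) (at \<zeta> within stolz_region \<zeta> \<alpha>) (at_left 1)"
  unfolding filterlim_at
proof
  have "((\<lambda>r. of_real r * \<zeta>) \<longlongrightarrow> of_real 1 * \<zeta>) (at_left 1)" by (intro tendsto_intros)
  then show "((\<lambda>r. of_real r * \<zeta>) \<longlongrightarrow> \<zeta>) (at_left 1)" by simp
  have "\<forall>\<^sub>F r in at_left 1. 0 < r \<and> r < (1::real)" by (auto simp: eventually_at_left_field intro: exI[of _ 0])
  then show "\<forall>\<^sub>F r in at_left 1. of_real r * \<zeta> \<in> stolz_region \<zeta> \<alpha> \<and> of_real r * \<zeta> \<noteq> \<zeta>"
  proof eventually_elim
    case (elim r)
    have "of_real r * \<zeta> - \<zeta> = of_real (r - 1) * \<zeta>" by (simp add: algebra_simps)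
    then have "norm (of_real r * \<zeta> - \<zeta>) = 1 - r" using elim \<zeta> by (simp add: norm_mult del: of_real_diff)
    moreover have "1 - r < \<alpha> * (1 - r)" using elim \<alpha> by simp
    ultimately show ?case using elim \<zeta> by (auto simp: stolz_region_def norm_mult)
  qed
qed

lemma nontangential_imp_radial:
  assumes "has_nontangential_limit f \<zeta> l" "norm \<zeta> = 1"
  shows "((\<lambda>r. f (of_real r * \<zeta>)) \<longlongrightarrow> l) (at_left 1)"
  using assms filterlim_radial_stolz[of \<zeta> 2] filterlim_compose
  unfolding has_nontangential_limit_def by (metis one_less_numeral_iff semiring_norm(76))

lemma nontangential_value_eq:
  assumes "has_nontangential_limit f \<zeta> l" "norm \<zeta> = 1"
  shows "nontangential_value f \<zeta> = l"
  unfolding nontangential_value_def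
proof (rule the_equality)
  fix l' assume "has_nontangential_limit f \<zeta> l'"
  then show "l' = l"
    using tendsto_unique[OF trivial_limit_at_left_real] nontangential_imp_radial assms by blast
qed fact

text \<open>A fixed sequence of radii, so that convergence theorems for sequences apply to limits
  along \<open>at_left 1\<close>.\<close>

definition radial :: "nat \<Rightarrow> real" where
  "radial k = 1 - 1 / (real k + 2)"

lemma radial_bounds: "0 < radial k" "0 \<le> radial k" "radial k < 1"
  by (auto simp: radial_def)

lemma filterlim_radial: "filterlim radial (at_left 1) sequentially"
  unfolding filterlim_at
proof
  show "radial \<longlonglongrightarrow> 1" unfolding radial_def by real_asymp
  show "\<forall>\<^sub>F k in sequentially. radial k \<in> {..<1} \<and> radial k \<noteq> 1"
    using radial_bounds by (auto intro!: always_eventually simp: less_le)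
qed

lemma measurable_nontangential_value:
  assumes f: "f holomorphic_on ball 0 1"
    and lim: "AE t in circ. \<exists>l. has_nontangential_limit f (cis t) l"
  shows "(\<lambda>t. nontangential_value f (cis t)) \<in> borel_measurable circ"
proof (rule circ_measurable_AE)
  show "(\<lambda>t. lim (\<lambda>k. f (of_real (radial k) * cis t))) \<in> borel_measurable circ"
    by (intro borel_measurable_lim_metric measurable_circ_continuous continuous_on_circle_comp
      holomorphic_on_imp_continuous_on f radial_bounds)
  show "AE t in circ. lim (\<lambda>k. f (of_real (radial k) * cis t)) = nontangential_value f (cis t)"
    using lim
  proof eventually_elim
    case (elim t)
    then obtain l where l: "has_nontangential_limit f (cis t) l" by blast
    have "(\<lambda>k. f (of_real (radial k) * cis t)) \<longlonglongrightarrow> l"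
      using filterlim_compose[OF nontangential_imp_radial[OF l] filterlim_radial] by simp
    then show ?case using nontangential_value_eq[OF l] by (simp add: limI)
  qed
qed

section \<open>Normal families and quotients of bounded functions\<close>

lemma montel_unit_ball:
  fixes F :: "nat \<Rightarrow> complex \<Rightarrow> complex"
  assumes F: "\<And>k. F k holomorphic_on ball 0 1" "\<And>k z. norm z < 1 \<Longrightarrow> norm (F k z) \<le> 1"
  obtains G r where "G holomorphic_on ball 0 1" "strict_mono (r :: nat \<Rightarrow> nat)"
    "\<And>z. norm z < 1 \<Longrightarrow> (\<lambda>n. F (r n) z) \<longlonglongrightarrow> G z" "\<And>z. norm z < 1 \<Longrightarrow> norm (G z) \<le> 1"
    "\<And>K. compact K \<Longrightarrow> K \<subseteq> ball 0 1 \<Longrightarrow> uniform_limit K (F \<circ> r) G sequentially"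
proof -
  define HH where "HH = {h. h holomorphic_on ball 0 1 \<and> (\<forall>z\<in>ball 0 1. norm (h z :: complex) \<le> 1)}"
  have rng: "range F \<subseteq> HH" using F by (auto simp: HH_def)
  obtain G r where G: "G holomorphic_on ball 0 1" "strict_mono (r :: nat \<Rightarrow> nat)"
    "\<And>z. z \<in> ball 0 1 \<Longrightarrow> (\<lambda>n. F (r n) z) \<longlonglongrightarrow> G z"
    "\<And>K. compact K \<Longrightarrow> K \<subseteq> ball 0 1 \<Longrightarrow> uniform_limit K (F \<circ> r) G sequentially"
  proof (rule Montel[of "ball 0 1" HH F])
    show "h holomorphic_on ball 0 1" if "h \<in> HH" for h using that by (simp add: HH_def)
    show "\<exists>B. \<forall>h\<in>HH. \<forall>z\<in>K. norm (h z) \<le> B" if "K \<subseteq> ball 0 1" for K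
      using that by (intro exI[of _ 1]) (auto simp: HH_def)
  qed (rule open_ball rng that; assumption)+
  show ?thesis
  proof (rule that[OF G(1,2)])
    show "norm (G z) \<le> 1" if "norm z < 1" for z
      using that F(2) by (intro Lim_bounded[OF tendsto_norm[OF G(3)]]) auto
  qed (use G in auto)
qed

text \<open>With the polynomial majorants \<open>p k\<close> at the radii \<open>radial k\<close>,
  both \<open>exp (- p k)\<close> and its product with the dilated \<open>f\<close> are bounded by
  1. A locally uniform limit of the former is \<open>G\<close>; the products then tend to
  \<open>f * G\<close>.\<close>

lemma nevanlinna_imp_quotient:
  assumes "f \<in> nevanlinna_class"
  obtains \<Psi> G where "\<Psi> holomorphic_on ball 0 1" "G holomorphic_on ball 0 1"
    "\<And>z. norm z < 1 \<Longrightarrow> norm (\<Psi> z) \<le> 1" "\<And>z. norm z < 1 \<Longrightarrow> norm (G z) \<le> 1"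
    "\<And>z. norm z < 1 \<Longrightarrow> G z \<noteq> 0" "\<And>z. norm z < 1 \<Longrightarrow> \<Psi> z = f z * G z"
proof -
  obtain L where f: "f holomorphic_on ball 0 1"
    and L: "\<And>r. 0 \<le> r \<Longrightarrow> r < 1 \<Longrightarrow> circle_log_mean f r \<le> L"
    using assms nevanlinna_class_iff by blast
  have "\<exists>p. (\<forall>z. norm z \<le> 1 \<longrightarrow> 0 \<le> Re (poly p z)) \<and>
    (\<forall>z. norm z \<le> 1 \<longrightarrow> norm (f (of_real (radial k) * z)) \<le> exp (Re (poly p z))) \<and>
    Re (poly p 0) \<le> circle_log_mean f (radial k) + 1" for k
    by (rule log_plus_majorant[OF f radial_bounds(2,3) zero_less_one, of k]) (intro exI conjI allI impI; blast)
  then obtain p where p: "\<And>k z. norm z \<le> 1 \<Longrightarrow> 0 \<le> Re (poly (p k) z)"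
    "\<And>k z. norm z \<le> 1 \<Longrightarrow> norm (f (of_real (radial k) * z)) \<le> exp (Re (poly (p k) z))"
    "\<And>k. Re (poly (p k) 0) \<le> circle_log_mean f (radial k) + 1" by metis
  define F where "F k z = exp (- poly (p k) z)" for k z
  have Fle: "norm (F k z) \<le> 1" if "norm z < 1" for k z
    using p(1)[of z k] that by (simp add: F_def norm_exp_eq_Re)
  have Fhol: "F k holomorphic_on ball 0 1" for k
    unfolding F_def by (intro holomorphic_intros)
  obtain G r where G: "G holomorphic_on ball 0 1" "strict_mono (r :: nat \<Rightarrow> nat)"
    "\<And>z. norm z < 1 \<Longrightarrow> (\<lambda>n. F (r n) z) \<longlonglongrightarrow> G z" "\<And>z. norm z < 1 \<Longrightarrow> norm (G z) \<le> 1"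
    "\<And>K. compact K \<Longrightarrow> K \<subseteq> ball 0 1 \<Longrightarrow> uniform_limit K (F \<circ> r) G sequentially"
    by (rule montel_unit_ball[OF Fhol Fle], assumption) (rule that; assumption)
  \<comment> \<open>The bounded circle means keep the majorants bounded at 0, so \<open>G\<close>
    does not vanish there; Hurwitz's theorem extends this to the whole disc.\<close>
  have "exp (- (L + 1)) \<le> norm (F k 0)" for k
  proof -
    have "Re (poly (p k) 0) \<le> L + 1" using p(3)[of k] L[of "radial k"] radial_bounds[of k] by simp
    then show ?thesis by (simp add: F_def norm_exp_eq_Re)
  qed
  then have "exp (- (L + 1)) \<le> norm (G 0)"
    by (intro Lim_bounded2[OF tendsto_norm[OF G(3)]]) auto
  then have G0: "G 0 \<noteq> 0" by (metis exp_gt_zero norm_zero not_le)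
  have Gnz: "G z \<noteq> 0" if z: "norm z < 1" for z
  proof (cases "G constant_on ball 0 1")
    case True
    then have "G z = G 0" using z by (auto simp: constant_on_def)
    then show ?thesis using G0 by simp
  next
    case False
    show ?thesis
      by (rule Hurwitz_no_zeros[of "ball 0 1" "F \<circ> r" G])
         (use G False z Fhol in \<open>auto simp: F_def o_def\<close>)
  qed
  have \<Psi>le: "norm (f z * G z) \<le> 1" if z: "norm z < 1" for z
  proof (rule Lim_bounded[OF tendsto_norm])
    have "isCont f z" using z f
      by (intro continuous_on_interior[OF holomorphic_on_imp_continuous_on[OF f]]) auto
    moreover have "(\<lambda>k. of_real (radial k) * z) \<longlonglongrightarrow> of_real 1 * z"
      using filterlim_radial by (intro tendsto_intros) (auto simp: filterlim_at)
    ultimately have "(\<lambda>k. f (of_real (radial k) * z)) \<longlonglongrightarrow> f z"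
      using isCont_tendsto_compose by fastforce
    then have "(\<lambda>n. f (of_real (radial (r n)) * z)) \<longlonglongrightarrow> f z"
      using LIMSEQ_subseq_LIMSEQ[OF _ G(2)] by (auto simp: o_def)
    then show "(\<lambda>n. f (of_real (radial (r n)) * z) * F (r n) z) \<longlonglongrightarrow> f z * G z"
      using G(3)[of z] z by (intro tendsto_mult) auto
    show "\<forall>n\<ge>0. norm (f (of_real (radial (r n)) * z) * F (r n) z) \<le> 1"
      using p(2)[of z] z by (auto simp: norm_mult F_def norm_exp_eq_Re exp_minus divide_simps norm_divide)
  qed
  show ?thesis
    by (rule that[of "\<lambda>z. f z * G z" G]) (use G f Gnz \<Psi>le in \<open>auto intro!: holomorphic_intros\<close>)
qed

lemma Re_circle_mean_radial:
  assumes E: "E holomorphic_on ball 0 1" and r: "0 \<le> r" "r < 1"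
  shows "(LINT t|circ. Re (E (of_real r * cis t))) = 2 * pi * Re (E 0)"
    "integrable circ (\<lambda>t. Re (E (of_real r * cis t)))"
proof -
  have "E holomorphic_on cball 0 r" using r by (intro holomorphic_on_subset[OF E]) auto
  then show "(LINT t|circ. Re (E (of_real r * cis t))) = 2 * pi * Re (E 0)"
    "integrable circ (\<lambda>t. Re (E (of_real r * cis t)))"
    using r by (auto intro!: Re_holomorphic_circle_mean integrable_Re integrable_circ_holomorphic)
qed

text \<open>Fatou's lemma; the circle means of \<open>Re E\<close> are all equal to
  \<open>Re (E 0)\<close>.\<close>

lemma nn_integral_liminf_Re_le:
  assumes E: "E holomorphic_on ball 0 1" and E0: "\<And>z. norm z < 1 \<Longrightarrow> 0 \<le> Re (E z)"
  shows "(\<integral>\<^sup>+t. liminf (\<lambda>k. ennreal (Re (E (of_real (radial k) * cis t)))) \<partial>circ)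
     \<le> ennreal (2 * pi * Re (E 0))"
proof -
  have "(\<integral>\<^sup>+t. liminf (\<lambda>k. ennreal (Re (E (of_real (radial k) * cis t)))) \<partial>circ)
      \<le> liminf (\<lambda>k. \<integral>\<^sup>+t. ennreal (Re (E (of_real (radial k) * cis t))) \<partial>circ)"
    by (intro nn_integral_liminf measurable_compose[OF
      borel_measurable_integrable[OF Re_circle_mean_radial(2)[OF E radial_bounds(2,3)]]]) simp
  also have "(\<lambda>k. \<integral>\<^sup>+t. ennreal (Re (E (of_real (radial k) * cis t))) \<partial>circ)
      = (\<lambda>k. ennreal (2 * pi * Re (E 0)))"
  proof
    fix k
    have "AE t in circ. 0 \<le> Re (E (of_real (radial k) * cis t))"
      using radial_bounds[of k] by (intro AE_I2 E0) (simp add: norm_mult)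
    then show "(\<integral>\<^sup>+t. ennreal (Re (E (of_real (radial k) * cis t))) \<partial>circ) = ennreal (2 * pi * Re (E 0))"
      using nn_integral_eq_integral[OF Re_circle_mean_radial(2)[OF E radial_bounds(2,3)]]
        Re_circle_mean_radial(1)[OF E radial_bounds(2,3)] by simp
  qed
  finally show ?thesis by (simp add: Liminf_const)
qed

text \<open>If \<open>exp (- E)\<close> tended to \<open>0\<close> then \<open>Re E\<close> would tend to infinity, which by Fatou's lemma
  happens only on a null set.\<close>

lemma exp_minus_nonzero_boundary_limit:
  assumes E: "E holomorphic_on ball 0 1" and E0: "\<And>z. norm z < 1 \<Longrightarrow> 0 \<le> Re (E z)"
  shows "AE t in circ. \<exists>l. l \<noteq> 0 \<and> has_nontangential_limit (\<lambda>z. exp (- E z)) (cis t) l"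
proof -
  have "AE t in circ. \<exists>l. has_nontangential_limit (\<lambda>z. exp (- E z)) (cis t) l"
    by (rule fatou_bounded[where B=1])
       (use E0 in \<open>auto intro!: holomorphic_intros E simp: norm_exp_eq_Re\<close>)
  moreover have "AE t in circ. liminf (\<lambda>k. ennreal (Re (E (of_real (radial k) * cis t)))) \<noteq> \<infinity>"
  proof (rule nn_integral_PInf_AE)
    show "(\<lambda>t. liminf (\<lambda>k. ennreal (Re (E (of_real (radial k) * cis t))))) \<in> borel_measurable circ"
      by (intro borel_measurable_liminf measurable_compose[OF
        borel_measurable_integrable[OF Re_circle_mean_radial(2)[OF E radial_bounds(2,3)]]]) simp
    show "(\<integral>\<^sup>+t. liminf (\<lambda>k. ennreal (Re (E (of_real (radial k) * cis t)))) \<partial>circ) \<noteq> \<infinity>"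
      using nn_integral_liminf_Re_le[OF E E0] by (metis ennreal_less_top infinity_ennreal_def leD)
  qed
  ultimately show ?thesis
  proof eventually_elim
    case (elim t)
    then obtain l where l: "has_nontangential_limit (\<lambda>z. exp (- E z)) (cis t) l" by blast
    have lim: "(\<lambda>k. exp (- E (of_real (radial k) * cis t))) \<longlonglongrightarrow> l"
      using filterlim_compose[OF nontangential_imp_radial[OF l] filterlim_radial] by simp
    have "l \<noteq> 0"
    proof
      assume "l = 0"
      then have "(\<lambda>k. exp (- Re (E (of_real (radial k) * cis t)))) \<longlonglongrightarrow> 0"
        using tendsto_norm[OF lim] by (simp add: norm_exp_eq_Re)
      then have top: "filterlim (\<lambda>k. exp (Re (E (of_real (radial k) * cis t)))) at_top sequentially"
        by (subst (asm) filterlim_inverse_at_top_iff[symmetric])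
           (auto simp: exp_minus intro!: filterlim_inverse_at_top)
      have "liminf (\<lambda>k. ennreal (Re (E (of_real (radial k) * cis t)))) = \<infinity>"
      proof -
        have "filterlim (\<lambda>k. Re (E (of_real (radial k) * cis t))) at_top sequentially"
          using filterlim_compose[OF ln_at_top top] by simp
        then have "(\<lambda>k. ennreal (Re (E (of_real (radial k) * cis t)))) \<longlonglongrightarrow> \<infinity>"
          by (simp add: ennreal_tendsto_top_eq_at_top)
        then show ?thesis by (intro lim_imp_Liminf) auto
      qed
      then show False using elim by simp
    qed
    then show ?case using l by blast
  qed
qed

lemma nontangential_limit_cong:
  assumes "\<And>z. norm z < 1 \<Longrightarrow> f z = g z"
  shows "has_nontangential_limit f \<zeta> l \<longleftrightarrow> has_nontangential_limit g \<zeta> l"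
proof -
  have "\<forall>\<^sub>F z in at \<zeta> within stolz_region \<zeta> \<alpha>. f z = g z" for \<alpha>
    using assms by (auto simp: eventually_at_filter stolz_region_def)
  then have "(f \<longlongrightarrow> l) (at \<zeta> within stolz_region \<zeta> \<alpha>) \<longleftrightarrow> (g \<longlongrightarrow> l) (at \<zeta> within stolz_region \<zeta> \<alpha>)" for \<alpha>
    by (rule tendsto_cong)
  then show ?thesis by (simp add: has_nontangential_limit_def)
qed

text \<open>The denominator \<open>G\<close> is zero-free and bounded by 1, hence
  \<open>exp g\<close> with \<open>Re g \<le> 0\<close>. Its boundary limits are nonzero almost
  everywhere, so those of the quotient exist.\<close>

theorem fatou_nevanlinna:
  assumes "f \<in> nevanlinna_class"
  shows "AE t in circ. \<exists>l. has_nontangential_limit f (cis t) l"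
proof -
  obtain \<Psi> G where \<Psi>: "\<Psi> holomorphic_on ball 0 1" "\<And>z. norm z < 1 \<Longrightarrow> norm (\<Psi> z) \<le> 1"
    and G: "G holomorphic_on ball 0 1" "\<And>z. norm z < 1 \<Longrightarrow> norm (G z) \<le> 1" "\<And>z. norm z < 1 \<Longrightarrow> G z \<noteq> 0"
    and f: "\<And>z. norm z < 1 \<Longrightarrow> \<Psi> z = f z * G z"
    using nevanlinna_imp_quotient[OF assms] by metis
  obtain g where g: "g holomorphic_on ball 0 1" "\<And>z. z \<in> ball 0 1 \<Longrightarrow> G z = exp (g z)"
    by (rule contractible_imp_holomorphic_log[OF G(1)])
       (use G(3) in \<open>auto intro: convex_imp_contractible\<close>)
  have "AE t in circ. \<exists>l. l \<noteq> 0 \<and> has_nontangential_limit (\<lambda>z. exp (- (- g z))) (cis t) l"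
  proof (rule exp_minus_nonzero_boundary_limit)
    show "(\<lambda>z. - g z) holomorphic_on ball 0 1" by (intro holomorphic_intros g)
    show "0 \<le> Re (- g z)" if "norm z < 1" for z
      using G(2)[OF that] g(2)[of z] that by (simp add: norm_exp_eq_Re)
  qed
  moreover have "AE t in circ. \<exists>l. has_nontangential_limit \<Psi> (cis t) l"
    by (rule fatou_bounded[OF \<Psi>])
  ultimately show ?thesis
  proof eventually_elim
    case (elim t)
    then obtain l m where l: "l \<noteq> 0" "has_nontangential_limit (\<lambda>z. exp (- (- g z))) (cis t) l"
      and m: "has_nontangential_limit \<Psi> (cis t) m" by blast
    have "has_nontangential_limit (\<lambda>z. \<Psi> z / exp (- (- g z))) (cis t) (m / l)"
      using l m unfolding has_nontangential_limit_def by (auto intro!: tendsto_divide)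
    then have "has_nontangential_limit f (cis t) (m / l)"
      by (subst (asm) nontangential_limit_cong[of _ f]) (use f g(2) G(3) in auto)
    then show ?case by blast
  qed
qed

text \<open>Dominated convergence with majorants \<open>b n\<close> whose integrals converge. By
  Scheffe's lemma \<open>b n\<close> tends to \<open>b'\<close> in the mean; the minimum of
  \<open>a n\<close> and \<open>b'\<close> is dominated by \<open>b'\<close>, and the excess of
  \<open>a n\<close> over it is at most \<open>\<bar>b n - b'\<bar>\<close>.\<close>

lemma pratt_dominated_convergence:
  fixes a b :: "nat \<Rightarrow> 'a \<Rightarrow> real"
  assumes int: "\<And>n. integrable M (a n)" "\<And>n. integrable M (b n)" "integrable M b'"
    and a': "a' \<in> borel_measurable M"
    and le: "\<And>n x. x \<in> space M \<Longrightarrow> 0 \<le> a n x" "\<And>n x. x \<in> space M \<Longrightarrow> a n x \<le> b n x"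
    and lim: "AE x in M. (\<lambda>n. a n x) \<longlonglongrightarrow> a' x" "AE x in M. (\<lambda>n. b n x) \<longlonglongrightarrow> b' x"
    and conv: "(\<lambda>n. integral\<^sup>L M (b n)) \<longlonglongrightarrow> integral\<^sup>L M b'"
  shows "integrable M a'" "(\<lambda>n. integral\<^sup>L M (a n)) \<longlonglongrightarrow> integral\<^sup>L M a'"
proof -
  have b0: "0 \<le> b n x" if "x \<in> space M" for n x using le(1)[OF that, of n] le(2)[OF that, of n] by linarith
  have b'0: "AE x in M. 0 \<le> b' x"
    using lim(2) by (rule AE_mp) (auto intro!: AE_I2 LIMSEQ_le_const b0)
  have absint: "integral\<^sup>L M (\<lambda>x. \<bar>b' x\<bar>) = integral\<^sup>L M b'"
    using b'0 int(3) by (intro integral_cong_AE) auto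
  have nn: "(\<integral>\<^sup>+x. norm (b n x) \<partial>M) = ennreal (integral\<^sup>L M (b n))" for n
    using int(2)[of n] b0 by (subst nn_integral_eq_integral[symmetric])
      (auto intro!: nn_integral_cong)
  have nn': "(\<integral>\<^sup>+x. norm (b' x) \<partial>M) = ennreal (integral\<^sup>L M b')"
    using int(3) absint by (subst nn_integral_eq_integral) auto
  have S: "(\<lambda>n. \<integral>\<^sup>+x. norm (b n x - b' x) \<partial>M) \<longlonglongrightarrow> 0"
  proof (rule Scheffe_lemma1[OF int(2,3) lim(2)])
    have "(\<lambda>n. \<integral>\<^sup>+x. norm (b n x) \<partial>M) \<longlonglongrightarrow> (\<integral>\<^sup>+x. norm (b' x) \<partial>M)"
      unfolding nn nn' using conv by (rule tendsto_ennrealI)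
    then show "limsup (\<lambda>n. \<integral>\<^sup>+x. norm (b n x) \<partial>M) \<le> (\<integral>\<^sup>+x. norm (b' x) \<partial>M)"
      using lim_imp_Limsup by (metis order_refl trivial_limit_sequentially)
  qed
  have dint: "integrable M (\<lambda>x. \<bar>b n x - b' x\<bar>)" for n
    using int by auto
  have "(\<lambda>n. ennreal (integral\<^sup>L M (\<lambda>x. \<bar>b n x - b' x\<bar>))) \<longlonglongrightarrow> ennreal 0"
    using S dint by (subst (asm) nn_integral_eq_integral) auto
  then have D: "(\<lambda>n. integral\<^sup>L M (\<lambda>x. \<bar>b n x - b' x\<bar>)) \<longlonglongrightarrow> 0"
    by (subst (asm) tendsto_ennreal_iff) auto
  have lim_min: "AE x in M. (\<lambda>n. min (a n x) (b' x)) \<longlonglongrightarrow> a' x"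
    using lim AE_space
  proof eventually_elim
    case (elim x)
    then have "a' x \<le> b' x" using le(2) by (intro LIMSEQ_le[OF elim(1,2)]) auto
    moreover have "(\<lambda>n. min (a n x) (b' x)) \<longlonglongrightarrow> min (a' x) (b' x)"
      by (intro tendsto_intros elim)
    ultimately show ?case by (simp add: min_absorb1)
  qed
  have dom: "AE x in M. norm (min (a n x) (b' x)) \<le> b' x" for n
    using b'0 by (rule AE_mp) (auto intro!: AE_I2 simp: abs_le_iff min_def le)
  have minm: "(\<lambda>x. min (a n x) (b' x)) \<in> borel_measurable M" for n
    using int(1)[of n] int(3) by measurable
  show ia: "integrable M a'"
    by (rule integrable_dominated_convergence[OF a' minm int(3) lim_min dom])
  have I1: "(\<lambda>n. integral\<^sup>L M (\<lambda>x. min (a n x) (b' x))) \<longlonglongrightarrow> integral\<^sup>L M a'"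
    by (rule integral_dominated_convergence[OF a' minm int(3) lim_min dom])
  have minint: "integrable M (\<lambda>x. min (a n x) (b' x))" for n
    using int by (intro integrable_min) auto
  have I2: "(\<lambda>n. integral\<^sup>L M (a n) - integral\<^sup>L M (\<lambda>x. min (a n x) (b' x))) \<longlonglongrightarrow> 0"
  proof (rule Lim_null_comparison[OF _ D], rule always_eventually, rule allI)
    fix n
    have "integral\<^sup>L M (a n) - integral\<^sup>L M (\<lambda>x. min (a n x) (b' x)) =
      integral\<^sup>L M (\<lambda>x. a n x - min (a n x) (b' x))"
      using int minint by simp
    also have "norm \<dots> \<le> integral\<^sup>L M (\<lambda>x. \<bar>b n x - b' x\<bar>)"
      using le(2)[of _ n] int minint dint
      by (intro order_trans[OF integral_norm_bound] integral_mono) (auto simp: min_def split: if_splits intro: order_trans[OF _ abs_ge_self])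
    finally show "norm (integral\<^sup>L M (a n) - integral\<^sup>L M (\<lambda>x. min (a n x) (b' x)))
      \<le> integral\<^sup>L M (\<lambda>x. \<bar>b n x - b' x\<bar>)" .
  qed
  show "(\<lambda>n. integral\<^sup>L M (a n)) \<longlonglongrightarrow> integral\<^sup>L M a'"
    using tendsto_add[OF I1 I2] by simp
qed

text \<open>On the logarithmic scale the factor \<open>exp E\<close> costs \<open>Re E\<close>,
  whose circle means have the constant value \<open>Re (E 0)\<close>.\<close>

lemma nevanlinna_mult_exp:
  assumes g: "g \<in> nevanlinna_class" and F: "F holomorphic_on ball 0 1"
    and E: "E holomorphic_on ball 0 1" and E0: "\<And>z. norm z < 1 \<Longrightarrow> 0 \<le> Re (E z)"
    and le: "\<And>z. norm z < 1 \<Longrightarrow> norm (F z) \<le> exp (Re (E z)) * norm (g z)"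
  shows "F \<in> nevanlinna_class"
    "\<And>r t. 0 \<le> r \<Longrightarrow> r < 1 \<Longrightarrow> log_plus (norm (F (of_real r * cis t))) \<le>
        Re (E (of_real r * cis t)) + log_plus (norm (g (of_real r * cis t)))"
proof -
  obtain L where gh: "g holomorphic_on ball 0 1"
    and L: "\<And>r. 0 \<le> r \<Longrightarrow> r < 1 \<Longrightarrow> circle_log_mean g r \<le> L"
    using g nevanlinna_class_iff by blast
  show *: "log_plus (norm (F (of_real r * cis t))) \<le>
        Re (E (of_real r * cis t)) + log_plus (norm (g (of_real r * cis t)))"
    if r: "0 \<le> r" "r < 1" for r t
  proof -
    have n: "norm (of_real r * cis t) < 1" using r by (simp add: norm_mult)
    show ?thesis
      by (rule order_trans[OF log_plus_mono[OF _ le[OF n]] log_plus_mult_exp_le]) (use E0[OF n] in auto)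
  qed
  have "circle_log_mean F r \<le> Re (E 0) + L" if r: "0 \<le> r" "r < 1" for r
  proof -
    have "(LINT t|circ. log_plus (norm (F (of_real r * cis t)))) \<le>
      (LINT t|circ. Re (E (of_real r * cis t)) + log_plus (norm (g (of_real r * cis t))))"
      using * r by (intro integral_mono Bochner_Integration.integrable_add
         integrable_log_plus_circle Re_circle_mean_radial F E gh)
    also have "\<dots> = 2 * pi * Re (E 0) + 2 * pi * circle_log_mean g r"
      using r by (subst Bochner_Integration.integral_add)
        (auto intro!: integrable_log_plus_circle Re_circle_mean_radial E gh simp: circle_log_mean_eq)
    finally have "2 * pi * circle_log_mean F r \<le> 2 * pi * (Re (E 0) + circle_log_mean g r)"
      by (simp add: circle_log_mean_eq algebra_simps)
    then show ?thesis using L[OF r] by simp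
  qed
  then show "F \<in> nevanlinna_class" using F nevanlinna_class_iff by blast
qed

lemma smirnov_class_alt:
  "f \<in> smirnov_class \<longleftrightarrow> f \<in> nevanlinna_class \<and>
     integrable circ (\<lambda>t. log_plus (norm (nontangential_value f (cis t)))) \<and>
     (circle_log_mean f \<longlongrightarrow>
       (LINT t|circ. log_plus (norm (nontangential_value f (cis t)))) / (2 * pi)) (at_left 1)"
  by (simp add: smirnov_class_def set_integrable_def set_lebesgue_integral_def
      integral_restrict_space integrable_restrict_space)

text \<open>The hypotheses on \<open>H\<close> say that \<open>Re E\<close> loses no mass at the
  boundary, and membership of \<open>g\<close> says the same of \<open>log_plus (norm g)\<close>.
  Their sum is a majorant of \<open>log_plus (norm F)\<close> with converging integrals.\<close>

lemma smirnov_mult_exp: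
  assumes g: "g \<in> smirnov_class" and F: "F holomorphic_on ball 0 1"
    and E: "E holomorphic_on ball 0 1" and E0: "\<And>z. norm z < 1 \<Longrightarrow> 0 \<le> Re (E z)"
    and H: "integrable circ H" "(LINT t|circ. H t) = 2 * pi * Re (E 0)"
      "AE t in circ. (\<lambda>k. Re (E (of_real (radial k) * cis t))) \<longlonglongrightarrow> H t"
    and le: "\<And>z. norm z < 1 \<Longrightarrow> norm (F z) \<le> exp (Re (E z)) * norm (g z)"
  shows "F \<in> smirnov_class"
proof -
  have gN: "g \<in> nevanlinna_class" and gi: "integrable circ (\<lambda>t. log_plus (norm (nontangential_value g (cis t))))"
    and gl: "(circle_log_mean g \<longlongrightarrow>
       (LINT t|circ. log_plus (norm (nontangential_value g (cis t)))) / (2 * pi)) (at_left 1)"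
    using g by (auto simp: smirnov_class_alt)
  have gh: "g holomorphic_on ball 0 1" using gN nevanlinna_class_iff by blast
  have FN: "F \<in> nevanlinna_class"
    by (rule nevanlinna_mult_exp(1)[OF gN F E E0 le])
  have FN2: "log_plus (norm (F (of_real r * cis t))) \<le>
        Re (E (of_real r * cis t)) + log_plus (norm (g (of_real r * cis t)))"
    if "0 \<le> r" "r < 1" for r t
    by (rule nevanlinna_mult_exp(2)[OF gN F E E0 le that])
  have radlim: "AE t in circ. (\<lambda>k. log_plus (norm (f (of_real (radial k) * cis t))))
      \<longlonglongrightarrow> log_plus (norm (nontangential_value f (cis t)))" if "f \<in> nevanlinna_class" for f
    using fatou_nevanlinna[OF that]
  proof eventually_elim
    case (elim t)
    then obtain l where l: "has_nontangential_limit f (cis t) l" by blast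
    have "(\<lambda>k. f (of_real (radial k) * cis t)) \<longlonglongrightarrow> l"
      using filterlim_compose[OF nontangential_imp_radial[OF l] filterlim_radial] by simp
    then show ?case using nontangential_value_eq[OF l] by (simp add: tendsto_log_plus_norm)
  qed
  define a where "a k t = log_plus (norm (F (of_real (radial k) * cis t)))" for k t
  define b where "b k t = Re (E (of_real (radial k) * cis t)) + log_plus (norm (g (of_real (radial k) * cis t)))" for k t
  define a' where "a' t = log_plus (norm (nontangential_value F (cis t)))" for t
  define b' where "b' t = H t + log_plus (norm (nontangential_value g (cis t)))" for t
  have inta: "integrable circ (a k)" and intg: "integrable circ (\<lambda>t. log_plus (norm (g (of_real (radial k) * cis t))))" for k
    unfolding a_def by (intro integrable_log_plus_circle F gh radial_bounds)+
  have intE: "integrable circ (\<lambda>t. Re (E (of_real (radial k) * cis t)))" for k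
    by (intro Re_circle_mean_radial E radial_bounds)
  have intb: "integrable circ (b k)" for k
    unfolding b_def by (intro Bochner_Integration.integrable_add intE intg)
  have intb': "integrable circ b'" unfolding b'_def by (intro Bochner_Integration.integrable_add H gi)
  have lp: "log_plus \<in> borel_measurable borel" unfolding log_plus_def by measurable
  have a'm: "a' \<in> borel_measurable circ"
    unfolding a'_def
    by (rule measurable_compose[OF measurable_compose[OF
          measurable_nontangential_value[OF F fatou_nevanlinna[OF FN]] borel_measurable_norm] lp])
  have Ib: "(LINT t|circ. b k t) = 2 * pi * Re (E 0) + 2 * pi * circle_log_mean g (radial k)" for k
    unfolding b_def using Re_circle_mean_radial(1)[OF E radial_bounds(2,3)]
    by (subst Bochner_Integration.integral_add[OF intE intg]) (simp add: circle_log_mean_eq)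
  have Ib': "(LINT t|circ. b' t) = 2 * pi * Re (E 0) + 2 * pi *
      ((LINT t|circ. log_plus (norm (nontangential_value g (cis t)))) / (2 * pi))"
    unfolding b'_def by (subst Bochner_Integration.integral_add[OF H(1) gi]) (simp add: H(2))
  have conv: "(\<lambda>k. LINT t|circ. b k t) \<longlonglongrightarrow> (LINT t|circ. b' t)"
    unfolding Ib Ib' by (intro tendsto_intros filterlim_compose[OF gl filterlim_radial])
  have lima: "AE t in circ. (\<lambda>k. a k t) \<longlonglongrightarrow> a' t"
    unfolding a_def a'_def by (rule radlim[OF FN])
  have limb: "AE t in circ. (\<lambda>k. b k t) \<longlonglongrightarrow> b' t"
    using radlim[OF gN] H(3) unfolding b_def b'_def by eventually_elim (intro tendsto_add)
  have le': "0 \<le> a k t" "a k t \<le> b k t" for k t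
    unfolding a_def b_def using FN2[OF radial_bounds(2,3)] by auto
  have P: "integrable circ a'" "(\<lambda>k. LINT t|circ. a k t) \<longlonglongrightarrow> (LINT t|circ. a' t)"
    using pratt_dominated_convergence[OF inta intb intb' a'm le' lima limb conv] by auto
  \<comment> \<open>Convergence has been shown along \<open>radial\<close> only. The full limit
    exists because \<open>F\<close> is in the Nevanlinna class, and the sequence identifies
    it.\<close>
  obtain L where L: "(circle_log_mean F \<longlongrightarrow> L) (at_left 1)"
    using FN by (auto simp: nevanlinna_class_def)
  have "(\<lambda>k. circle_log_mean F (radial k)) \<longlonglongrightarrow> L" by (rule filterlim_compose[OF L filterlim_radial])
  moreover have "(\<lambda>k. circle_log_mean F (radial k)) \<longlonglongrightarrow> (LINT t|circ. a' t) / (2 * pi)"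
    unfolding circle_log_mean_eq using P(2) unfolding a_def by (intro tendsto_divide) auto
  ultimately have "L = (LINT t|circ. a' t) / (2 * pi)" by (rule LIMSEQ_unique)
  then show ?thesis using FN P(1) L by (simp add: smirnov_class_alt a'_def[abs_def])
qed

lemma one_in_smirnov: "(\<lambda>_. 1) \<in> smirnov_class" "(\<lambda>_. 1) \<in> nevanlinna_class"
proof -
  have m: "circle_log_mean (\<lambda>_. 1) r = 0" for r by (simp add: circle_log_mean_eq log_plus_def)
  show N: "(\<lambda>_. 1) \<in> nevanlinna_class"
    unfolding nevanlinna_class_iff m by auto
  have "nontangential_value (\<lambda>_. 1) (cis t) = 1" for t
    by (rule nontangential_value_eq) (auto simp: has_nontangential_limit_def)
  then show "(\<lambda>_. 1) \<in> smirnov_class"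
    using N unfolding smirnov_class_alt by (simp add: m[abs_def] log_plus_def)
qed

section \<open>Deterministic interpolation\<close>

text \<open>The rotation parameter 0 gives \<open>(z - a) / (1 - cnj a * z)\<close>, whose modulus
  is the pseudohyperbolic distance.\<close>

abbreviation blaschke_factor :: "complex \<Rightarrow> complex \<Rightarrow> complex" where
  "blaschke_factor \<equiv> Moebius_function 0"

lemma blaschke_factor_denominator:
  assumes "norm a < 1" "norm z < 1"
  shows "1 - norm z \<le> norm (1 - cnj a * z)" "1 - norm a \<le> norm (1 - cnj a * z)"
    "1 - cnj a * z \<noteq> 0" "norm (1 - cnj a * z) \<le> 2"
proof -
  have "norm (cnj a * z) \<le> norm z" "norm (cnj a * z) \<le> norm a"
    using assms mult_right_mono[of "norm a" 1 "norm z"] mult_left_mono[of "norm z" 1 "norm a"]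
    by (simp_all add: norm_mult)
  moreover have "1 - norm (cnj a * z) \<le> norm (1 - cnj a * z)"
    using norm_triangle_ineq2[of 1 "cnj a * z"] by simp
  moreover have "norm (1 - cnj a * z) \<le> 1 + norm (cnj a * z)"
    using norm_triangle_ineq4[of 1 "cnj a * z"] by simp
  ultimately show 1: "1 - norm z \<le> norm (1 - cnj a * z)" "1 - norm a \<le> norm (1 - cnj a * z)"
    "norm (1 - cnj a * z) \<le> 2" using assms by linarith+
  show "1 - cnj a * z \<noteq> 0" using 1(1) assms(2) by force
qed

lemma one_minus_blaschke_factor_sq:
  assumes "norm a < 1" "norm z < 1"
  shows "1 - (norm (blaschke_factor a z))\<^sup>2 = (1 - (norm a)\<^sup>2) * (1 - (norm z)\<^sup>2) / (norm (1 - cnj a * z))\<^sup>2"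
proof -
  have "norm (1 - cnj a * z) \<noteq> 0" using blaschke_factor_denominator(3)[OF assms] by simp
  moreover have "(norm (1 - cnj a * z))\<^sup>2 - (norm (z - a))\<^sup>2 = (1 - (norm a)\<^sup>2) * (1 - (norm z)\<^sup>2)"
    unfolding cmod_power2 by (simp add: algebra_simps power2_eq_square)
  ultimately show ?thesis
    by (simp add: Moebius_function_simple norm_divide power_divide field_simps)
qed

lemma blaschke_factor_le_1: "norm a < 1 \<Longrightarrow> norm z < 1 \<Longrightarrow> norm (blaschke_factor a z) \<le> 1"
  using Moebius_function_norm_lt_1[of a z 0] by simp

text \<open>\<open>2 / (1 - w) - 1\<close> is the Herglotz kernel \<open>(1 + w) / (1 - w)\<close>,
  whose real part is a Poisson kernel and hence nonnegative.\<close>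

lemma kernel_Re:
  assumes "norm w < 1"
  shows "2 * Re (1 / (1 - w)) - 1 = (1 - (norm w)\<^sup>2) / (norm (1 - w))\<^sup>2" "1 / 2 \<le> Re (1 / (1 - w))"
proof -
  have "norm (1 - w) \<noteq> 0" using assms by auto
  then have nz: "(1 - Re w)\<^sup>2 + (Im w)\<^sup>2 \<noteq> 0" by (metis cmod_power2 diff_0_eq_0 minus_complex.simps one_complex.simps power2_minus power_eq_0_iff minus_diff_eq diff_0)
  show 1: "2 * Re (1 / (1 - w)) - 1 = (1 - (norm w)\<^sup>2) / (norm (1 - w))\<^sup>2"
    using nz unfolding cmod_power2 by (simp add: Re_divide field_simps power2_eq_square)
  have "0 \<le> (1 - (norm w)\<^sup>2) / (norm (1 - w))\<^sup>2"
    using assms by (simp add: power_le_one)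
  then show "1 / 2 \<le> Re (1 / (1 - w))" using 1 by simp
qed

text \<open>Each kernel is 1 at the origin, so for summable nonnegative \<open>e\<close> the sum of
  \<open>e\<close> is the value at 0 and thus every circle mean of the real part.\<close>

definition cauchy_sum :: "(nat \<Rightarrow> real) \<Rightarrow> (nat \<Rightarrow> complex) \<Rightarrow> complex \<Rightarrow> complex" where
  "cauchy_sum e \<Lambda> z = (\<Sum>n. of_real (e n) / (1 - cnj (\<Lambda> n) * z))"

locale disc_sequence =
  fixes \<Lambda> :: "nat \<Rightarrow> complex"
  assumes in_disc: "\<And>n. norm (\<Lambda> n) < 1"
begin

lemma kernel_lt: "norm z \<le> 1 \<Longrightarrow> norm (cnj (\<Lambda> n) * z) < 1"
  using in_disc[of n] mult_left_mono[of "norm z" 1 "norm (\<Lambda> n)"] by (simp add: norm_mult)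

lemma kernel_nonzero: "norm z \<le> 1 \<Longrightarrow> 1 - cnj (\<Lambda> n) * z \<noteq> 0"
  using kernel_lt[of z n] by auto

lemma Re_of_real_divide: "Re (of_real e / w) = e * Re (1 / w)"
  by (simp add: Re_divide)

lemma Re_term_nonneg: "norm z \<le> 1 \<Longrightarrow> 0 \<le> e \<Longrightarrow> 0 \<le> Re (of_real e / (1 - cnj (\<Lambda> n) * z))"
  unfolding Re_of_real_divide using kernel_Re(2)[OF kernel_lt[of z n]]
  by (intro mult_nonneg_nonneg) auto

context
  fixes e :: "nat \<Rightarrow> real"
  assumes e0: "\<And>n. 0 \<le> e n" and se: "summable e"
begin

lemma cauchy_term_bound:
  assumes "norm z \<le> R" "R < 1"
  shows "norm (of_real (e n) / (1 - cnj (\<Lambda> n) * z)) \<le> e n / (1 - R)"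
proof -
  have "1 - R \<le> norm (1 - cnj (\<Lambda> n) * z)"
    using blaschke_factor_denominator(1)[OF in_disc, of z n] assms by auto
  then show ?thesis using assms e0[of n] by (auto simp: norm_divide intro!: divide_left_mono mult_pos_pos)
qed

lemma cauchy_summable: "norm z < 1 \<Longrightarrow> summable (\<lambda>n. of_real (e n) / (1 - cnj (\<Lambda> n) * z))"
  using cauchy_term_bound[of z "norm z"]
  by (intro summable_comparison_test'[OF summable_divide[OF se, of "1 - norm z"], of 0]) auto

lemma cauchy_sum_holomorphic: "cauchy_sum e \<Lambda> holomorphic_on ball 0 1"
proof (rule holomorphic_uniform_sequence)
  show "(\<lambda>z. \<Sum>n<N. of_real (e n) / (1 - cnj (\<Lambda> n) * z)) holomorphic_on ball 0 1" for N
    by (intro holomorphic_intros) (use kernel_nonzero in auto)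
  fix z :: complex assume z: "z \<in> ball 0 1"
  define d where "d = (1 - norm z) / 2"
  have d: "0 < d" using z by (simp add: d_def)
  have le: "norm w \<le> 1 - d" if "w \<in> cball z d" for w
  proof -
    have "norm (w - z) \<le> d" using that by (simp add: dist_norm norm_minus_commute)
    moreover have "norm w \<le> norm (w - z) + norm z" using norm_triangle_ineq[of "w - z" z] by simp
    moreover have "x \<le> 1 - d" if "y \<le> d" "x \<le> y + norm z" for x y
      using that unfolding d_def by (simp add: field_simps)
    ultimately show ?thesis by blast
  qed
  have "uniform_limit (cball z d) (\<lambda>N w. \<Sum>n<N. of_real (e n) / (1 - cnj (\<Lambda> n) * w)) (cauchy_sum e \<Lambda>) sequentially"
    unfolding cauchy_sum_def[abs_def]
    using cauchy_term_bound[OF le] d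
    by (intro Weierstrass_m_test[OF _ summable_divide[OF se, of d]]) auto
  moreover have "cball z d \<subseteq> ball 0 1" using le d by force
  ultimately show "\<exists>d>0. cball z d \<subseteq> ball 0 1 \<and>
      uniform_limit (cball z d) (\<lambda>N w. \<Sum>n<N. of_real (e n) / (1 - cnj (\<Lambda> n) * w)) (cauchy_sum e \<Lambda>) sequentially"
    using d by blast
qed auto

lemma Re_cauchy_sum:
  assumes "norm z < 1"
  shows "(\<lambda>n. Re (of_real (e n) / (1 - cnj (\<Lambda> n) * z))) sums Re (cauchy_sum e \<Lambda> z)"
  using sums_Re[OF summable_sums[OF cauchy_summable[OF assms]]] by (simp only: cauchy_sum_def)

lemma Re_cauchy_sum_ge:
  assumes "norm z < 1" "finite A"
  shows "(\<Sum>n\<in>A. Re (of_real (e n) / (1 - cnj (\<Lambda> n) * z))) \<le> Re (cauchy_sum e \<Lambda> z)"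
  using sum_le_suminf[OF sums_summable[OF Re_cauchy_sum[OF assms(1)]] assms(2)]
    sums_unique[OF Re_cauchy_sum[OF assms(1)]] Re_term_nonneg[OF _ e0] assms(1) by simp

lemma Re_cauchy_sum_nonneg: "norm z < 1 \<Longrightarrow> 0 \<le> Re (cauchy_sum e \<Lambda> z)"
  using Re_cauchy_sum_ge[of z "{}"] by simp

lemma cauchy_sum_0: "cauchy_sum e \<Lambda> 0 = of_real (suminf e)"
  using suminf_of_real[OF se, where 'a=complex] by (simp add: cauchy_sum_def)

text \<open>The boundary values of \<open>Re (cauchy_sum e \<Lambda>)\<close> dominate every partial sum, whose circle mean is
  the partial sum of \<open>e\<close>; with Fatou's lemma this shows that no mass is lost at the boundary.\<close>

lemma cauchy_sum_boundary:
  obtains H where "integrable circ H" "(LINT t|circ. H t) = 2 * pi * Re (cauchy_sum e \<Lambda> 0)"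
      "AE t in circ. (\<lambda>k. Re (cauchy_sum e \<Lambda> (of_real (radial k) * cis t))) \<longlonglongrightarrow> H t"
proof -
  let ?E = "cauchy_sum e \<Lambda>"
  define h where "h k t = Re (?E (of_real (radial k) * cis t))" for k t
  define H where "H t = lim (\<lambda>k. h k t)" for t
  have hint: "integrable circ (h k)" for k
    unfolding h_def by (intro Re_circle_mean_radial(2) cauchy_sum_holomorphic radial_bounds)
  have ndisc: "norm (of_real (radial k) * cis t) < 1" for k t
    using radial_bounds[of k] by (simp add: norm_mult)
  have h0: "0 \<le> h k t" for k t
    unfolding h_def by (intro Re_cauchy_sum_nonneg ndisc)
  \<comment> \<open>A nonzero boundary limit of \<open>exp (- ?E z)\<close> has a finite logarithm,
    so \<open>Re ?E\<close> itself converges along the radius.\<close>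
  have "AE t in circ. \<exists>l. l \<noteq> 0 \<and> has_nontangential_limit (\<lambda>z. exp (- ?E z)) (cis t) l"
    by (rule exp_minus_nonzero_boundary_limit[OF cauchy_sum_holomorphic Re_cauchy_sum_nonneg])
  then have lim: "AE t in circ. (\<lambda>k. h k t) \<longlonglongrightarrow> H t"
  proof eventually_elim
    case (elim t)
    then obtain l where l: "l \<noteq> 0" "has_nontangential_limit (\<lambda>z. exp (- ?E z)) (cis t) l" by blast
    have "(\<lambda>k. exp (- ?E (of_real (radial k) * cis t))) \<longlonglongrightarrow> l"
      using filterlim_compose[OF nontangential_imp_radial[OF l(2)] filterlim_radial] by simp
    then have "(\<lambda>k. - ln (norm (exp (- ?E (of_real (radial k) * cis t))))) \<longlonglongrightarrow> - ln (norm l)"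
      using l(1) by (intro tendsto_intros) auto
    then have "(\<lambda>k. h k t) \<longlonglongrightarrow> - ln (norm l)" by (simp add: norm_exp_eq_Re h_def)
    then show ?case by (simp add: H_def limI)
  qed
  have Hm: "H \<in> borel_measurable circ"
    unfolding H_def[abs_def] using hint by (intro borel_measurable_lim_metric) auto
  have H0: "AE t in circ. 0 \<le> H t"
    using lim by eventually_elim (auto intro: LIMSEQ_le_const h0)
  have liminf_eq: "AE t in circ. liminf (\<lambda>k. ennreal (h k t)) = ennreal (H t)"
    using lim by eventually_elim (intro lim_imp_Liminf tendsto_ennrealI; simp)
  have up: "(\<integral>\<^sup>+t. ennreal (H t) \<partial>circ) \<le> ennreal (2 * pi * Re (?E 0))"
    using nn_integral_liminf_Re_le[OF cauchy_sum_holomorphic Re_cauchy_sum_nonneg]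
      nn_integral_cong_AE[OF liminf_eq] unfolding h_def by simp
  have Hint: "integrable circ H"
  proof (rule integrableI_bounded[OF Hm])
    have "(\<integral>\<^sup>+t. ennreal (norm (H t)) \<partial>circ) = (\<integral>\<^sup>+t. ennreal (H t) \<partial>circ)"
      using H0 by (intro nn_integral_cong_AE) (auto elim!: eventually_mono)
    then show "(\<integral>\<^sup>+t. ennreal (norm (H t)) \<partial>circ) < \<infinity>" using up by (simp add: le_less_trans)
  qed
  have "(LINT t|circ. H t) \<le> 2 * pi * Re (?E 0)"
    using up nn_integral_eq_integral[OF Hint H0] Re_cauchy_sum_nonneg[of 0] by simp
  moreover have "2 * pi * suminf e \<le> (LINT t|circ. H t)"
  proof -
    have "2 * pi * (\<Sum>n<N. e n) \<le> (LINT t|circ. H t)" for N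
    proof -
      define g where "g z = (\<Sum>n<N. of_real (e n) / (1 - cnj (\<Lambda> n) * z))" for z
      have gh: "g holomorphic_on cball 0 1"
        unfolding g_def by (intro holomorphic_intros) (use kernel_nonzero in auto)
      have "2 * pi * Re (g 0) = (LINT t|circ. Re (g (of_real 1 * cis t)))"
        by (intro Re_holomorphic_circle_mean[symmetric] gh) simp
      also have "\<dots> \<le> (LINT t|circ. H t)"
      proof (rule integral_mono_AE)
        show "integrable circ (\<lambda>t. Re (g (of_real 1 * cis t)))"
          by (intro integrable_Re integrable_circ_holomorphic gh) simp
        show "AE t in circ. Re (g (of_real 1 * cis t)) \<le> H t"
          using lim
        proof eventually_elim
          case (elim t)
          have "(\<lambda>k. of_real (radial k) * cis t) \<longlonglongrightarrow> of_real 1 * cis t"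
            using filterlim_radial by (intro tendsto_intros) (auto simp: filterlim_at)
          then have "(\<lambda>k. g (of_real (radial k) * cis t)) \<longlonglongrightarrow> g (of_real 1 * cis t)"
            using holomorphic_on_imp_continuous_on[OF gh] ndisc
            by (intro continuous_on_tendsto_compose[of "cball 0 1" g]) (auto intro: always_eventually less_imp_le)
          then have "(\<lambda>k. Re (g (of_real (radial k) * cis t))) \<longlonglongrightarrow> Re (g (of_real 1 * cis t))"
            by (rule tendsto_Re)
          moreover have "Re (g (of_real (radial k) * cis t)) \<le> h k t" for k
            using Re_cauchy_sum_ge[OF ndisc, of "{..<N}" k t] by (simp only: g_def h_def Re_sum finite_lessThan)
          ultimately show ?case using elim by (intro LIMSEQ_le) auto
        qed
      qed (rule Hint)
      finally show ?thesis by (simp add: g_def)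
    qed
    then have "(\<Sum>n<N. e n) \<le> (LINT t|circ. H t) / (2 * pi)" for N by (simp add: field_simps)
    then have "suminf e \<le> (LINT t|circ. H t) / (2 * pi)" by (intro suminf_le_const se)
    then show ?thesis by (simp add: field_simps)
  qed
  ultimately have "(LINT t|circ. H t) = 2 * pi * Re (?E 0)" by (simp add: cauchy_sum_0)
  then show ?thesis using Hint lim unfolding h_def by (intro that)
qed

end

lemma cauchy_sum_add:
  assumes "\<And>n. 0 \<le> e n" "summable e" "\<And>n. 0 \<le> e' n" "summable e'" "norm z < 1"
  shows "cauchy_sum (\<lambda>n. e n + e' n) \<Lambda> z = cauchy_sum e \<Lambda> z + cauchy_sum e' \<Lambda> z"
  using suminf_add[OF cauchy_summable[OF assms(1,2,5)] cauchy_summable[OF assms(3,4,5)]]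
  by (simp add: cauchy_sum_def add_divide_distrib)

end

text \<open>The finite interpolation problems have the solutions
  \<open>(\<Sum>n<N. a n * B n z / B n (\<Lambda> n) * q n z ^ 2 * exp (H z - H (\<Lambda> n)))\<close> with
  \<open>q n z = (1 - norm (\<Lambda> n) ^ 2) / (1 - cnj (\<Lambda> n) * z)\<close>, \<open>H = (\<Sum>n. d n * q n)\<close> and \<open>B n\<close> the finite Blaschke product
  without the \<open>n\<close>-th factor. As \<open>Re (H (\<Lambda> n)) \<ge> d n\<close>, the coefficients are at most \<open>1\<close>, and
  \<open>norm (q n z) ^ 2\<close> is bounded by the real part of \<open>2 * q n z\<close>. Normal families
  then give the infinite interpolation.\<close>

lemma bounded_interpolation:
  fixes a \<Lambda> :: "nat \<Rightarrow> complex" and d :: "nat \<Rightarrow> real"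
  defines "w \<equiv> (\<lambda>n. 1 - (norm (\<Lambda> n))\<^sup>2)"
  assumes disc: "\<And>n. norm (\<Lambda> n) < 1" and d0: "\<And>n. 0 \<le> d n"
    and sw: "summable w" and sd: "summable (\<lambda>n. d n * w n)"
    and a: "\<And>n N. n < N \<Longrightarrow>
      norm (a n) \<le> exp (d n) * (\<Prod>k\<in>{..<N} - {n}. norm (blaschke_factor (\<Lambda> k) (\<Lambda> n)))"
  obtains \<psi> where "\<psi> holomorphic_on ball 0 1" "\<And>z. norm z < 1 \<Longrightarrow> norm (\<psi> z) \<le> 1"
    "\<And>n. \<psi> (\<Lambda> n) * exp (cauchy_sum (\<lambda>n. (d n + 2) * w n) \<Lambda> (\<Lambda> n)) = a n"
proof -
  interpret disc_sequence \<Lambda> by standard (rule disc)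
  have w0: "0 < w n" for n using disc[of n] by (simp add: w_def power_less_one_iff)
  define H where "H = cauchy_sum (\<lambda>n. d n * w n) \<Lambda>"
  define K where "K = cauchy_sum (\<lambda>n. 2 * w n) \<Lambda>"
  have dw: "0 \<le> d n * w n" "0 \<le> 2 * w n" for n using d0[of n] w0[of n] by auto
  have s2: "summable (\<lambda>n. 2 * w n)" using sw by (rule summable_mult)
  have Hh: "H holomorphic_on ball 0 1" and Kh: "K holomorphic_on ball 0 1"
    unfolding H_def K_def by (intro cauchy_sum_holomorphic dw sd s2)+
  have EHK: "cauchy_sum (\<lambda>n. (d n + 2) * w n) \<Lambda> z = H z + K z" if "norm z < 1" for z
    using cauchy_sum_add[OF dw(1) sd dw(2) s2 that] by (simp add: H_def K_def distrib_right)
  \<comment> \<open>The \<open>n\<close>-th term of \<open>H\<close>, of weight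
    \<open>d n * w n\<close>, equals \<open>d n\<close> exactly at \<open>\<Lambda> n\<close>; the
    other terms only add to the real part.\<close>
  have Hge: "d n \<le> Re (H (\<Lambda> n))" for n
  proof -
    have "cnj (\<Lambda> n) * \<Lambda> n = of_real ((norm (\<Lambda> n))\<^sup>2)"
      using complex_norm_square[of "\<Lambda> n"] by (simp add: mult.commute)
    then have "1 - cnj (\<Lambda> n) * \<Lambda> n = of_real (w n)" by (simp add: w_def)
    then have "of_real (d n * w n) / (1 - cnj (\<Lambda> n) * \<Lambda> n) = complex_of_real (d n)"
      using w0[of n] by simp
    then show ?thesis
      using Re_cauchy_sum_ge[OF dw(1) sd disc[of n], of "{n}"] by (simp add: H_def)
  qed
  define B where "B N n z = (\<Prod>k\<in>{..<N} - {n}. blaschke_factor (\<Lambda> k) z)" for N n z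
  define q where "q n z = of_real (w n) / (1 - cnj (\<Lambda> n) * z)" for n z
  have Bh: "B N n holomorphic_on ball 0 1" for N n
    unfolding B_def using Moebius_function_holomorphic[OF disc] by (intro holomorphic_intros) auto
  have qh: "q n holomorphic_on ball 0 1" for n
    unfolding q_def by (intro holomorphic_intros) (use kernel_nonzero in auto)
  have Ble: "norm (B N n z) \<le> 1" if "norm z < 1" for N n z
    unfolding B_def prod_norm[symmetric] using that by (intro prod_le_1) (auto intro: blaschke_factor_le_1 disc)
  have qn: "q n (\<Lambda> n) = 1" for n
  proof -
    have "cnj (\<Lambda> n) * \<Lambda> n = of_real ((norm (\<Lambda> n))\<^sup>2)"
      using complex_norm_square[of "\<Lambda> n"] by (simp add: mult.commute)
    then have "1 - cnj (\<Lambda> n) * \<Lambda> n = of_real (w n)" by (simp add: w_def)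
    then show ?thesis unfolding q_def using w0[of n] by simp
  qed
  have qsq: "(norm (q n z))\<^sup>2 \<le> Re (of_real (2 * w n) / (1 - cnj (\<Lambda> n) * z))" if z: "norm z < 1" for n z
  proof -
    define u where "u = cnj (\<Lambda> n) * z"
    have u: "norm u < 1" "norm u \<le> norm (\<Lambda> n)"
      using kernel_lt[of z n] z mult_left_mono[of "norm z" 1 "norm (\<Lambda> n)"] by (auto simp: u_def norm_mult)
    have "(norm u)\<^sup>2 \<le> (norm (\<Lambda> n))\<^sup>2" using u by (intro power_mono) auto
    then have "w n \<le> 1 - (norm u)\<^sup>2" by (simp add: w_def)
    then have "w n / (norm (1 - u))\<^sup>2 \<le> (1 - (norm u)\<^sup>2) / (norm (1 - u))\<^sup>2"
      by (intro divide_right_mono) auto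
    also have "\<dots> = 2 * Re (1 / (1 - u)) - 1" using kernel_Re(1)[OF u(1)] by simp
    also have "\<dots> \<le> 2 * Re (1 / (1 - u))" by simp
    finally have "w n * (w n / (norm (1 - u))\<^sup>2) \<le> w n * (2 * Re (1 / (1 - u)))"
      using w0[of n] by (intro mult_left_mono) auto
    moreover have "(norm (q n z))\<^sup>2 = w n * (w n / (norm (1 - u))\<^sup>2)"
      using w0[of n] by (simp add: q_def u_def[symmetric] norm_divide power_divide power2_eq_square)
    moreover have "Re (of_real (2 * w n) / (1 - u)) = w n * (2 * Re (1 / (1 - u)))"
      by (simp add: Re_divide)
    ultimately show ?thesis by (simp only: u_def)
  qed
  define c where "c N n = a n / B N n (\<Lambda> n) * exp (- H (\<Lambda> n))" for N n
  have cle: "norm (c N n) \<le> 1" if "n < N" for N n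
  \<comment> \<open>If the product vanishes, division by zero makes the coefficient 0. This is
    consistent, as \<open>a n = 0\<close> in that case.\<close>
  proof (cases "B N n (\<Lambda> n) = 0")
    case False
    have "norm (a n) \<le> exp (d n) * norm (B N n (\<Lambda> n))"
      using a[OF that] by (simp add: B_def prod_norm)
    then have "norm (a n) / norm (B N n (\<Lambda> n)) \<le> exp (d n)" using False by (simp add: field_simps)
    also have "\<dots> \<le> exp (Re (H (\<Lambda> n)))" using Hge by simp
    finally have "norm (a n) / norm (B N n (\<Lambda> n)) * exp (- Re (H (\<Lambda> n))) \<le> exp (Re (H (\<Lambda> n))) * exp (- Re (H (\<Lambda> n)))"
      by (intro mult_right_mono) auto
    then show ?thesis by (simp add: c_def norm_mult norm_divide norm_exp_eq_Re flip: exp_add)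
  qed (simp add: c_def)
  \<comment> \<open>The finite interpolant divided by \<open>exp (H z + K z)\<close>. The factor
    \<open>exp (- K z)\<close> brings the bound \<open>Re (K z)\<close> of the sum down to 1, by
    \<open>x \<le> exp x\<close>.\<close>
  define \<phi> where "\<phi> N z = exp (- K z) * (\<Sum>n<N. c N n * B N n z * (q n z)\<^sup>2)" for N z
  have \<phi>h: "\<phi> N holomorphic_on ball 0 1" for N
    unfolding \<phi>_def by (intro holomorphic_intros Kh Bh qh)
  have \<phi>le: "norm (\<phi> N z) \<le> 1" if z: "norm z < 1" for N z
  proof -
    have "norm (\<Sum>n<N. c N n * B N n z * (q n z)\<^sup>2) \<le> (\<Sum>n<N. (norm (q n z))\<^sup>2)"
    proof (rule sum_norm_le)
      fix n assume "n \<in> {..<N}"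
      then have "norm (c N n) * norm (B N n z) \<le> 1 * 1"
        using cle[of n N] Ble[OF z] by (intro mult_mono) auto
      then have "(norm (c N n) * norm (B N n z)) * (norm (q n z))\<^sup>2 \<le> 1 * (norm (q n z))\<^sup>2"
        by (intro mult_right_mono) auto
      then show "norm (c N n * B N n z * (q n z)\<^sup>2) \<le> (norm (q n z))\<^sup>2"
        by (simp add: norm_mult norm_power)
    qed
    also have "\<dots> \<le> (\<Sum>n<N. Re (of_real (2 * w n) / (1 - cnj (\<Lambda> n) * z)))"
      by (intro sum_mono qsq z)
    also have "\<dots> \<le> Re (K z)" unfolding K_def by (intro Re_cauchy_sum_ge dw s2 z) auto
    also have "\<dots> \<le> exp (Re (K z))" using exp_ge_add_one_self[of "Re (K z)"] by linarith
    finally have "exp (- Re (K z)) * norm (\<Sum>n<N. c N n * B N n z * (q n z)\<^sup>2)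
        \<le> exp (- Re (K z)) * exp (Re (K z))"
      by (intro mult_left_mono) auto
    then show ?thesis
      by (simp add: \<phi>_def norm_mult norm_exp_eq_Re flip: exp_add)
  qed
  have \<phi>val: "\<phi> N (\<Lambda> m) = a m * exp (- (H (\<Lambda> m) + K (\<Lambda> m)))" if m: "m < N" for N m
  proof -
    have "(\<Sum>n<N. c N n * B N n (\<Lambda> m) * (q n (\<Lambda> m))\<^sup>2) = (\<Sum>n<N. if n = m then a m * exp (- H (\<Lambda> m)) else 0)"
    proof (rule sum.cong[OF refl])
      fix n assume "n \<in> {..<N}"
      show "c N n * B N n (\<Lambda> m) * (q n (\<Lambda> m))\<^sup>2 = (if n = m then a m * exp (- H (\<Lambda> m)) else 0)"
      proof (cases "n = m")
        case True
        have "a m = 0" if "B N m (\<Lambda> m) = 0"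
        proof -
          have "norm (a m) \<le> exp (d m) * norm (B N m (\<Lambda> m))"
            using a[OF m] by (simp add: B_def prod_norm)
          then show ?thesis using that by simp
        qed
        then show ?thesis using True by (auto simp: c_def qn)
      next
        case False
        then have "B N n (\<Lambda> m) = 0"
          unfolding B_def using m by (intro prod_zero) (auto simp: Moebius_function_simple)
        then show ?thesis using False by simp
      qed
    qed
    also have "\<dots> = a m * exp (- H (\<Lambda> m))" using m by simp
    finally show ?thesis by (simp add: \<phi>_def exp_diff exp_minus divide_inverse mult_ac)
  qed
  obtain \<psi> r where \<psi>: "\<psi> holomorphic_on ball 0 1" "strict_mono (r :: nat \<Rightarrow> nat)"
    "\<And>z. norm z < 1 \<Longrightarrow> (\<lambda>n. \<phi> (r n) z) \<longlonglongrightarrow> \<psi> z" "\<And>z. norm z < 1 \<Longrightarrow> norm (\<psi> z) \<le> 1"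
    by (rule montel_unit_ball[OF \<phi>h \<phi>le], assumption) (rule that; assumption)
  show ?thesis
  proof (rule that[OF \<psi>(1,4)])
    fix m
    have "\<forall>\<^sub>F n in sequentially. \<phi> (r n) (\<Lambda> m) = a m * exp (- (H (\<Lambda> m) + K (\<Lambda> m)))"
      unfolding eventually_sequentially
    proof (intro exI[of _ "Suc m"] allI impI)
      fix n assume "Suc m \<le> n"
      then have "m < r n" using seq_suble[OF \<psi>(2), of n] by simp
      then show "\<phi> (r n) (\<Lambda> m) = a m * exp (- (H (\<Lambda> m) + K (\<Lambda> m)))" by (rule \<phi>val)
    qed
    then have "(\<lambda>n. \<phi> (r n) (\<Lambda> m)) \<longlonglongrightarrow> a m * exp (- (H (\<Lambda> m) + K (\<Lambda> m)))"
      by (rule tendsto_eventually)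
    then have "\<psi> (\<Lambda> m) = a m * exp (- (H (\<Lambda> m) + K (\<Lambda> m)))"
      using \<psi>(3)[OF disc[of m]] LIMSEQ_unique by blast
    then show "\<psi> (\<Lambda> m) * exp (cauchy_sum (\<lambda>n. (d n + 2) * w n) \<Lambda> (\<Lambda> m)) = a m"
      by (simp add: EHK disc mult.assoc flip: exp_add)
  qed
qed

theorem free_interpolating_sufficient:
  fixes \<Lambda> :: "nat \<Rightarrow> complex" and c :: "nat \<Rightarrow> real"
  assumes disc: "\<And>n. norm (\<Lambda> n) < 1" and c0: "\<And>n. 0 \<le> c n"
    and sw: "summable (\<lambda>n. 1 - (norm (\<Lambda> n))\<^sup>2)" and sc: "summable (\<lambda>n. c n * (1 - (norm (\<Lambda> n))\<^sup>2))"
    and sep: "\<And>n N. n < N \<Longrightarrow> exp (- c n) \<le> (\<Prod>k\<in>{..<N} - {n}. norm (blaschke_factor (\<Lambda> k) (\<Lambda> n)))"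
    and X: "X = nevanlinna_class \<or> X = smirnov_class"
  shows "free_interpolating X \<Lambda>"
  unfolding free_interpolating_def
proof clarify
  fix a b :: "nat \<Rightarrow> complex" assume ba: "bounded (range a)" and b: "b \<in> trace_space X \<Lambda>"
  interpret disc_sequence \<Lambda> by standard (rule disc)
  obtain g where g: "g \<in> X" "b = (\<lambda>n. g (\<Lambda> n))" using b by (auto simp: trace_space_def)
  obtain A where A: "1 \<le> A" "\<And>n. norm (a n) \<le> A"
    using ba unfolding bounded_iff by (metis max.cobounded1 max.coboundedI2 range_eqI)
  \<comment> \<open>Adding \<open>ln A\<close> absorbs the bound of \<open>a\<close>;
    \<open>1 \<le> A\<close> keeps the exponents nonnegative.\<close>
  define d where "d n = c n + ln A" for n
  define e where "e n = (d n + 2) * (1 - (norm (\<Lambda> n))\<^sup>2)" for n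
  have d0: "0 \<le> d n" for n using c0[of n] A by (simp add: d_def)
  have sd: "summable (\<lambda>n. d n * (1 - (norm (\<Lambda> n))\<^sup>2))"
    using summable_add[OF sc summable_mult[OF sw, of "ln A"]] by (simp add: d_def distrib_right)
  have w0: "0 \<le> 1 - (norm (\<Lambda> n))\<^sup>2" for n using disc[of n] by (simp add: power_le_one)
  have e0: "0 \<le> e n" for n using d0[of n] w0[of n] by (simp add: e_def)
  have "e = (\<lambda>n. d n * (1 - (norm (\<Lambda> n))\<^sup>2) + 2 * (1 - (norm (\<Lambda> n))\<^sup>2))"
    by (rule ext) (simp only: e_def distrib_right)
  then have se: "summable e"
    using summable_add[OF sd summable_mult[OF sw, of 2]] by (simp only:)
  have bound: "norm (a n) \<le> exp (d n) * (\<Prod>k\<in>{..<N} - {n}. norm (blaschke_factor (\<Lambda> k) (\<Lambda> n)))"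
    if "n < N" for n N
  proof -
    have "norm (a n) \<le> A" by (rule A)
    also have "A = exp (d n) * exp (- c n)" using A by (simp add: d_def flip: exp_add)
    also have "\<dots> \<le> exp (d n) * (\<Prod>k\<in>{..<N} - {n}. norm (blaschke_factor (\<Lambda> k) (\<Lambda> n)))"
      using sep[OF that] by (intro mult_left_mono) auto
    finally show ?thesis .
  qed
  obtain \<psi> where \<psi>: "\<psi> holomorphic_on ball 0 1" "\<And>z. norm z < 1 \<Longrightarrow> norm (\<psi> z) \<le> 1"
    "\<And>n. \<psi> (\<Lambda> n) * exp (cauchy_sum (\<lambda>n. (d n + 2) * (1 - (norm (\<Lambda> n))\<^sup>2)) \<Lambda> (\<Lambda> n)) = a n"
    by (rule bounded_interpolation[OF disc d0 sw sd bound], assumption) (rule that)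
  \<comment> \<open>The products \<open>a n * b n\<close> may be unbounded, so only \<open>a\<close>
    is interpolated and \<open>g\<close>, whose trace is \<open>b\<close>, stays as a
    factor.\<close>
  define F where "F z = \<psi> z * exp (cauchy_sum e \<Lambda> z) * g z" for z
  have Eh: "cauchy_sum e \<Lambda> holomorphic_on ball 0 1" by (rule cauchy_sum_holomorphic[OF e0 se])
  have gN: "g \<in> nevanlinna_class" using g X by (auto simp: smirnov_class_def)
  have gh: "g holomorphic_on ball 0 1" using gN nevanlinna_class_iff by blast
  have Fh: "F holomorphic_on ball 0 1" unfolding F_def by (intro holomorphic_intros \<psi> Eh gh)
  have E0: "0 \<le> Re (cauchy_sum e \<Lambda> z)" if "norm z < 1" for z
    by (rule Re_cauchy_sum_nonneg[OF e0 se that])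
  have le: "norm (F z) \<le> exp (Re (cauchy_sum e \<Lambda> z)) * norm (g z)" if "norm z < 1" for z
    using mult_right_mono[OF \<psi>(2)[OF that], of "exp (Re (cauchy_sum e \<Lambda> z)) * norm (g z)"]
    by (simp add: F_def norm_mult norm_exp_eq_Re mult.assoc)
  have "F \<in> X"
  proof (cases "X = nevanlinna_class")
    case True
    have "F \<in> nevanlinna_class" by (rule nevanlinna_mult_exp(1)[OF gN Fh Eh E0 le])
    then show ?thesis using True by simp
  next
    case False
    then have X: "X = smirnov_class" using X by simp
    obtain H where H: "integrable circ H" "(LINT t|circ. H t) = 2 * pi * Re (cauchy_sum e \<Lambda> 0)"
      "AE t in circ. (\<lambda>k. Re (cauchy_sum e \<Lambda> (of_real (radial k) * cis t))) \<longlonglongrightarrow> H t"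
      by (rule cauchy_sum_boundary[OF e0 se])
    have "g \<in> smirnov_class" using g X by simp
    then have "F \<in> smirnov_class" by (rule smirnov_mult_exp[OF _ Fh Eh E0 H le])
    then show ?thesis using X by simp
  qed
  moreover have "F (\<Lambda> n) = a n * b n" for n
    unfolding F_def using \<psi>(3)[folded e_def[abs_def]] g(2) by simp
  ultimately show "(\<lambda>n. a n * b n) \<in> trace_space X \<Lambda>"
    unfolding trace_space_def by (intro CollectI exI[of _ F]) auto
qed

section \<open>Division by Blaschke factors and the Blaschke condition\<close>

text \<open>The modulus of a Blaschke factor tends to 1 uniformly at the unit circle. The maximum
  principle on discs of radius \<open>r\<close> thus bounds the quotient by a constant that tends to
  1 with \<open>r\<close>.\<close>

lemma bounded_divide_blaschke_factor:
  assumes f: "f holomorphic_on ball 0 1" "\<And>z. norm z < 1 \<Longrightarrow> norm (f z) \<le> 1"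
    and a: "norm a < 1" "f a = 0"
  obtains g where "g holomorphic_on ball 0 1" "\<And>z. norm z < 1 \<Longrightarrow> norm (g z) \<le> 1"
    "\<And>z. norm z < 1 \<Longrightarrow> f z = blaschke_factor a z * g z"
proof -
  define h where "h z = (if z = a then deriv f a else (f z - f a) / (z - a))" for z
  have hh: "h holomorphic_on ball 0 1"
    unfolding h_def by (rule pole_theorem_open_0[of f]) (use f a in auto)
  define g where "g z = h z * (1 - cnj a * z)" for z
  have gh: "g holomorphic_on ball 0 1" unfolding g_def by (intro holomorphic_intros hh)
  have fg: "f z = blaschke_factor a z * g z" if "norm z < 1" for z
    using a blaschke_factor_denominator(3)[OF a(1) that]
    by (auto simp: g_def h_def Moebius_function_simple)
  \<comment> \<open>From \<open>1 - norm a \<le> norm (1 - cnj a * v)\<close>: on the circle of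
    radius \<open>r\<close> the squared modulus of the factor is at least
    \<open>1 - C * (1 - r^2)\<close>. For small \<open>r\<close> this bound may be nonpositive, and
    the next inequality is then trivial.\<close>
  define C where "C = (1 - (norm a)\<^sup>2) / (1 - norm a)\<^sup>2"
  have C0: "0 \<le> C" using a by (simp add: C_def power_le_one)
  have bd: "(norm (g z))\<^sup>2 * (1 - C * (1 - r\<^sup>2)) \<le> 1" if r: "norm z < r" "r < 1" for r z
  proof (cases "0 < 1 - C * (1 - r\<^sup>2)")
    case True
    define m where "m = 1 - C * (1 - r\<^sup>2)"
    have m: "0 < m" using True by (simp add: m_def)
    have "norm (g z) \<le> 1 / sqrt m"
    proof (rule maximum_modulus_frontier[of g "cball 0 r"])
      show "g holomorphic_on interior (cball 0 r)"
        using r by (intro holomorphic_on_subset[OF gh]) auto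
      show "continuous_on (closure (cball 0 r)) g"
        using r by (intro continuous_on_subset[OF holomorphic_on_imp_continuous_on[OF gh]]) auto
      fix v assume "v \<in> frontier (cball (0::complex) r)"
      then have v: "norm v = r" using r by (auto simp: frontier_cball)
      then have v1: "norm v < 1" using r by simp
      have pos: "0 < (norm (1 - cnj a * v))\<^sup>2" "0 < (1 - norm a)\<^sup>2"
        using a blaschke_factor_denominator(3)[OF a(1) v1] by (simp_all del: right_minus_eq)
      have "(1 - norm a)\<^sup>2 \<le> (norm (1 - cnj a * v))\<^sup>2"
        using blaschke_factor_denominator(2)[OF a(1) v1] a by (intro power_mono) auto
      then have "(1 - (norm a)\<^sup>2) * (1 - r\<^sup>2) / (norm (1 - cnj a * v))\<^sup>2 \<le> (1 - (norm a)\<^sup>2) * (1 - r\<^sup>2) / (1 - norm a)\<^sup>2"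
        using a r v by (intro divide_left_mono mult_nonneg_nonneg mult_pos_pos pos)
          (auto simp: power_le_one)
      then have "1 - (norm (blaschke_factor a v))\<^sup>2 \<le> C * (1 - r\<^sup>2)"
        using one_minus_blaschke_factor_sq[OF a(1) v1] v by (simp add: C_def)
      then have "m \<le> (norm (blaschke_factor a v))\<^sup>2" by (simp add: m_def)
      then have sm: "sqrt m \<le> norm (blaschke_factor a v)" by (simp add: real_le_lsqrt)
      have "sqrt m * norm (g v) \<le> norm (blaschke_factor a v) * norm (g v)"
        using sm by (intro mult_right_mono) auto
      also have "\<dots> \<le> 1" using fg[OF v1] f(2)[OF v1] by (simp add: norm_mult)
      finally show "norm (g v) \<le> 1 / sqrt m" using m by (simp add: field_simps)
    qed (use r in auto)
    then have "(norm (g z))\<^sup>2 \<le> (1 / sqrt m)\<^sup>2" by (intro power_mono) auto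
    then show ?thesis using m by (simp add: power_divide field_simps m_def)
  next
    case False
    then have "(norm (g z))\<^sup>2 * (1 - C * (1 - r\<^sup>2)) \<le> 0" by (intro mult_nonneg_nonpos) auto
    then show ?thesis by simp
  qed
  have "norm (g z) \<le> 1" if z: "norm z < 1" for z
  proof -
    have "((\<lambda>r. (norm (g z))\<^sup>2 * (1 - C * (1 - r\<^sup>2))) \<longlongrightarrow> (norm (g z))\<^sup>2 * (1 - C * (1 - 1\<^sup>2))) (at_left 1)"
      by (intro tendsto_intros)
    moreover have "\<forall>\<^sub>F r in at_left 1. (norm (g z))\<^sup>2 * (1 - C * (1 - r\<^sup>2)) \<le> 1"
      using z bd by (auto simp: eventually_at_left_field intro!: exI[of _ "norm z"])
    ultimately have "(norm (g z))\<^sup>2 * (1 - C * (1 - 1\<^sup>2)) \<le> 1"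
      by (rule tendsto_upperbound) simp
    then show ?thesis by (simp add: power_le_one_iff)
  qed
  then show ?thesis using gh fg by (intro that)
qed

text \<open>As \<open>A\<close> is a set, the factors already removed do not vanish at the next zero
  of \<open>f\<close>, which is therefore a zero of the quotient.\<close>

lemma bounded_divide_finite_blaschke:
  assumes f: "f holomorphic_on ball 0 1" "\<And>z. norm z < 1 \<Longrightarrow> norm (f z) \<le> 1"
    and A: "finite A" "\<And>a. a \<in> A \<Longrightarrow> norm a < 1 \<and> f a = 0"
  shows "\<exists>g. g holomorphic_on ball 0 1 \<and> (\<forall>z. norm z < 1 \<longrightarrow> norm (g z) \<le> 1) \<and>
    (\<forall>z. norm z < 1 \<longrightarrow> f z = (\<Prod>a\<in>A. blaschke_factor a z) * g z)"
  using A
proof (induction A)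
  case empty
  show ?case using f by (intro exI[of _ f]) auto
next
  case (insert b A)
  then obtain g where g: "g holomorphic_on ball 0 1" "\<And>z. norm z < 1 \<Longrightarrow> norm (g z) \<le> 1"
    "\<And>z. norm z < 1 \<Longrightarrow> f z = (\<Prod>a\<in>A. blaschke_factor a z) * g z" by auto
  have b: "norm b < 1" "f b = 0" using insert.prems by auto
  have "(\<Prod>a\<in>A. blaschke_factor a b) \<noteq> 0"
    using insert b blaschke_factor_denominator(3) by (auto simp: Moebius_function_simple)
  then have "g b = 0" using g(3)[OF b(1)] b by simp
  then obtain h where h: "h holomorphic_on ball 0 1" "\<And>z. norm z < 1 \<Longrightarrow> norm (h z) \<le> 1"
    "\<And>z. norm z < 1 \<Longrightarrow> g z = blaschke_factor b z * h z"
    using bounded_divide_blaschke_factor[OF g(1,2) b(1)] by blast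
  show ?case using insert.hyps g h by (intro exI[of _ h]) (auto simp: mult_ac)
qed

text \<open>At \<open>\<Lambda> 0\<close> every finite Blaschke product over the zeros has modulus
  at least \<open>norm (f (\<Lambda> 0))\<close>, which bounds the sums of \<open>1 - norm a\<close>
  over the zeros \<open>a\<close>. Injectivity turns sums over zeros into sums over indices.\<close>

lemma blaschke_condition_of_bounded:
  fixes \<Lambda> :: "nat \<Rightarrow> complex"
  assumes f: "f holomorphic_on ball 0 1" "\<And>z. norm z < 1 \<Longrightarrow> norm (f z) \<le> 1"
    and \<Lambda>: "\<And>n. norm (\<Lambda> n) < 1" "inj \<Lambda>" "f (\<Lambda> 0) \<noteq> 0" "\<And>n. n > 0 \<Longrightarrow> f (\<Lambda> n) = 0"
  shows "summable (\<lambda>n. 1 - norm (\<Lambda> n))"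
proof -
  define z where "z = \<Lambda> 0"
  have z: "norm z < 1" "f z \<noteq> 0" using \<Lambda> by (auto simp: z_def)
  \<comment> \<open>The divisor 4 bounds \<open>norm (1 - cnj a * z) ^ 2\<close>.\<close>
  define C where "C = (1 - (norm z)\<^sup>2) / 4"
  have C: "0 < C" using z by (simp add: C_def power_less_one_iff)
  have kernel_le: "C * (1 - norm a) \<le> 1 - (norm (blaschke_factor a z))\<^sup>2" if a: "norm a < 1" for a
  proof -
    have le2: "(norm (1 - cnj a * z))\<^sup>2 \<le> 2\<^sup>2"
      using blaschke_factor_denominator(4)[OF a z(1)] by (intro power_mono) auto
    have "1 - norm a \<le> 1 - (norm a)\<^sup>2" using a by (simp add: power2_eq_square mult_left_le)
    then have "C * (1 - norm a) \<le> (1 - (norm a)\<^sup>2) * (1 - (norm z)\<^sup>2) / 2\<^sup>2"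
      using C mult_left_mono[of "1 - norm a" "1 - (norm a)\<^sup>2" C] by (simp add: C_def mult_ac)
    also have "\<dots> \<le> (1 - (norm a)\<^sup>2) * (1 - (norm z)\<^sup>2) / (norm (1 - cnj a * z))\<^sup>2"
      using le2 blaschke_factor_denominator(3)[OF a z(1)] a z(1)
      by (intro divide_left_mono mult_nonneg_nonneg mult_pos_pos) (auto simp: power_le_one)
    finally show ?thesis using one_minus_blaschke_factor_sq[OF a z(1)] by simp
  qed
  \<comment> \<open>The summand 1 accounts for index 0, which is not a zero; the factor 2 comes from
    squared moduli.\<close>
  have "(\<Sum>n<N. 1 - norm (\<Lambda> n)) \<le> 1 + - 2 * ln (norm (f z)) / C" for N
  proof -
    define A where "A = \<Lambda> ` {1..<N}"
    have A: "finite A" "\<And>a. a \<in> A \<Longrightarrow> norm a < 1 \<and> f a = 0" using \<Lambda> by (auto simp: A_def)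
    obtain g where g: "\<And>z. norm z < 1 \<Longrightarrow> norm (g z) \<le> 1"
      "\<And>z. norm z < 1 \<Longrightarrow> f z = (\<Prod>a\<in>A. blaschke_factor a z) * g z"
      using bounded_divide_finite_blaschke[OF f A] by blast
    have "norm (f z) \<le> (\<Prod>a\<in>A. norm (blaschke_factor a z))"
      using g[OF z(1)] by (simp add: norm_mult prod_norm mult_left_le)
    then have "(norm (f z))\<^sup>2 \<le> (\<Prod>a\<in>A. norm (blaschke_factor a z))\<^sup>2" by (intro power_mono) auto
    also have "\<dots> = (\<Prod>a\<in>A. (norm (blaschke_factor a z))\<^sup>2)" by (simp add: prod_power_distrib)
    also have "\<dots> \<le> (\<Prod>a\<in>A. exp (- (C * (1 - norm a))))"
    proof (rule prod_mono)
      fix a assume "a \<in> A"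
      then have "(norm (blaschke_factor a z))\<^sup>2 \<le> 1 + - (C * (1 - norm a))" using kernel_le[of a] A by simp
      also have "\<dots> \<le> exp (- (C * (1 - norm a)))" by (rule exp_ge_add_one_self)
      finally show "0 \<le> (norm (blaschke_factor a z))\<^sup>2 \<and> (norm (blaschke_factor a z))\<^sup>2 \<le> exp (- (C * (1 - norm a)))"
        by simp
    qed
    also have "\<dots> = exp (- (C * (\<Sum>a\<in>A. 1 - norm a)))"
      using A(1) by (simp add: exp_sum[symmetric] sum_negf sum_distrib_left)
    finally have "ln ((norm (f z))\<^sup>2) \<le> - (C * (\<Sum>a\<in>A. 1 - norm a))"
      using z by (metis exp_gt_zero ln_exp ln_le_cancel_iff norm_eq_zero zero_less_power2)
    then have "(\<Sum>a\<in>A. 1 - norm a) \<le> - 2 * ln (norm (f z)) / C"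
      using C z by (simp add: ln_realpow field_simps)
    moreover have "(\<Sum>a\<in>A. 1 - norm a) = (\<Sum>n\<in>{1..<N}. 1 - norm (\<Lambda> n))"
      unfolding A_def using \<Lambda>(2) by (subst sum.reindex) (auto intro: inj_on_subset)
    moreover have "(\<Sum>n<N. 1 - norm (\<Lambda> n)) \<le> 1 + (\<Sum>n\<in>{1..<N}. 1 - norm (\<Lambda> n))"
    proof (cases N)
      case (Suc M)
      have "{..<N} = insert 0 {1..<N}" using Suc by auto
      then show ?thesis by simp
    qed simp
    ultimately show ?thesis by simp
  qed
  then show ?thesis
    using \<Lambda>(1) less_imp_le by (intro summableI_nonneg_bounded) (auto simp: less_imp_le)
qed

text \<open>The unit sequences are traces. They separate the points, and the one at index 0 gives a
  numerator \<open>\<Psi>\<close> that vanishes at every point except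
  \<open>\<Lambda> 0\<close>.\<close>

theorem free_interpolating_imp_blaschke:
  fixes \<Lambda> :: "nat \<Rightarrow> complex"
  assumes fi: "free_interpolating X \<Lambda>" and disc: "\<And>n. norm (\<Lambda> n) < 1"
    and X: "X = nevanlinna_class \<or> X = smirnov_class"
  shows "summable (\<lambda>n. 1 - norm (\<Lambda> n))"
proof -
  have "(\<lambda>_. 1) \<in> X" using X one_in_smirnov by auto
  then have one: "(\<lambda>n. 1) \<in> trace_space X \<Lambda>" unfolding trace_space_def by force
  have interp: "\<exists>f\<in>nevanlinna_class. \<forall>n. f (\<Lambda> n) = (if n = m then 1 else 0)" for m
  proof -
    define a :: "nat \<Rightarrow> complex" where "a n = (if n = m then 1 else 0)" for n
    have "bounded (range a)" unfolding bounded_iff by (intro exI[of _ 1]) (auto simp: a_def)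
    then have "(\<lambda>n. a n * 1) \<in> trace_space X \<Lambda>" using fi one unfolding free_interpolating_def by fast
    then obtain f where f: "f \<in> X" "a = (\<lambda>n. f (\<Lambda> n))" by (auto simp: trace_space_def)
    have "f \<in> nevanlinna_class" using f X by (auto simp: smirnov_class_def)
    moreover have "f (\<Lambda> n) = (if n = m then 1 else 0)" for n
      using fun_cong[OF f(2), of n] by (simp add: a_def)
    ultimately show ?thesis by blast
  qed
  have inj: "inj \<Lambda>"
  proof (rule injI)
    fix m n assume "\<Lambda> m = \<Lambda> n"
    then show "m = n" using interp[of m] by (metis zero_neq_one)
  qed
  obtain f where f: "f \<in> nevanlinna_class" "\<And>n. f (\<Lambda> n) = (if n = 0 then 1 else 0)"
    using interp[of 0] by blast
  obtain \<Psi> G where \<Psi>: "\<Psi> holomorphic_on ball 0 1" "\<And>z. norm z < 1 \<Longrightarrow> norm (\<Psi> z) \<le> 1"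
    and G: "\<And>z. norm z < 1 \<Longrightarrow> G z \<noteq> 0" and eq: "\<And>z. norm z < 1 \<Longrightarrow> \<Psi> z = f z * G z"
    using nevanlinna_imp_quotient[OF f(1)] by metis
  show ?thesis
    by (rule blaschke_condition_of_bounded[OF \<Psi> disc inj]) (use f(2) G eq disc in auto)
qed

section \<open>Random sequences\<close>

text \<open>\<open>1 - u * w\<close> has positive real part for \<open>w\<close> in the closed disc,
  so its logarithm is holomorphic there and vanishes at 0.\<close>

lemma circle_mean_ln:
  assumes u: "norm u < 1"
  shows "(LINT t|circ. ln (norm (1 - u * cis t))) = 0" "integrable circ (\<lambda>t. ln (norm (1 - u * cis t)))"
proof -
  define F where "F w = Ln (1 - u * w)" for w
  have n: "norm (u * w) < 1" if "norm w \<le> 1" for w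
    using u that mult_left_mono[of "norm w" 1 "norm u"] by (simp add: norm_mult)
  have re: "0 < Re (1 - u * w)" if "norm w \<le> 1" for w
    using n[OF that] complex_Re_le_cmod[of "u * w"] by simp
  have Fh: "F holomorphic_on cball 0 1"
    unfolding F_def using re
    by (intro holomorphic_intros) (force simp: complex_nonpos_Reals_iff)
  have eq: "Re (F (of_real 1 * cis t)) = ln (norm (1 - u * cis t))" for t
  proof -
    have "1 - u * cis t \<noteq> 0"
      using re[of "cis t", OF eq_refl[OF norm_cis]] by (metis less_irrefl zero_complex.sel(1))
    then show ?thesis unfolding F_def by simp
  qed
  show "(LINT t|circ. ln (norm (1 - u * cis t))) = 0"
    using Re_holomorphic_circle_mean[OF Fh] unfolding eq by (simp add: F_def)
  show "integrable circ (\<lambda>t. ln (norm (1 - u * cis t)))"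
    using integrable_Re[OF integrable_circ_holomorphic[OF Fh]] unfolding eq by simp
qed

text \<open>Coinciding points need the explicit value \<infinity>, since \<open>ln 0 = 0\<close>
  would give 0. Finiteness of a sum of these terms then forces the points to be distinct.\<close>

definition pseudo_log :: "complex \<Rightarrow> complex \<Rightarrow> ennreal" where
  "pseudo_log w z = (if w = z then \<infinity> else ennreal (- ln (norm (blaschke_factor w z))))"

lemma measurable_pseudo_log [measurable]:
  assumes [measurable]: "f \<in> borel_measurable M" "g \<in> borel_measurable M"
  shows "(\<lambda>x. pseudo_log (f x) (g x)) \<in> borel_measurable M"
proof -
  have [measurable]: "cnj \<in> borel_measurable borel"
    by (intro borel_measurable_continuous_onI continuous_intros)
  show ?thesis unfolding pseudo_log_def Moebius_function_simple by measurable
qed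

lemma measurable_cis [measurable]: "cis \<in> borel_measurable borel"
  by (intro borel_measurable_continuous_onI) (auto intro!: continuous_intros)

text \<open>Taking the larger of the two moduli out of \<open>norm (z - of_real r * cis t)\<close>
  leaves \<open>norm (1 - u * cis t)\<close> with \<open>norm u < 1\<close>. The logarithms of this
  and of the denominator of the Blaschke factor have mean 0, so only the larger modulus
  remains.\<close>

lemma circ_pseudo_log_distinct:
  assumes z: "norm z < 1" and r: "0 \<le> r" "r < 1" "r \<noteq> norm z"
  shows "(\<integral>\<^sup>+t. pseudo_log (of_real r * cis t) z \<partial>circ) \<le> ennreal (- 2 * pi * ln (max r (norm z)))"
proof -
  have z1: "norm (cnj z * of_real r) < 1"
    using z r mult_mono[of "norm z" 1 r r] mult_strict_mono[of "norm z" 1 r 1] by (cases "r = 0") (auto simp: norm_mult)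
  obtain u where u: "norm u < 1" "\<And>t. norm (z - of_real r * cis t) = max r (norm z) * norm (1 - u * cis t)"
  proof (cases "r < norm z")
    case True
    have "norm (z - of_real r * cis t) = max r (norm z) * norm (1 - (of_real r / z) * cis t)" for t
    proof -
      have "z - of_real r * cis t = z * (1 - (of_real r / z) * cis t)" using True r by (auto simp: field_simps)
      then show ?thesis using True by (simp add: norm_mult)
    qed
    moreover have "norm (of_real r / z) < 1" using True r by (auto simp: norm_divide divide_less_eq)
    ultimately show ?thesis by (rule that[rotated])
  next
    case False
    then have rz: "norm z < r" using r by simp
    have r0: "0 < r" using rz norm_ge_zero[of z] by linarith
    \<comment> \<open>Up to sign, taking out \<open>of_real r * cis t\<close> leaves
      \<open>1 - (z / of_real r) * cnj (cis t)\<close>, whose conjugate has the required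
      form.\<close>
    have "norm (z - of_real r * cis t) = max r (norm z) * norm (1 - (cnj z / of_real r) * cis t)" for t
    proof -
      have "cis t * cnj (cis t) = 1" by (simp add: cis_cnj cis_mult)
      then have "z - of_real r * cis t = - (of_real r * cis t * cnj (1 - (cnj z / of_real r) * cis t))"
        using r0 by (simp add: field_simps)
      then have "norm (z - of_real r * cis t) = norm (of_real r * cis t * cnj (1 - (cnj z / of_real r) * cis t))"
        by (simp only: norm_minus_cancel)
      also have "\<dots> = max r (norm z) * norm (1 - (cnj z / of_real r) * cis t)"
        unfolding norm_mult complex_mod_cnj using rz r by simp
      finally show ?thesis .
    qed
    moreover have "norm (cnj z / of_real r) < 1" using rz r0 by (simp add: norm_divide)
    ultimately show ?thesis by (rule that[rotated])
  qed
  define v where "v = cnj z * of_real r"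
  have mx: "0 < max r (norm z)" unfolding less_max_iff_disj using r norm_ge_zero[of z] by linarith
  have ne: "1 - u * cis t \<noteq> 0" "1 - v * cis t \<noteq> 0" for t
  proof -
    have "norm (u * cis t) \<noteq> 1" "norm (v * cis t) \<noteq> 1" using u(1) z1 by (simp_all add: norm_mult v_def)
    then show "1 - u * cis t \<noteq> 0" "1 - v * cis t \<noteq> 0" by (metis eq_iff_diff_eq_0 norm_one)+
  qed
  have eq: "pseudo_log (of_real r * cis t) z = ennreal (ln (norm (1 - v * cis t)) - ln (max r (norm z)) - ln (norm (1 - u * cis t)))" for t
  proof -
    have "norm (z - of_real r * cis t) \<noteq> 0" unfolding u(2) using mx ne(1)[of t] by simp
    then have "of_real r * cis t \<noteq> z" by auto
    moreover have "norm (1 - cnj (of_real r * cis t) * z) = norm (1 - v * cis t)"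
    proof -
      have "1 - cnj (of_real r * cis t) * z = cnj (1 - v * cis t)" by (simp add: v_def mult_ac)
      then show ?thesis by (simp only: complex_mod_cnj)
    qed
    ultimately show ?thesis
      using mx ne[of t] unfolding pseudo_log_def Moebius_function_simple norm_divide u(2)
      by (simp add: ln_div ln_mult diff_diff_eq)
  qed
  have int: "integrable circ (\<lambda>t. ln (norm (1 - v * cis t)) - ln (max r (norm z)) - ln (norm (1 - u * cis t)))"
    using circle_mean_ln(2)[OF u(1)] circle_mean_ln(2)[of v] z1
    by (intro Bochner_Integration.integrable_diff finite_measure.integrable_const finite_measure_circ) (auto simp: v_def)
  have "0 \<le> ln (norm (1 - v * cis t)) - ln (max r (norm z)) - ln (norm (1 - u * cis t))" for t
  proof -
    have rc: "norm (of_real r * cis t) < 1" using r by (simp add: norm_mult)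
    have "norm (1 - v * cis t) = norm (1 - cnj (of_real r * cis t) * z)"
    proof -
      have "1 - cnj (of_real r * cis t) * z = cnj (1 - v * cis t)" by (simp add: v_def mult_ac)
      then show ?thesis by (simp only: complex_mod_cnj)
    qed
    then have "norm (z - of_real r * cis t) \<le> norm (1 - v * cis t)"
      using blaschke_factor_le_1[OF rc z] blaschke_factor_denominator(3)[OF rc z]
      by (simp add: Moebius_function_simple norm_divide divide_le_eq)
    then have "max r (norm z) * norm (1 - u * cis t) \<le> norm (1 - v * cis t)" by (simp only: u(2))
    then have "ln (max r (norm z) * norm (1 - u * cis t)) \<le> ln (norm (1 - v * cis t))"
      using mx ne[of t] by (subst ln_le_cancel_iff) auto
    then show ?thesis using mx ne(1)[of t] by (subst (asm) ln_mult) auto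
  qed
  then have "(\<integral>\<^sup>+t. pseudo_log (of_real r * cis t) z \<partial>circ) =
     ennreal (LINT t|circ. ln (norm (1 - v * cis t)) - ln (max r (norm z)) - ln (norm (1 - u * cis t)))"
    unfolding eq by (intro nn_integral_eq_integral int) auto
  also have "(LINT t|circ. ln (norm (1 - v * cis t)) - ln (max r (norm z)) - ln (norm (1 - u * cis t)))
      = - (2 * pi * ln (max r (norm z)))"
  proof -
    have v1: "norm v < 1" using z1 by (simp add: v_def)
    have c: "integrable circ (\<lambda>t. ln (max r (norm z)))"
      by (intro finite_measure.integrable_const finite_measure_circ)
    show ?thesis
      using Bochner_Integration.integral_diff[OF Bochner_Integration.integrable_diff[OF circle_mean_ln(2)[OF v1] c] circle_mean_ln(2)[OF u(1)]]
        Bochner_Integration.integral_diff[OF circle_mean_ln(2)[OF v1] c]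
      unfolding circle_mean_ln(1)[OF v1] circle_mean_ln(1)[OF u(1)] integral_circ_const by simp
  qed
  finally show ?thesis by simp
qed

text \<open>On the closed interval \<open>cis\<close> repeats a value only at the endpoints, so at
  most three parameters are excluded.\<close>

lemma AE_circle_avoids_point:
  assumes "0 < r"
  shows "AE t in circ. of_real r * cis t \<noteq> z"
proof -
  have "finite {t \<in> {0..2*pi}. of_real r * cis t = z}"
  proof (cases "\<exists>s\<in>{0..2*pi}. of_real r * cis s = z")
    case True
    then obtain s where s: "s \<in> {0..2*pi}" "of_real r * cis s = z" by blast
    have "t \<in> {s, 0, 2 * pi}" if t: "t \<in> {0..2*pi}" "of_real r * cis t = z" for t
    proof (cases "t \<in> {0, 2 * pi}")
      case False
      then have t': "0 < t" "t < 2 * pi" using t by auto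
      have "cis s = cis t" using s t assms by auto
      then have "\<not> \<bar>s - t\<bar> > 0"
        using cis_distance_pos[OF t', of "\<bar>s - t\<bar>"] s(1) by force
      then show ?thesis by simp
    qed auto
    then have "{t \<in> {0..2*pi}. of_real r * cis t = z} \<subseteq> {s, 0, 2 * pi}" by blast
    then show ?thesis by (rule finite_subset) simp
  next
    case False
    then have "{t \<in> {0..2*pi}. of_real r * cis t = z} = {}" by auto
    then show ?thesis by (simp only: finite.emptyI)
  qed
  then have "negligible {t \<in> {0..2*pi}. of_real r * cis t = z}" by (rule negligible_finite)
  then have "AE t in lebesgue. t \<notin> {t \<in> {0..2*pi}. of_real r * cis t = z}"
    using AE_not_in negligible_iff_null_sets by blast
  then have "AE t in lebesgue. t \<in> {0..2*pi} \<longrightarrow> of_real r * cis t \<noteq> z" by eventually_elim auto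
  then show ?thesis by (subst AE_restrict_space_iff) auto
qed

lemma circ_borel_measurable: "f \<in> borel_measurable borel \<Longrightarrow> f \<in> borel_measurable circ"
  by (intro measurable_restrict_space1 measurable_completion) simp

text \<open>For \<open>r = norm z\<close> the integrand has a logarithmic singularity; approximate by smaller radii.\<close>

lemma circ_pseudo_log_le:
  assumes z: "norm z < 1" and r: "0 \<le> r" "r < 1" "0 < max r (norm z)"
  shows "(\<integral>\<^sup>+t. pseudo_log (of_real r * cis t) z \<partial>circ) \<le> ennreal (- 2 * pi * ln (max r (norm z)))"
proof (cases "r = norm z")
  case True
  then have r0: "0 < r" using r by simp
  define s where "s k = r * radial k" for k
  have s: "0 \<le> s k" "s k < r" for k
    using r0 radial_bounds[of k] mult_strict_left_mono[of "radial k" 1 r] by (auto simp: s_def)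
  then have s1: "s k < 1" for k using r(2) less_trans by blast
  have "(\<integral>\<^sup>+t. pseudo_log (of_real r * cis t) z \<partial>circ) =
    (\<integral>\<^sup>+t. liminf (\<lambda>k. pseudo_log (of_real (s k) * cis t) z) \<partial>circ)"
  proof (rule nn_integral_cong_AE)
    show "AE t in circ. pseudo_log (of_real r * cis t) z = liminf (\<lambda>k. pseudo_log (of_real (s k) * cis t) z)"
      using AE_circle_avoids_point[OF r0, of z]
    proof eventually_elim
      case (elim t)
      define w where "w = of_real r * cis t"
      have w: "norm w < 1" using r by (simp add: w_def norm_mult)
      have "s \<longlonglongrightarrow> r * 1" unfolding s_def using filterlim_radial
        by (intro tendsto_intros) (auto simp: filterlim_at)
      then have lim: "(\<lambda>k. of_real (s k) * cis t) \<longlonglongrightarrow> w"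
        unfolding w_def by (intro tendsto_intros) simp
      have nz: "1 - cnj w * z \<noteq> 0" "z - w \<noteq> 0"
        using blaschke_factor_denominator(3)[OF w z] elim by (auto simp: w_def)
      have "(\<lambda>k. ennreal (- ln (norm (blaschke_factor (of_real (s k) * cis t) z)))) \<longlonglongrightarrow>
          ennreal (- ln (norm (blaschke_factor w z)))"
        unfolding Moebius_function_simple
        by (intro tendsto_ennrealI tendsto_intros lim) (use nz in auto)
      moreover have "pseudo_log (of_real (s k) * cis t) z = ennreal (- ln (norm (blaschke_factor (of_real (s k) * cis t) z)))" for k
      proof -
        have "norm (of_real (s k) * cis t) \<noteq> norm z" using s[of k] True by (simp add: norm_mult)
        then show ?thesis by (auto simp: pseudo_log_def)
      qed
      moreover have "pseudo_log w z = ennreal (- ln (norm (blaschke_factor w z)))"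
        using nz by (auto simp: pseudo_log_def)
      ultimately have "(\<lambda>k. pseudo_log (of_real (s k) * cis t) z) \<longlonglongrightarrow> pseudo_log w z" by simp
      then show ?case unfolding w_def by (intro lim_imp_Liminf[symmetric]) auto
    qed
  qed
  also have "\<dots> \<le> liminf (\<lambda>k. \<integral>\<^sup>+t. pseudo_log (of_real (s k) * cis t) z \<partial>circ)"
    by (intro nn_integral_liminf circ_borel_measurable) measurable
  also have "\<dots> \<le> liminf (\<lambda>k. ennreal (- 2 * pi * ln (max r (norm z))))"
  proof (rule Liminf_mono, rule always_eventually, rule allI)
    fix k
    \<comment> \<open>The maximum is \<open>norm z = r\<close> for every \<open>k\<close>, so the
      bound is constant along the approximation.\<close>
    have "max (s k) (norm z) = max r (norm z)" using s[of k] True by simp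
    then show "(\<integral>\<^sup>+t. pseudo_log (of_real (s k) * cis t) z \<partial>circ) \<le> ennreal (- 2 * pi * ln (max r (norm z)))"
      using circ_pseudo_log_distinct[OF z s(1) s1, of k] s[of k] True by simp
  qed
  finally show ?thesis by (simp add: Liminf_const)
qed (use circ_pseudo_log_distinct[OF z r(1,2)] in simp)

section \<open>Expectations over independent angles\<close>

lemma uniform_integral_le_circ:
  fixes f :: "real \<Rightarrow> ennreal"
  assumes f: "f \<in> borel_measurable borel"
  shows "(\<integral>\<^sup>+t. f t \<partial>uniform_measure lborel {0..<2*pi}) \<le> (\<integral>\<^sup>+t. f t \<partial>circ) / ennreal (2 * pi)"
proof -
  have "(\<integral>\<^sup>+t. f t \<partial>uniform_measure lborel {0..<2*pi}) = (\<integral>\<^sup>+t. f t * indicator {0..<2*pi} t \<partial>lborel) / ennreal (2 * pi)"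
    using f by (subst nn_integral_uniform_measure) auto
  also have "(\<integral>\<^sup>+t. f t * indicator {0..<2*pi} t \<partial>lborel) \<le> (\<integral>\<^sup>+t. f t * indicator {0..2*pi} t \<partial>lborel)"
    by (intro nn_integral_mono mult_left_mono) (auto simp: indicator_def)
  also have "\<dots> = (\<integral>\<^sup>+t. f t \<partial>circ)"
    by (subst nn_integral_restrict_space) (auto simp: nn_integral_completion)
  finally show ?thesis by (simp add: divide_right_mono_ennreal)
qed

lemma (in prob_space) indep_vars_imp_indep_var:
  assumes ind: "indep_vars (\<lambda>_. N) X I" and i: "i \<in> I" "j \<in> I" "i \<noteq> j"
  shows "indep_var N (X i) N (X j)"
  unfolding indep_var_eq
proof (intro conjI)
  let ?F = "\<lambda>i. sigma_sets (space M) {X i -` A \<inter> space M | A. A \<in> sets N}"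
  show rv: "random_variable N (X i)" "random_variable N (X j)"
    using ind i by (auto simp: indep_vars_def)
  have F: "indep_sets ?F I" using ind by (simp add: indep_vars_def)
  then have ev: "?F i \<subseteq> events" "?F j \<subseteq> events" using i by (auto simp: indep_sets_def)
  have "prob (a \<inter> b) = prob a * prob b" if "a \<in> ?F i" "b \<in> ?F j" for a b
    using indep_setsD[OF F, of "{i, j}" "\<lambda>k. if k = i then a else b"] that i by (auto simp: Int_commute)
  then show "indep_set (?F i) (?F j)" using ev unfolding indep_sets2_eq by blast
qed

text \<open>Independence gives a product law. With \<open>\<theta> n\<close> held fixed, averaging
  over \<open>\<theta> k\<close> alone already gives a bound by the moduli.\<close>

lemma (in prob_space) expected_pseudo_log_le:
  fixes \<theta> :: "nat \<Rightarrow> 'a \<Rightarrow> real"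
  assumes ind: "indep_vars (\<lambda>_. borel) \<theta> UNIV"
    and dist: "\<And>n. distr M borel (\<theta> n) = uniform_measure lborel {0..<2*pi}"
    and r: "\<And>n. 0 \<le> r n \<and> r n < 1" and nk: "n \<noteq> k" and pos: "0 < max (r k) (r n)"
  shows "(\<integral>\<^sup>+\<omega>. pseudo_log (of_real (r k) * cis (\<theta> k \<omega>)) (of_real (r n) * cis (\<theta> n \<omega>)) \<partial>M)
    \<le> ennreal (- ln (max (r k) (r n)))"
proof -
  have iv: "indep_var borel (\<theta> n) borel (\<theta> k)"
    by (rule indep_vars_imp_indep_var[OF ind _ _ nk]) auto
  then have [measurable]: "random_variable borel (\<theta> n)" "random_variable borel (\<theta> k)"
    and eq: "distr M borel (\<theta> n) \<Otimes>\<^sub>M distr M borel (\<theta> k) = distr M (borel \<Otimes>\<^sub>M borel) (\<lambda>x. (\<theta> n x, \<theta> k x))"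
    unfolding indep_var_distribution_eq by auto
  define f where "f = (\<lambda>(s, t). pseudo_log (of_real (r k) * cis t) (of_real (r n) * cis s))"
  have [measurable]: "f \<in> borel_measurable (borel \<Otimes>\<^sub>M borel)" unfolding f_def by measurable
  let ?U = "uniform_measure lborel {0..<2*pi}"
  have pU: "prob_space ?U" using dist[of 0] prob_space_distr[of "\<theta> n" borel] dist[of n] by simp
  interpret U: prob_space ?U by (rule pU)
  have "(\<integral>\<^sup>+\<omega>. pseudo_log (of_real (r k) * cis (\<theta> k \<omega>)) (of_real (r n) * cis (\<theta> n \<omega>)) \<partial>M) =
     (\<integral>\<^sup>+x. f x \<partial>distr M (borel \<Otimes>\<^sub>M borel) (\<lambda>x. (\<theta> n x, \<theta> k x)))"
    by (subst nn_integral_distr) (auto simp: f_def)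
  also have "\<dots> = (\<integral>\<^sup>+x. f x \<partial>(?U \<Otimes>\<^sub>M ?U))" by (simp add: eq[symmetric] dist)
  also have "\<dots> = (\<integral>\<^sup>+s. \<integral>\<^sup>+t. f (s, t) \<partial>?U \<partial>?U)"
    by (subst U.nn_integral_fst) (auto cong: measurable_cong_sets intro: sets_pair_measure_cong)
  also have "\<dots> \<le> (\<integral>\<^sup>+s. ennreal (- ln (max (r k) (r n))) \<partial>?U)"
  proof (rule nn_integral_mono)
    fix s
    define z where "z = of_real (r n) * cis s"
    have z: "norm z = r n" using r[of n] by (simp add: z_def norm_mult)
    have "(\<integral>\<^sup>+t. f (s, t) \<partial>?U) \<le> (\<integral>\<^sup>+t. f (s, t) \<partial>circ) / ennreal (2 * pi)"
      by (rule uniform_integral_le_circ) (simp add: f_def)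
    also have "(\<integral>\<^sup>+t. f (s, t) \<partial>circ) = (\<integral>\<^sup>+t. pseudo_log (of_real (r k) * cis t) z \<partial>circ)"
      by (simp add: f_def z_def)
    also have "\<dots> \<le> ennreal (- 2 * pi * ln (max (r k) (norm z)))"
      using r[of k] r[of n] pos by (intro circ_pseudo_log_le) (auto simp: z)
    finally have "(\<integral>\<^sup>+t. f (s, t) \<partial>?U) \<le> ennreal (- 2 * pi * ln (max (r k) (r n))) / ennreal (2 * pi)"
      by (simp add: z divide_right_mono_ennreal)
    also have "\<dots> = ennreal (- ln (max (r k) (r n)))"
    proof -
      have "ln (max (r k) (r n)) \<le> 0" using r[of k] r[of n] pos by (subst ln_le_zero_iff) auto
      then show ?thesis by (subst divide_ennreal) (auto simp: mult_le_0_iff)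
    qed
    finally show "(\<integral>\<^sup>+t. f (s, t) \<partial>?U) \<le> ennreal (- ln (max (r k) (r n)))" .
  qed
  also have "\<dots> = ennreal (- ln (max (r k) (r n)))" by (simp add: U.emeasure_space_1)
  finally show ?thesis .
qed

text \<open>All but finitely many radii exceed 1/2, and the remaining positive ones have a minimum.
  Of two distinct indices at most one has radius 0, so the larger radius is bounded below.\<close>

lemma radii_bounded_below:
  fixes r :: "nat \<Rightarrow> real"
  assumes r: "\<And>n. 0 \<le> r n \<and> r n < 1" and one: "\<And>m n. r m = 0 \<Longrightarrow> r n = 0 \<Longrightarrow> m = n"
    and s: "summable (\<lambda>n. 1 - r n)"
  shows "\<exists>m>0. \<forall>n k. n \<noteq> k \<longrightarrow> m \<le> max (r k) (r n)"
proof -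
  have "(\<lambda>n. 1 - r n) \<longlonglongrightarrow> 0" by (rule summable_LIMSEQ_zero[OF s])
  then have "\<forall>\<^sub>F n in sequentially. 1 - r n < 1/2" by (rule order_tendstoD) simp
  then obtain N where N: "\<And>n. N \<le> n \<Longrightarrow> 1 - r n < 1/2" by (auto simp: eventually_sequentially)
  define S where "S = insert (1/2) (r ` {n. n < N \<and> r n > 0})"
  define m where "m = Min S"
  have S: "finite S" "S \<noteq> {}" "\<And>x. x \<in> S \<Longrightarrow> 0 < x" by (auto simp: S_def)
  have m0: "0 < m" unfolding m_def using S Min_in by blast
  have le: "m \<le> r n" if "0 < r n" for n
  proof (cases "n < N")
    case True
    then have "r n \<in> S" using that by (simp add: S_def)
    then show ?thesis unfolding m_def using S(1) by (rule Min_le[rotated])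
  next
    case False
    have "m \<le> 1/2" unfolding m_def using S(1) by (intro Min_le) (auto simp: S_def)
    then show ?thesis using N[of n] False by simp
  qed
  have "m \<le> max (r k) (r n)" if "n \<noteq> k" for n k
  proof (cases "0 < r k")
    case True then show ?thesis using le[of k] by simp
  next
    case False
    then have "r k = 0" using r[of k] by simp
    then have "0 < r n" using one[of n k] that r[of n] by force
    then show ?thesis using le[of n] by simp
  qed
  then show ?thesis using m0 by blast
qed

lemma (in prob_space) AE_total_pseudo_log_finite:
  assumes ind: "indep_vars (\<lambda>_. borel) \<theta> UNIV"
    and dist: "\<And>n. distr M borel (\<theta> n) = uniform_measure lborel {0..<2*pi}"
    and r: "\<And>n. 0 \<le> r n \<and> r n < 1" and one: "\<And>m n. r m = 0 \<Longrightarrow> r n = 0 \<Longrightarrow> m = n"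
    and s: "summable (\<lambda>n. 1 - r n)"
  shows "AE \<omega> in M. (\<Sum>n. ennreal (1 - (r n)\<^sup>2) * (\<Sum>k. if k = n then 0 else
      pseudo_log (random_sequence r \<theta> \<omega> k) (random_sequence r \<theta> \<omega> n))) \<noteq> \<infinity>"
proof (rule nn_integral_PInf_AE)
  let ?P = "\<lambda>\<omega> n k. if k = n then 0 else
      pseudo_log (random_sequence r \<theta> \<omega> k) (random_sequence r \<theta> \<omega> n)"
  have [measurable]: "\<theta> n \<in> borel_measurable M" for n
    using ind by (auto simp: indep_vars_def)
  have [measurable]: "(\<lambda>\<omega>. random_sequence r \<theta> \<omega> n) \<in> borel_measurable M" for n
    unfolding random_sequence_def by measurable
  have [measurable]: "(\<lambda>\<omega>. ?P \<omega> n k) \<in> borel_measurable M" for n k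
    by (cases "k = n") simp_all
  show "(\<lambda>\<omega>. \<Sum>n. ennreal (1 - (r n)\<^sup>2) * (\<Sum>k. ?P \<omega> n k)) \<in> borel_measurable M"
    by measurable
  obtain m where m: "0 < m" "\<And>n k. n \<noteq> k \<Longrightarrow> m \<le> max (r k) (r n)"
    using radii_bounded_below[OF r one s] by blast
  define T where "T = (\<Sum>k. (1 - r k) / m)"
  have sT: "summable (\<lambda>k. (1 - r k) / m)" by (rule summable_divide[OF s])
  have T0: "0 \<le> T" unfolding T_def using r m less_imp_le by (intro suminf_nonneg sT) (auto simp: less_imp_le)
  have Ek: "(\<integral>\<^sup>+\<omega>. ?P \<omega> n k \<partial>M)
     \<le> ennreal ((1 - r k) / m)" for n k
  proof (cases "k = n")
    case False
    define x where "x = max (r k) (r n)"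
    have x: "m \<le> x" "r k \<le> x" "0 < x" "x < 1" using m(1) m(2)[of n k] False r[of n] r[of k] by (auto simp: x_def)
    \<comment> \<open>The resulting bound \<open>(1 - r k) / m\<close> does not involve
      \<open>n\<close>: every inner sum has expectation at most \<open>T\<close>, and the outer
      weights are summable.\<close>
    have "- ln x = ln (1 / x)" using x by (simp add: ln_div)
    also have "\<dots> \<le> 1 / x - 1" using x by (intro ln_le_minus_one) auto
    also have "\<dots> = (1 - x) / x" using x by (simp add: field_simps)
    also have "\<dots> \<le> (1 - r k) / m" using x m by (intro frac_le) auto
    finally have "- ln x \<le> (1 - r k) / m" .
    moreover have "(\<integral>\<^sup>+\<omega>. pseudo_log (random_sequence r \<theta> \<omega> k) (random_sequence r \<theta> \<omega> n) \<partial>M) \<le> ennreal (- ln x)"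
      unfolding random_sequence_def x_def using x False
      by (intro expected_pseudo_log_le[OF ind dist r]) (auto simp: x_def)
    ultimately show ?thesis using False by (simp add: order_trans[OF _ ennreal_leI])
  qed simp
  have "(\<integral>\<^sup>+\<omega>. (\<Sum>n. ennreal (1 - (r n)\<^sup>2) * (\<Sum>k. ?P \<omega> n k)) \<partial>M)
    = (\<Sum>n. ennreal (1 - (r n)\<^sup>2) * (\<Sum>k. \<integral>\<^sup>+\<omega>. ?P \<omega> n k \<partial>M))"
    by (simp add: nn_integral_suminf nn_integral_cmult)
  also have "\<dots> \<le> (\<Sum>n. ennreal (2 * (1 - r n)) * ennreal T)"
  proof (intro suminf_le mult_mono)
    fix n
    have "1 - (r n)\<^sup>2 = (1 - r n) * (1 + r n)" by (simp add: power2_eq_square algebra_simps)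
    also have "\<dots> \<le> (1 - r n) * 2" using r[of n] by (intro mult_left_mono) auto
    finally show "ennreal (1 - (r n)\<^sup>2) \<le> ennreal (2 * (1 - r n))" by (intro ennreal_leI) simp
    have "(\<Sum>k. \<integral>\<^sup>+\<omega>. ?P \<omega> n k \<partial>M)
        \<le> (\<Sum>k. ennreal ((1 - r k) / m))" by (intro suminf_le Ek) auto
    also have "\<dots> = ennreal T" unfolding T_def using r m by (intro suminf_ennreal2 sT) (auto simp: less_imp_le)
    finally show "(\<Sum>k. \<integral>\<^sup>+\<omega>. ?P \<omega> n k \<partial>M)
        \<le> ennreal T" .
  qed auto
  also have "\<dots> = (\<Sum>n. ennreal (2 * (1 - r n) * T))"
    using r T0 by (simp add: ennreal_mult less_imp_le)
  also have "\<dots> = ennreal (\<Sum>n. 2 * (1 - r n) * T)"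
    using r T0 by (intro suminf_ennreal2 summable_mult2 summable_mult s) (auto simp: less_imp_le)
  also have "\<dots> < \<infinity>" by simp
  finally show "(\<integral>\<^sup>+\<omega>. (\<Sum>n. ennreal (1 - (r n)\<^sup>2) * (\<Sum>k. ?P \<omega> n k)) \<partial>M) \<noteq> \<infinity>" by simp
qed

text \<open>From here on the outcome is fixed. The weights are positive, so each inner sum is
  finite; this makes the points distinct, and exponentiating partial sums bounds the finite Blaschke
  products from below.\<close>

lemma free_interpolating_of_pseudo_log:
  fixes \<Lambda> :: "nat \<Rightarrow> complex"
  assumes disc: "\<And>n. norm (\<Lambda> n) < 1" and s: "summable (\<lambda>n. 1 - norm (\<Lambda> n))"
    and fin: "(\<Sum>n. ennreal (1 - (norm (\<Lambda> n))\<^sup>2) * (\<Sum>k. if k = n then 0 else pseudo_log (\<Lambda> k) (\<Lambda> n))) \<noteq> \<infinity>"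
    and X: "X = nevanlinna_class \<or> X = smirnov_class"
  shows "free_interpolating X \<Lambda>"
proof -
  define w where "w n = 1 - (norm (\<Lambda> n))\<^sup>2" for n
  define C where "C n = (\<Sum>k. if k = n then 0 else pseudo_log (\<Lambda> k) (\<Lambda> n))" for n
  define c where "c n = enn2real (C n)" for n
  have w0: "0 < w n" for n using disc[of n] by (simp add: w_def power_less_one_iff)
  have fin': "(\<Sum>n. ennreal (w n) * C n) \<noteq> \<infinity>" using fin by (simp add: w_def C_def)
  have Cfin: "C n < \<infinity>" for n
  proof (rule ccontr)
    assume "\<not> C n < \<infinity>"
    then have "C n = \<infinity>" by (metis infinity_ennreal_def less_top)
    then have "ennreal (w n) * C n = \<infinity>" using w0[of n] by (simp add: ennreal_mult_eq_top_iff)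
    moreover have "ennreal (w n) * C n \<le> (\<Sum>n. ennreal (w n) * C n)"
      using sum_le_suminf[of "\<lambda>n. ennreal (w n) * C n" "{n}"] by simp
    ultimately show False using fin' by (simp add: top_unique)
  qed
  have Cc: "C n = ennreal (c n)" for n using Cfin[of n] by (simp add: c_def)
  have c0: "0 \<le> c n" for n by (simp add: c_def)
  have sw: "summable w"
  proof (rule summable_comparison_test'[OF summable_mult[OF s, of 2], of 0])
    fix n
    have "w n = (1 - norm (\<Lambda> n)) * (1 + norm (\<Lambda> n))" by (simp add: w_def power2_eq_square algebra_simps)
    also have "\<dots> \<le> (1 - norm (\<Lambda> n)) * 2" using disc[of n] by (intro mult_left_mono) auto
    finally show "norm (w n) \<le> 2 * (1 - norm (\<Lambda> n))" using w0[of n] by simp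
  qed
  have sc: "summable (\<lambda>n. c n * w n)"
  proof (rule summable_suminf_not_top)
    show "0 \<le> c n * w n" for n using c0[of n] w0[of n] by simp
    have "ennreal (c n * w n) = ennreal (w n) * C n" for n
      unfolding Cc using c0[of n] w0[of n] by (simp add: ennreal_mult mult.commute less_imp_le)
    then show "(\<Sum>n. ennreal (c n * w n)) \<noteq> top" using fin' by simp
  qed
  have sep: "exp (- c n) \<le> (\<Prod>k\<in>{..<N} - {n}. norm (blaschke_factor (\<Lambda> k) (\<Lambda> n)))" for n N
  proof -
    define A where "A = {..<N} - {n}"
    define \<rho> where "\<rho> k = norm (blaschke_factor (\<Lambda> k) (\<Lambda> n))" for k
    have term_le: "pseudo_log (\<Lambda> k) (\<Lambda> n) \<le> C n" if "k \<noteq> n" for k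
      using sum_le_suminf[of "\<lambda>k. if k = n then 0 else pseudo_log (\<Lambda> k) (\<Lambda> n)" "{k}"] that by (simp add: C_def)
    have ne: "\<Lambda> k \<noteq> \<Lambda> n" if "k \<noteq> n" for k
      using term_le[OF that] Cfin[of n] by (auto simp: pseudo_log_def top_unique)
    have \<rho>: "0 < \<rho> k" "\<rho> k \<le> 1" if "k \<in> A" for k
      using ne[of k] that blaschke_factor_le_1[OF disc disc, of k n]
        blaschke_factor_denominator(3)[OF disc disc, of k n]
      by (auto simp: \<rho>_def A_def Moebius_function_simple)
    have "ennreal (\<Sum>k\<in>A. - ln (\<rho> k)) = (\<Sum>k\<in>A. ennreal (- ln (\<rho> k)))"
      using \<rho> by (intro sum_ennreal[symmetric]) simp
    also have "\<dots> = (\<Sum>k\<in>A. if k = n then 0 else pseudo_log (\<Lambda> k) (\<Lambda> n))"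
      using ne by (intro sum.cong) (auto simp: A_def pseudo_log_def \<rho>_def)
    also have "\<dots> \<le> C n" unfolding C_def by (intro sum_le_suminf) (auto simp: A_def)
    finally have "(\<Sum>k\<in>A. - ln (\<rho> k)) \<le> c n" using c0[of n] by (simp add: Cc)
    then have "exp (- c n) \<le> exp (\<Sum>k\<in>A. ln (\<rho> k))" by (simp add: sum_negf)
    also have "\<dots> = (\<Prod>k\<in>A. \<rho> k)" using \<rho> by (subst exp_sum) (auto simp: A_def)
    finally show ?thesis by (simp add: A_def \<rho>_def)
  qed
  show ?thesis
    by (rule free_interpolating_sufficient[where c=c, OF disc c0 sw[unfolded w_def[abs_def]] sc[unfolded w_def] sep X])
qed

theorem theorem1p2:
  fixes M :: "'w measure"
    and r :: "nat \<Rightarrow> real"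
    and \<theta> :: "nat \<Rightarrow> 'w \<Rightarrow> real"
    and X :: "(complex \<Rightarrow> complex) set"
  assumes "prob_space M"
    and "\<And>n. 0 \<le> r n \<and> r n < 1"
    and "\<And>m n. r m = 0 \<Longrightarrow> r n = 0 \<Longrightarrow> m = n"
    and "prob_space.indep_vars M (\<lambda>_. borel) \<theta> UNIV"
    and "\<And>n. distr M borel (\<theta> n) = uniform_measure lborel {0..<2*pi}"
    and "X = nevanlinna_class \<or> X = smirnov_class"
  shows "(AE \<omega> in M. free_interpolating X (random_sequence r \<theta> \<omega>)) \<longleftrightarrow>
         summable (\<lambda>n. 1 - r n)"
proof
  interpret prob_space M by fact
  have norm_eq: "norm (random_sequence r \<theta> \<omega> n) = r n" for \<omega> n
    using assms(2)[of n] by (simp add: random_sequence_def norm_mult)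
  show "summable (\<lambda>n. 1 - r n)" if ae: "AE \<omega> in M. free_interpolating X (random_sequence r \<theta> \<omega>)"
  proof -
    \<comment> \<open>The statement does not involve \<open>\<omega>\<close>, and on a probability
      space a fixed statement that holds almost surely holds.\<close>
    have "AE \<omega> in M. summable (\<lambda>n. 1 - r n)"
      using ae
    proof eventually_elim
      case (elim \<omega>)
      have "summable (\<lambda>n. 1 - norm (random_sequence r \<theta> \<omega> n))"
        using elim assms(2,6) by (intro free_interpolating_imp_blaschke) (auto simp: norm_eq)
      then show ?case by (simp add: norm_eq)
    qed
    then show ?thesis by simp
  qed
  show "AE \<omega> in M. free_interpolating X (random_sequence r \<theta> \<omega>)" if s: "summable (\<lambda>n. 1 - r n)"
  proof -
    have "AE \<omega> in M. (\<Sum>n. ennreal (1 - (r n)\<^sup>2) * (\<Sum>k. if k = n then 0 else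
      pseudo_log (random_sequence r \<theta> \<omega> k) (random_sequence r \<theta> \<omega> n))) \<noteq> \<infinity>"
      by (rule AE_total_pseudo_log_finite[OF assms(4,5,2,3) s])
    then show ?thesis
    proof eventually_elim
      case (elim \<omega>)
      then show ?case
        using assms(2,6) s by (intro free_interpolating_of_pseudo_log) (auto simp: norm_eq)
    qed
  qed
qed

end
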